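(* Assume the Riemann hypothesis (all zeros of $\zeta(s)$ with $0<\Re(s)<1$ satisfy $\Re(s)=\frac12$). Then $\eta'(s)\neq 0$ for all $s=\sigma+it\in\mathbb{C}$ with $0<\sigma<\frac12$.
   Context: $\eta$ is the Euler (Dirichlet) eta function, $\eta(s)=\sum_{n\ge 1}(-1)^{n+1}n^{-s}$ for $\Re(s)>0$, extended to an entire function by $\eta(s)=(1-2^{1-s})\zeta(s)$, where $\zeta$ is the Riemann zeta function. $\eta'$ is its derivative. *)

theory Defs
  imports "HOL-Complex_Analysis.Complex_Analysis"
begin

text \<open>
  The Riemann zeta function is the analytic continuation to the plane without the point 1 of the
  Dirichlet series. The continuation is unique because the punctured plane is connected;
  the equation \<open>f 1 = 0\<close> only fixes the otherwise arbitrary value at the pole.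
\<close>

definition riemann_zeta :: "complex \<Rightarrow> complex" where
  "riemann_zeta = (THE f. f holomorphic_on - {1} \<and>
     (\<forall>s. Re s > 1 \<longrightarrow> (\<lambda>n. of_nat (Suc n) powr (- s)) sums f s) \<and>
     f 1 = 0)"

text \<open>
  The summation index is shifted by one, so the sign \<open>(-1)^(n+1)\<close> of the \<open>n\<close>-th
  term becomes \<open>(-1)^n\<close>. The series converges only conditionally for \<open>0 < Re s \<le> 1\<close>.
  It also supplies the value at \<open>s = 1\<close>, where the product formula has a removable singularity.
\<close>

definition dirichlet_eta :: "complex \<Rightarrow> complex" where
  "dirichlet_eta s =
     (if Re s > 0 then (\<Sum>n. (-1) ^ n * of_nat (Suc n) powr (- s))
      else (1 - 2 powr (1 - s)) * riemann_zeta s)"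

definition riemann_hypothesis :: bool where
  "riemann_hypothesis \<longleftrightarrow>
     (\<forall>s. 0 < Re s \<and> Re s < 1 \<and> riemann_zeta s = 0 \<longrightarrow> Re s = 1 / 2)"

end

theory Submission
  imports Defs "HOL-Real_Asymp.Real_Asymp"
begin

text \<open>
  Let \<open>\<xi>(s) = \<pi>\<^sup>-\<^sup>s\<^sup>/\<^sup>2 \<Gamma>(s/2 + 1) (s - 1) \<zeta>(s)\<close>. For small \<open>a > 0\<close> the quotient \<open>\<xi>(s - a) / \<xi>(s + a)\<close>
  has modulus 1 on the critical line by the functional equation, and under the Riemann hypothesis
  it is holomorphic to the right of it. Being of polynomial growth there, it is bounded by 1, by the
  Phragmen--Lindelof principle. Hence \<open>|\<xi>|\<close> increases with the distance from the critical line, that is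
  \<open>Re (\<xi>'/\<xi>) \<le> 0\<close> to its left; this replaces the Hadamard product. Since
  \<open>\<eta>'/\<eta> = \<xi>'/\<xi> + ln \<pi> / 2 - \<psi>(s/2 + 1) / 2 - 1 / (s - 1) - ln 2 / (1 - 2\<^sup>s\<^sup>-\<^sup>1)\<close>, elementary estimates of the
  explicit terms give \<open>Re (\<eta>'/\<eta>) < 0\<close> for \<open>|Im s| \<ge> 7/2\<close>. In the remaining rectangle \<open>\<eta>'\<close> is
  approximated by an explicit polynomial of degree 8 that is bounded away from 0 there.

  The functional equation is obtained for real \<open>w\<close> in \<open>(-1, 0)\<close> by computing the Mellin transform of
  \<open>1 / (e\<^sup>x - 1) + 1/2 - 1/x\<close> in two ways: from its partial fractions, and as a sum of trapezoid errors
  of \<open>u \<mapsto> e\<^sup>-\<^sup>u\<^sup>x\<close>. All terms are nonnegative, so monotone convergence suffices.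
\<close>

section \<open>Continuation of zeta to the right of \<open>Re s = - 1\<close>\<close>

text \<open>The hypothesis speaks only of the open strip and only of \<open>riemann_zeta\<close>,
  which is a definite description. This forces three preliminaries: a continuation to the whole
  punctured plane must be exhibited before \<open>riemann_zeta\<close> equals anything known, which
  costs the functional equation; zeros on \<open>Re s = 1\<close> have to be excluded separately;
  and 1/zeta needs a polynomial bound to the right of the critical line before Phragmen-Lindelof can
  apply. The pole never enters, because all estimates are made for (s - 1) zeta(s), which a single
  series represents on \<open>Re s > -1\<close>. This half-plane contains the critical strip with
  room to spare and overlaps the half-plane \<open>Re s < 0\<close>, where the functional equation
  takes over. The cut-off 7/2 is a compromise. The digamma term must be large enough, and the pole
  term small enough, to outweigh \<open>ln pi\<close>; at height 7/2 the bounds used achieve this by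
  less than 1/100. Below it a finite computation remains, in a rectangle small enough for a
  polynomial of degree 8 whose modulus exceeds the total approximation error 67/1000.\<close>

lemma holomorphic_on_suminf:
  fixes f :: "nat \<Rightarrow> complex \<Rightarrow> complex"
  assumes "open S" and hol: "\<And>n. f n holomorphic_on S"
    and bound: "\<And>x. x \<in> S \<Longrightarrow> \<exists>d>0. \<exists>M. cball x d \<subseteq> S \<and> summable M \<and> (\<forall>n. \<forall>y\<in>cball x d. norm (f n y) \<le> M n)"
  shows "(\<lambda>z. \<Sum>n. f n z) holomorphic_on S"
proof (rule holomorphic_uniform_sequence[where f = "\<lambda>N z. \<Sum>n<N. f n z", OF \<open>open S\<close>])
  show "(\<lambda>z. \<Sum>n<N. f n z) holomorphic_on S" for N
    by (intro holomorphic_intros hol)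
next
  fix x assume "x \<in> S"
  from bound[OF this] obtain d M where "d > 0" "cball x d \<subseteq> S" "summable M"
    "\<And>n y. y \<in> cball x d \<Longrightarrow> norm (f n y) \<le> M n" by blast
  then show "\<exists>d>0. cball x d \<subseteq> S \<and>
      uniform_limit (cball x d) (\<lambda>N z. \<Sum>n<N. f n z) (\<lambda>z. \<Sum>n. f n z) sequentially"
    using Weierstrass_m_test[of "cball x d" f M] by blast
qed

lemma summable_of_nat_powr:
  assumes "a < -1"
  shows "summable (\<lambda>n. real (n + m) powr a)"
  using summable_iff_shift[of "\<lambda>n. real n powr a" m] summable_real_powr_iff assms by auto

text \<open>Serves both the trapezoid corrections (\<open>c = -1\<close>) and the alternating tails
  (\<open>c = 1 - k\<close>). For \<open>Re s > c\<close> the exponent is below -1; on a small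
  closed disc \<open>B\<close> is bounded by compactness and the exponent stays away from -1, which
  gives the uniform majorant. The shift \<open>m > 0\<close> keeps the base at least 1, so that
  powers are monotone in the exponent.\<close>

lemma dirichlet_like_series:
  fixes f :: "nat \<Rightarrow> complex \<Rightarrow> complex"
  assumes hol: "\<And>n. f n holomorphic_on UNIV" and "continuous_on UNIV B" and m: "m > 0"
    and bound: "\<And>n s. Re s > c \<Longrightarrow> norm (f n s) \<le> B s * real (n + m) powr (- Re s - (1 - c))"
  shows dirichlet_like_series_summable: "Re s > c \<Longrightarrow> summable (\<lambda>n. norm (f n s))"
    and dirichlet_like_series_holomorphic: "(\<lambda>s. \<Sum>n. f n s) holomorphic_on {s. Re s > c}"
proof -
  show "summable (\<lambda>n. norm (f n s))" if "Re s > c"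
    by (rule summable_comparison_test'[where N = 0 and g = "\<lambda>n. B s * real (n + m) powr (- Re s - (1 - c))"])
       (use that bound in \<open>auto intro!: summable_mult summable_of_nat_powr simp del: of_nat_add\<close>)
  show "(\<lambda>s. \<Sum>n. f n s) holomorphic_on {s. Re s > c}"
  proof (rule holomorphic_on_suminf)
    show "open {s. Re s > c}" by (rule open_halfspace_Re_gt)
    show "f n holomorphic_on {s. Re s > c}" for n by (rule holomorphic_on_subset[OF hol]) auto
  next
    fix x assume x: "x \<in> {s. Re s > c}"
    define d where "d = (Re x - c) / 2"
    have d: "d > 0" using x by (simp add: d_def)
    have Re_ge: "Re y \<ge> c + d" if "y \<in> cball x d" for y
    proof -
      have "Re x - Re y \<le> d"
        using that abs_Re_le_cmod[of "x - y"] by (simp add: dist_norm)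
      then show ?thesis unfolding d_def by (simp add: field_simps)
    qed
    have "compact (B ` cball x d)"
      by (intro compact_continuous_image continuous_on_subset[OF assms(2)]) auto
    then obtain C where C: "\<And>y. y \<in> cball x d \<Longrightarrow> norm (B y) \<le> C"
      unfolding bounded_iff[symmetric] using compact_imp_bounded by (force simp: bounded_iff)
    have "norm (f n y) \<le> C * real (n + m) powr (- 1 - d)" if y: "y \<in> cball x d" for n y
    proof -
      have "norm (f n y) \<le> B y * real (n + m) powr (- Re y - (1 - c))"
        using Re_ge[OF y] d by (intro bound) linarith
      also have "\<dots> \<le> C * real (n + m) powr (- Re y - (1 - c))"
        using C[OF y] by (intro mult_right_mono) auto
      also have "\<dots> \<le> C * real (n + m) powr (- 1 - d)"
        using C[OF y] Re_ge[OF y] m by (intro mult_left_mono powr_mono order.trans[OF _ C[OF y]]) auto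
      finally show ?thesis .
    qed
    moreover have "summable (\<lambda>n. C * real (n + m) powr (- 1 - d))"
      using d by (intro summable_mult summable_of_nat_powr) auto
    moreover have "cball x d \<subseteq> {s. Re s > c}" using Re_ge d by fastforce
    ultimately show "\<exists>d>0. \<exists>M. cball x d \<subseteq> {s. Re s > c} \<and> summable M \<and> (\<forall>n. \<forall>y\<in>cball x d. norm (f n y) \<le> M n)"
      using d by blast
  qed
qed

text \<open>This is s - 1 times the error of the trapezoid rule for the integral of
  \<open>u powr (-s)\<close> over [x, x + 1]. The factor s - 1 clears the denominator of the
  antiderivative, so nothing singular remains at s = 1.\<close>

definition trapezoid_term :: "complex \<Rightarrow> complex \<Rightarrow> complex" where
  "trapezoid_term x s = (s - 1) * (x powr (-s) + (x + 1) powr (-s)) / 2 + (x + 1) powr (1 - s) - x powr (1 - s)"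

text \<open>Let the length u of the interval vary: the error \<open>A\<close> vanishes at 0 and its
  derivative is a multiple of \<open>h\<close>, which again vanishes at 0 and whose derivative is
  controlled by \<open>x powr (- Re s - 2)\<close>. The mean value inequality is applied
  twice.\<close>

lemma norm_trapezoid_term_le:
  assumes "x > 0" "Re s \<ge> - 2"
  shows "norm (trapezoid_term (of_real x) s) \<le> norm ((s - 1) * s * (s + 1)) / 2 * x powr (- Re s - 2)"
proof -
  define U where "U = closed_segment 0 (1::complex)"
  have U: "\<exists>v. u = of_real v \<and> 0 \<le> v \<and> v \<le> 1" if "u \<in> U" for u
    using that unfolding U_def in_segment by (auto simp: scaleR_conv_of_real)
  have U01: "0 \<in> U" "1 \<in> U" "convex U" unfolding U_def by auto
  have pos: "of_real x + u \<notin> \<real>\<^sub>\<le>\<^sub>0" if "u \<in> U" for u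
    using U[OF that] assms by (auto simp: complex_nonpos_Reals_iff)
  define h where "h u = of_real x powr (-s) - (of_real x + u) powr (-s) - s * u * (of_real x + u) powr (-s-1)" for u
  define A where "A u = (s - 1) * u * (of_real x powr (-s) + (of_real x + u) powr (-s)) / 2
      + (of_real x + u) powr (1 - s) - of_real x powr (1 - s)" for u
  let ?K = "norm (s * (s + 1)) * x powr (- Re s - 2)"
  have h0: "h 0 = 0" by (simp add: h_def)
  have dh: "(h has_field_derivative s * (s + 1) * u * (of_real x + u) powr (-s-2)) (at u within U)" if "u \<in> U" for u
    unfolding h_def using pos[OF that]
    by (auto intro!: derivative_eq_intros simp: algebra_simps)
  have dA: "(A has_field_derivative (s - 1) / 2 * h u) (at u within U)" if "u \<in> U" for u
    unfolding A_def h_def using pos[OF that]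
    by (auto intro!: derivative_eq_intros simp: field_simps)
  have h_le: "norm (h u) \<le> ?K" if "u \<in> U" for u
  proof -
    have "norm (h u - h 0) \<le> ?K * norm (u - 0)"
    proof (rule field_differentiable_bound[OF U01(3) dh _ that U01(1)])
      fix v assume "v \<in> U"
      then obtain r where r: "v = of_real r" "0 \<le> r" "r \<le> 1" using U by blast
      have "norm ((of_real x + v) powr (-s-2)) = (x + r) powr (- Re s - 2)"
        using r assms by (subst norm_powr_real_powr) (auto simp flip: of_real_add)
      also have "\<dots> \<le> x powr (- Re s - 2)"
        using assms r by (intro powr_mono2') auto
      finally have "norm v * norm ((of_real x + v) powr (-s-2)) \<le> 1 * x powr (- Re s - 2)"
        using r by (intro mult_mono) auto
      then show "norm (s * (s + 1) * v * (of_real x + v) powr (-s-2)) \<le> ?K"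
        by (simp add: norm_mult mult.assoc mult_left_mono)
    qed
    moreover have "?K * norm u \<le> ?K * 1"
      using U[OF that] by (intro mult_left_mono) auto
    ultimately show ?thesis using h0 by simp
  qed
  have "norm (A 1 - A 0) \<le> norm ((s - 1) / 2) * ?K * norm (1 - 0 :: complex)"
    by (rule field_differentiable_bound[OF U01(3) dA _ U01(2,1)])
       (auto simp: norm_mult norm_divide intro!: divide_right_mono mult_left_mono h_le[unfolded norm_mult])
  then show ?thesis
    by (simp add: A_def trapezoid_term_def norm_mult norm_divide mult_ac)
qed

text \<open>The Euler-Maclaurin formula for (s - 1) zeta(s): the summand 1 is s - 1 times the
  integral of \<open>u powr (-s)\<close> from 1 to infinity, and (s - 1) / 2 accounts for half of
  the first term of the Dirichlet series.\<close>

definition zeta_reg :: "complex \<Rightarrow> complex" where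
  "zeta_reg s = 1 + (s - 1) / 2 + (\<Sum>n. trapezoid_term (of_nat (Suc n)) s)"

lemma of_nat_Suc_plus_1_neq_0: "of_nat (Suc n) + 1 \<noteq> (0 :: complex)"
  by (metis add.commute nat.distinct(1) of_nat_Suc of_nat_eq_0_iff)

lemma trapezoid_term_holomorphic: "x \<noteq> 0 \<Longrightarrow> x + 1 \<noteq> 0 \<Longrightarrow> trapezoid_term x holomorphic_on A"
  unfolding trapezoid_term_def by (intro holomorphic_intros) auto

lemma
  shows zeta_reg_summable: "Re s > -1 \<Longrightarrow> summable (\<lambda>n. norm (trapezoid_term (of_nat (Suc n)) s))"
    and zeta_reg_holomorphic: "zeta_reg holomorphic_on {s. Re s > -1}"
proof -
  let ?B = "\<lambda>s::complex. norm ((s - 1) * s * (s + 1)) / 2"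
  have bd: "norm (trapezoid_term (of_nat (Suc n)) s) \<le> ?B s * real (n + 1) powr (- Re s - (1 - (-1)))"
    if "Re s > -1" for n s
    using norm_trapezoid_term_le[of "real (n + 1)" s] that by simp
  have hol: "trapezoid_term (of_nat (Suc n)) holomorphic_on UNIV" for n
    using of_nat_Suc_plus_1_neq_0[of n] by (intro trapezoid_term_holomorphic) (simp_all del: of_nat_Suc)
  have cont: "continuous_on UNIV ?B" by (intro continuous_intros) auto
  show "Re s > -1 \<Longrightarrow> summable (\<lambda>n. norm (trapezoid_term (of_nat (Suc n)) s))"
    by (rule dirichlet_like_series_summable[OF hol cont _ bd]) auto
  have "(\<lambda>s. \<Sum>n. trapezoid_term (of_nat (Suc n)) s) holomorphic_on {s. Re s > -1}"
    by (rule dirichlet_like_series_holomorphic[OF hol cont _ bd]) auto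
  then show "zeta_reg holomorphic_on {s. Re s > -1}"
    unfolding zeta_reg_def by (intro holomorphic_intros) auto
qed

lemma of_nat_powr_tendsto_0:
  assumes "Re s > 0"
  shows "(\<lambda>n. of_nat (Suc n) powr (- s) :: complex) \<longlonglongrightarrow> 0"
proof -
  have "(\<lambda>n. real (Suc n) powr (- Re s)) \<longlonglongrightarrow> 0"
    using assms by (intro tendsto_neg_powr filterlim_compose[OF filterlim_real_sequentially] filterlim_Suc) auto
  then show ?thesis
    by (rule Lim_null_comparison[rotated])
       (auto simp: norm_powr_real_powr intro!: always_eventually simp del: of_nat_Suc)
qed

lemma summable_norm_powr:
  assumes "Re s > 1"
  shows "summable (\<lambda>n. norm (of_nat (Suc n) powr (- s) :: complex))"
  using summable_of_nat_powr[of "- Re s" 1] assms by (simp add: norm_powr_real_powr)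

lemma zeta_reg_sums:
  assumes s: "Re s > 1"
  shows "(\<lambda>n. (s - 1) * of_nat (Suc n) powr (- s)) sums zeta_reg s"
proof -
  let ?f = "\<lambda>n. of_nat (Suc n) powr (- s) :: complex"
  define S where "S = (\<Sum>n. ?f n)"
  have S: "?f sums S" unfolding S_def
    using summable_norm_cancel[OF summable_norm_powr[OF s]] by (rule summable_sums)
  have S': "(\<lambda>n. ?f (Suc n)) sums (S - 1)"
    using S by (subst sums_Suc_iff) simp
  have "(\<lambda>n. of_nat (Suc n) powr (1 - s) :: complex) \<longlonglongrightarrow> 0"
    using of_nat_powr_tendsto_0[of "s - 1"] s by simp
  then have T: "(\<lambda>n. of_nat (Suc (Suc n)) powr (1 - s) - of_nat (Suc n) powr (1 - s) :: complex) sums (0 - 1)"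
    using telescope_sums[of "\<lambda>n. of_nat (Suc n) powr (1 - s) :: complex" 0] by simp
  have "(\<lambda>n. (s - 1) / 2 * (?f n + ?f (Suc n)) + (of_nat (Suc (Suc n)) powr (1 - s) - of_nat (Suc n) powr (1 - s)))
      sums ((s - 1) / 2 * (S + (S - 1)) + (0 - 1))"
    by (intro sums_add sums_mult S S' T)
  also have "(\<lambda>n. (s - 1) / 2 * (?f n + ?f (Suc n)) + (of_nat (Suc (Suc n)) powr (1 - s) - of_nat (Suc n) powr (1 - s)))
      = (\<lambda>n. trapezoid_term (of_nat (Suc n)) s)"
    by (simp add: trapezoid_term_def fun_eq_iff field_simps)
  finally have "zeta_reg s = 1 + (s - 1) / 2 + ((s - 1) / 2 * (S + (S - 1)) + (0 - 1))"
    unfolding zeta_reg_def by (simp add: sums_unique[symmetric])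
  also have "\<dots> = (s - 1) * S" by (simp add: field_simps)
  finally show ?thesis using sums_mult[OF S, of "s - 1"] by simp
qed

lemma cnj_zeta_reg: "Re s > -1 \<Longrightarrow> cnj (zeta_reg s) = zeta_reg (cnj s)"
proof -
  assume s: "Re s > -1"
  have c: "cnj (of_nat k powr z) = of_nat k powr cnj z" for k z
    by (simp add: cnj_powr)
  have "cnj (trapezoid_term (of_nat (Suc n)) s) = trapezoid_term (of_nat (Suc n)) (cnj s)" for n
    using c[of "Suc n"] c[of "Suc (Suc n)"] by (simp add: trapezoid_term_def add_ac)
  moreover have "(\<lambda>n. cnj (trapezoid_term (of_nat (Suc n)) s)) sums cnj (\<Sum>n. trapezoid_term (of_nat (Suc n)) s)"
    using summable_norm_cancel[OF zeta_reg_summable[OF s]] by (simp add: sums_cnj summable_sums)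
  ultimately show ?thesis by (simp add: zeta_reg_def sums_iff)
qed

lemma zeta_reg_growth:
  assumes "d > 0"
  obtains C where "C > 0" "\<And>s. Re s \<ge> -1 + d \<Longrightarrow> norm (zeta_reg s) \<le> C * (1 + norm s) ^ 3"
proof
  define M where "M = (\<Sum>n. real (n + 1) powr (- 1 - d))"
  have sM: "summable (\<lambda>n. real (n + 1) powr (- 1 - d))"
    using assms by (intro summable_of_nat_powr) auto
  have M: "M \<ge> 0" unfolding M_def by (intro suminf_nonneg sM) auto
  show "2 + M > 0" using M by simp
  fix s assume s: "Re s \<ge> -1 + d"
  let ?y = "1 + norm s"
  have y1: "?y \<ge> 1" by simp
  have "norm ((s - 1) * s * (s + 1)) \<le> ?y * ?y * ?y"
    unfolding norm_mult using norm_triangle_ineq4[of s 1] norm_triangle_ineq[of s 1]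
    by (intro mult_mono) auto
  then have B: "norm ((s - 1) * s * (s + 1)) / 2 \<le> ?y ^ 3"
    using norm_ge_zero[of "(s - 1) * s * (s + 1)"] unfolding power3_eq_cube by linarith
  have "norm (trapezoid_term (of_nat (Suc n)) s) \<le> ?y ^ 3 * real (n + 1) powr (- 1 - d)" for n
  proof -
    have "norm (trapezoid_term (of_nat (Suc n)) s) \<le> norm ((s - 1) * s * (s + 1)) / 2 * real (n + 1) powr (- Re s - 2)"
      using norm_trapezoid_term_le[of "real (n + 1)" s] s assms by simp
    also have "\<dots> \<le> ?y ^ 3 * real (n + 1) powr (- 1 - d)"
      using s by (intro mult_mono[OF B] powr_mono) auto
    finally show ?thesis .
  qed
  then have "norm (\<Sum>n. trapezoid_term (of_nat (Suc n)) s) \<le> (\<Sum>n. ?y ^ 3 * real (n + 1) powr (- 1 - d))"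
    by (intro norm_suminf_le summable_mult sM) auto
  also have "\<dots> = ?y ^ 3 * M" unfolding M_def by (rule suminf_mult[OF sM])
  finally have T: "norm (\<Sum>n. trapezoid_term (of_nat (Suc n)) s) \<le> ?y ^ 3 * M" .
  have "norm (1 + (s - 1) / 2) = norm (s + 1) / 2" by (simp add: field_simps flip: norm_divide_numeral)
  also have "\<dots> \<le> ?y"
    using norm_triangle_ineq[of s 1] norm_ge_zero[of s] unfolding norm_one by linarith
  also have "\<dots> \<le> ?y ^ 3" using y1 power_increasing[of 1 3 ?y] by simp
  finally have U: "norm (1 + (s - 1) / 2) \<le> ?y ^ 3" .
  have y3: "?y ^ 3 \<ge> 0" by simp
  have "norm (zeta_reg s) \<le> ?y ^ 3 + ?y ^ 3 * M" 
    unfolding zeta_reg_def by (rule norm_triangle_le[OF add_mono[OF U T]])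
  also have "\<dots> \<le> (2 + M) * ?y ^ 3" using y3 by (simp add: algebra_simps)
  finally show "norm (zeta_reg s) \<le> (2 + M) * ?y ^ 3" .
qed

lemma zeta_reg_1 [simp]: "zeta_reg 1 = 1"
  using of_nat_Suc_plus_1_neq_0 by (simp add: zeta_reg_def trapezoid_term_def del: of_nat_Suc)

section \<open>The Euler product and the line \<open>Re s = 1\<close>\<close>

definition sifted :: "nat set \<Rightarrow> nat set" where
  "sifted A = {n. n > 0 \<and> (\<forall>p\<in>A. \<not> p dvd n)}"

lemma abs_summable_on_powr:
  assumes "Re s > 1"
  shows "(\<lambda>n. norm (of_nat n powr (- s) :: complex)) summable_on A"
proof (rule summable_on_subset_banach)
  have "summable (\<lambda>n. norm (of_nat n powr (- s) :: complex))"
    using summable_norm_powr[OF assms] by (subst (asm) summable_Suc_iff)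
  then show "(\<lambda>n. norm (of_nat n powr (- s) :: complex)) summable_on UNIV"
    by (intro norm_summable_imp_summable_on) auto
qed auto

text \<open>Sieving by q removes the multiples of q, and among the numbers already sifted these are
  exactly q times the sifted set: a prime in \<open>A\<close> does not divide q, so it divides
  \<open>q * n\<close> only if it divides n.\<close>

lemma sifted_insert:
  assumes "Re s > 1" "prime q" "q \<notin> A" "\<And>p. p \<in> A \<Longrightarrow> prime p"
  shows "infsum (\<lambda>n. of_nat n powr (- s) :: complex) (sifted (insert q A)) =
         (1 - of_nat q powr (- s)) * infsum (\<lambda>n. of_nat n powr (- s)) (sifted A)"
proof -
  let ?f = "\<lambda>n. of_nat n powr (- s) :: complex"
  have q: "q > 0" using assms(2) by (simp add: prime_gt_0_nat)
  have sm: "?f summable_on B" for B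
    using abs_summable_on_powr[OF assms(1)] by (rule abs_summable_summable)
  have *: "p dvd q * n \<longleftrightarrow> p dvd n" if "p \<in> A" for p n
  proof -
    have "\<not> p dvd q" using assms that primes_dvd_imp_eq by metis
    then show ?thesis using assms(4)[OF that] by (simp add: prime_dvd_mult_iff)
  qed
  have split: "sifted A = sifted (insert q A) \<union> (*) q ` sifted A"
  proof (intro equalityI subsetI)
    fix n assume n: "n \<in> sifted A"
    show "n \<in> sifted (insert q A) \<union> (*) q ` sifted A"
    proof (cases "q dvd n")
      case True
      then obtain m where "n = q * m" by blast
      then show ?thesis using n * by (auto simp: sifted_def)
    qed (use n in \<open>auto simp: sifted_def\<close>)
  qed (use * q in \<open>auto simp: sifted_def\<close>)
  have "infsum ?f (sifted A) = infsum ?f (sifted (insert q A)) + infsum ?f ((*) q ` sifted A)"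
    by (subst split, rule infsum_Un_disjoint[OF sm sm]) (auto simp: sifted_def)
  also have "infsum ?f ((*) q ` sifted A) = infsum (?f \<circ> (*) q) (sifted A)"
    using q by (intro infsum_reindex) (auto simp: inj_on_def)
  also have "?f \<circ> (*) q = (\<lambda>n. of_nat q powr (- s) * ?f n)"
    by (auto simp: powr_times_real fun_eq_iff)
  also have "infsum \<dots> (sifted A) = of_nat q powr (- s) * infsum ?f (sifted A)"
    by (rule infsum_cmult_right) (rule sm)
  finally show ?thesis by (simp add: algebra_simps)
qed

text \<open>The reciprocal of the truncated Euler product. In this form only finite products occur,
  and zeta times it tends to 1.\<close>

definition euler_prod :: "nat \<Rightarrow> complex \<Rightarrow> complex" where
  "euler_prod N s = (\<Prod>p | prime p \<and> p \<le> N. 1 - of_nat p powr (- s))"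

lemma infsum_sifted:
  assumes "Re s > 1" "finite A" "\<And>p. p \<in> A \<Longrightarrow> prime p"
  shows "infsum (\<lambda>n. of_nat n powr (- s) :: complex) (sifted A) =
         (\<Prod>p\<in>A. 1 - of_nat p powr (- s)) * infsum (\<lambda>n. of_nat n powr (- s)) {0<..}"
  using assms(2,3)
proof (induction A rule: finite_induct)
  case empty
  have "sifted {} = {0<..}" by (auto simp: sifted_def)
  then show ?case by simp
next
  case (insert q A)
  then show ?case using sifted_insert[OF assms(1), of q A] by (simp add: mult_ac)
qed

lemma zeta_reg_eq_infsum:
  assumes "Re s > 1"
  shows "zeta_reg s = (s - 1) * infsum (\<lambda>n. of_nat n powr (- s)) {0<..}"
proof -
  let ?f = "\<lambda>n. of_nat n powr (- s) :: complex"
  have "(\<lambda>n. norm (?f n)) summable_on UNIV" by (rule abs_summable_on_powr[OF assms])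
  then have "(?f has_sum infsum ?f UNIV) UNIV"
    by (rule has_sum_infsum[OF abs_summable_summable])
  then have "?f sums infsum ?f UNIV" by (rule has_sum_imp_sums)
  then have "(\<lambda>n. ?f (Suc n)) sums infsum ?f UNIV"
    by (subst sums_Suc_iff[of ?f]) simp
  from sums_mult[OF this, of "s - 1"] zeta_reg_sums[OF assms]
  have "zeta_reg s = (s - 1) * infsum ?f UNIV" by (metis sums_unique2)
  \<comment> \<open>The index 0 contributes nothing because \<open>0 powr (- s)\<close> is
    0.\<close>
  also have "infsum ?f UNIV = infsum ?f {0<..}"
    by (rule infsum_cong_neutral) auto
  finally show ?thesis .
qed

text \<open>After sieving by all primes up to N, every survivor other than 1 exceeds N. So the
  sifted sum differs from 1 by at most a tail of an absolutely convergent series.\<close>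

lemma euler_prod_tendsto:
  assumes s: "Re s > 1"
  shows "(\<lambda>N. zeta_reg s * euler_prod N s) \<longlonglongrightarrow> s - 1"
proof -
  let ?f = "\<lambda>n. of_nat n powr (- s) :: complex"
  define P where "P N = {p. prime p \<and> p \<le> (N::nat)}" for N
  have fin: "finite (P N)" for N unfolding P_def by (rule finite_subset[of _ "{..N}"]) auto
  have sm: "(\<lambda>n. norm (?f n)) summable_on B" for B by (rule abs_summable_on_powr[OF s])
  note sm' = abs_summable_summable[OF sm]
  have eq: "infsum ?f (sifted (P N)) - 1 = infsum ?f (sifted (P N) - {1})" for N
  proof -
    have "sifted (P N) = {1} \<union> (sifted (P N) - {1})"
      by (auto simp: sifted_def P_def)
    then have "infsum ?f (sifted (P N)) = infsum ?f ({1} \<union> (sifted (P N) - {1}))" by simp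
    also have "\<dots> = infsum ?f {1} + infsum ?f (sifted (P N) - {1})"
      by (rule infsum_Un_disjoint) (use sm' in auto)
    finally show ?thesis by simp
  qed
  have sub: "sifted (P N) - {1} \<subseteq> {N<..}" for N
  proof
    fix n assume n: "n \<in> sifted (P N) - {1}"
    then obtain p where p: "prime p" "p dvd n" using prime_factor_nat[of n] by (auto simp: sifted_def)
    then have "p \<le> n" using n by (auto simp: sifted_def intro: dvd_imp_le)
    moreover have "p > N" using p n by (force simp: sifted_def P_def)
    ultimately show "n \<in> {N<..}" by simp
  qed
  have bd: "norm (infsum ?f (sifted (P N)) - 1) \<le> infsum (\<lambda>n. norm (?f n)) UNIV - (\<Sum>n\<in>{..N}. norm (?f n))" for N
  proof -
    have "norm (infsum ?f (sifted (P N)) - 1) \<le> infsum (\<lambda>n. norm (?f n)) (sifted (P N) - {1})"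
      unfolding eq by (rule norm_infsum_bound[OF sm])
    also have "\<dots> \<le> infsum (\<lambda>n. norm (?f n)) {N<..}"
      by (rule infsum_mono_neutral[OF sm sm]) (use sub in auto)
    also have "infsum (\<lambda>n. norm (?f n)) UNIV = infsum (\<lambda>n. norm (?f n)) ({..N} \<union> {N<..})"
      by (rule arg_cong[where f = "infsum _"]) auto
    then have "infsum (\<lambda>n. norm (?f n)) {N<..} = infsum (\<lambda>n. norm (?f n)) UNIV - (\<Sum>n\<in>{..N}. norm (?f n))"
      by (subst (asm) infsum_Un_disjoint) (use sm in auto)
    finally show ?thesis .
  qed
  have "(\<lambda>N. infsum (\<lambda>n. norm (?f n)) UNIV - (\<Sum>n\<in>{..N}. norm (?f n))) \<longlonglongrightarrow>
      infsum (\<lambda>n. norm (?f n)) UNIV - infsum (\<lambda>n. norm (?f n)) UNIV"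
    using has_sum_imp_sums[OF has_sum_infsum[OF sm]]
    by (intro tendsto_intros) (simp add: sums_def_le)
  then have "(\<lambda>N. infsum ?f (sifted (P N)) - 1) \<longlonglongrightarrow> 0"
    by (intro Lim_null_comparison[OF always_eventually[OF allI[OF bd]]]) simp
  then have "(\<lambda>N. (s - 1) * infsum ?f (sifted (P N))) \<longlonglongrightarrow> (s - 1) * 1"
    by (intro tendsto_intros) (simp add: LIM_zero_iff)
  moreover have "(s - 1) * infsum ?f (sifted (P N)) = zeta_reg s * euler_prod N s" for N
    using infsum_sifted[OF s fin, of N] zeta_reg_eq_infsum[OF s]
    by (simp add: euler_prod_def P_def mult_ac)
  ultimately show ?thesis by simp
qed

lemma zeta_reg_nonzero_Re_gt_1: "Re s > 1 \<Longrightarrow> zeta_reg s \<noteq> 0"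
  using euler_prod_tendsto[of s] LIMSEQ_unique[OF tendsto_const, of 0 "s - 1"] by auto

section \<open>The 3-4-1 inequality and the absence of zeros on Re s = 1\<close>

lemma three_four_one:
  fixes x :: real and z :: complex
  assumes "0 \<le> x" "x < 1" "norm z = 1"
  shows "norm ((1 - of_real x) ^ 3 * (1 - of_real x * z) ^ 4 * (1 - of_real x * z\<^sup>2)) \<le> 1"
proof -
  define L where "L w = Ln (1 - of_real x * w)" for w
  have small: "norm (of_real x * w) < 1" if "norm w = 1" for w :: complex
    using assms that by (simp add: norm_mult)
  have nz: "1 - of_real x * w \<noteq> 0" if "norm w = 1" for w :: complex
    using small[OF that] by auto
  have L: "(\<lambda>n. - (x ^ n / n) * Re (w ^ n)) sums Re (L w)" if "norm w = 1" for w
  proof -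
    have "(\<lambda>n. (-1) ^ Suc n / of_nat n * (- (of_real x * w)) ^ n) sums Ln (1 + - (of_real x * w))"
      using small[OF that] by (intro Ln_series) simp
    then have "(\<lambda>n. Re ((-1) ^ Suc n / of_nat n * (- (of_real x * w)) ^ n)) sums Re (L w)"
      unfolding L_def by (intro sums_Re) simp
    moreover have "(-1) ^ Suc n / of_nat n * (- (of_real x * w)) ^ n = of_real (- (x ^ n / n)) * w ^ n" for n
      by (subst power_minus) (simp add: power_mult_distrib flip: power_mult_distrib[of "-1" "-1"])
    ultimately show ?thesis
      by (simp only: times_complex.sel Re_complex_of_real Im_complex_of_real mult_zero_left diff_zero)
  qed
  have "(\<lambda>n. 3 * (- (x ^ n / n) * Re (1 ^ n)) + 4 * (- (x ^ n / n) * Re (z ^ n)) + - (x ^ n / n) * Re ((z\<^sup>2) ^ n))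
      sums (3 * Re (L 1) + 4 * Re (L z) + Re (L (z\<^sup>2)))"
    using assms by (intro sums_add sums_mult L) (auto simp: norm_power)
  moreover have "3 * (- (x ^ n / n) * Re (1 ^ n)) + 4 * (- (x ^ n / n) * Re (z ^ n)) + - (x ^ n / n) * Re ((z\<^sup>2) ^ n) \<le> 0" for n
  proof -
    define u where "u = z ^ n"
    have "(Re u)\<^sup>2 + (Im u)\<^sup>2 = 1"
      using assms cmod_power2[of u] by (simp add: u_def norm_power)
    then have R: "Re (u\<^sup>2) = 2 * (Re u)\<^sup>2 - 1" by (simp add: power2_eq_square)
    have z2: "(z\<^sup>2) ^ n = u\<^sup>2" by (simp add: u_def mult.commute flip: power_mult)
    \<comment> \<open>With \<open>Re u\<close> as a cosine this is 3 + 4 cos a + cos 2a = 2 (1 + cos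
      a)^2, the source of the exponents 3, 4 and 1.\<close>
    have "3 * (- (x ^ n / n) * Re (1 ^ n)) + 4 * (- (x ^ n / n) * Re (z ^ n)) + - (x ^ n / n) * Re ((z\<^sup>2) ^ n)
        = - (x ^ n / n) * (2 * (1 + Re u)\<^sup>2)"
      unfolding z2 R u_def[symmetric] by (simp add: power2_eq_square algebra_simps)
    also have "\<dots> \<le> 0" using assms by (intro mult_nonpos_nonneg) auto
    finally show ?thesis .
  qed
  ultimately have le: "3 * Re (L 1) + 4 * Re (L z) + Re (L (z\<^sup>2)) \<le> 0"
    by (rule sums_le[OF _ _ sums_zero, rotated])
  have e: "norm (1 - of_real x * w) = exp (Re (L w))" if "norm w = 1" for w
    using nz[OF that] by (simp add: L_def flip: norm_exp_eq_Re)
  have z2: "norm (z\<^sup>2) = 1" using assms by (simp add: norm_power)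
  have "norm ((1 - of_real x) ^ 3 * (1 - of_real x * z) ^ 4 * (1 - of_real x * z\<^sup>2)) =
      exp (Re (L 1)) ^ 3 * exp (Re (L z)) ^ 4 * exp (Re (L (z\<^sup>2)))"
    using e[of 1] e[OF assms(3)] e[OF z2] by (simp add: norm_mult norm_power)
  also have "\<dots> = exp (3 * Re (L 1) + 4 * Re (L z) + Re (L (z\<^sup>2)))"
    by (simp add: exp_add exp_of_nat_mult[of 3, simplified] exp_of_nat_mult[of 4, simplified])
  also have "\<dots> \<le> 1" using le by simp
  finally show ?thesis .
qed

lemma euler_prod_three_four_one:
  assumes "\<sigma> > 1"
  shows "norm (euler_prod N (of_real \<sigma>) ^ 3 * euler_prod N (Complex \<sigma> t) ^ 4 * euler_prod N (Complex \<sigma> (2 * t))) \<le> 1"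
proof -
  have "norm ((1 - of_nat p powr (- of_real \<sigma>)) ^ 3 * (1 - of_nat p powr (- Complex \<sigma> t)) ^ 4 *
         (1 - of_nat p powr (- Complex \<sigma> (2 * t))) :: complex) \<le> 1" if "prime p" for p :: nat
  proof -
    define z :: complex where "z = of_nat p powr (- \<i> * of_real t)"
    have p: "real p > 1" using prime_gt_1_nat[OF that] by simp
    have x: "of_nat p powr (- of_real \<sigma>) = complex_of_real (real p powr (- \<sigma>))"
      using powr_of_real[of "real p" "- \<sigma>"] by simp
    have 1: "of_nat p powr (- Complex \<sigma> t) = of_real (real p powr (- \<sigma>)) * z"
      unfolding z_def x[symmetric] powr_add[symmetric] by (rule arg_cong[where f = "(powr) _"]) (simp add: complex_eq_iff)
    have 2: "of_nat p powr (- Complex \<sigma> (2 * t)) = of_real (real p powr (- \<sigma>)) * z\<^sup>2"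
      unfolding z_def x[symmetric] power2_eq_square powr_add[symmetric] by (rule arg_cong[where f = "(powr) _"]) (simp add: complex_eq_iff)
    show ?thesis unfolding 1 2 unfolding x
    proof (rule three_four_one)
      show "real p powr (- \<sigma>) < 1" using p assms by (simp add: powr_less_one)
      show "norm z = 1" using p unfolding z_def by (subst norm_powr_real_powr) auto
    qed auto
  qed
  then have "(\<Prod>p | prime p \<and> p \<le> N. norm ((1 - of_nat p powr (- of_real \<sigma>)) ^ 3 * (1 - of_nat p powr (- Complex \<sigma> t)) ^ 4 *
         (1 - of_nat p powr (- Complex \<sigma> (2 * t))) :: complex)) \<le> 1"
    by (intro prod_le_1) auto
  then show ?thesis
    unfolding prod_norm prod.distrib prod_power_distrib[symmetric] euler_prod_def .
qed

lemma zeta_reg_three_four_one: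
  assumes "\<sigma> > 1"
  shows "norm ((of_real \<sigma> - 1) ^ 3 * (Complex \<sigma> t - 1) ^ 4 * (Complex \<sigma> (2 * t) - 1)) \<le>
         norm (zeta_reg (of_real \<sigma>) ^ 3 * zeta_reg (Complex \<sigma> t) ^ 4 * zeta_reg (Complex \<sigma> (2 * t)))"
    (is "norm ?a \<le> norm ?b")
proof (rule tendsto_upperbound)
  let ?E = "\<lambda>N. (zeta_reg (of_real \<sigma>) * euler_prod N (of_real \<sigma>)) ^ 3 * (zeta_reg (Complex \<sigma> t) * euler_prod N (Complex \<sigma> t)) ^ 4
    * (zeta_reg (Complex \<sigma> (2 * t)) * euler_prod N (Complex \<sigma> (2 * t)))"
  show "(\<lambda>N. norm (?E N)) \<longlonglongrightarrow> norm ?a"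
    using assms by (intro tendsto_intros euler_prod_tendsto) auto
  have "norm (?E N) \<le> norm ?b" for N
  proof -
    have "norm (?E N) = norm ?b * norm (euler_prod N (of_real \<sigma>) ^ 3 * euler_prod N (Complex \<sigma> t) ^ 4 * euler_prod N (Complex \<sigma> (2 * t)))"
      by (simp add: norm_mult norm_power power_mult_distrib mult_ac)
    also have "\<dots> \<le> norm ?b * 1"
      by (intro mult_left_mono euler_prod_three_four_one assms) auto
    finally show ?thesis by simp
  qed
  then show "\<forall>\<^sub>F N in sequentially. norm (?E N) \<le> norm ?b" by simp
qed auto

lemma zeta_reg_differentiable:
  assumes "Re s > -1"
  shows "(zeta_reg has_field_derivative deriv zeta_reg s) (at s)"
  using assms zeta_reg_holomorphic open_halfspace_Re_gt[of "-1"] by (intro holomorphic_derivI) auto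

lemma zeta_reg_isCont: "Re s > -1 \<Longrightarrow> isCont zeta_reg s"
  using zeta_reg_differentiable DERIV_isCont by blast

text \<open>In \<open>zeta_reg_three_four_one\<close> at abscissa 1 + h, divide by h^3, the modulus
  of the factor belonging to the pole. A zero at 1 + it makes the fourth power of order h^4, so the
  right side tends to 0, while the left side tends to the modulus of (it)^4 (2it).\<close>

lemma zeta_reg_nonzero_Re_eq_1: "zeta_reg (Complex 1 t) \<noteq> 0"
proof
  assume z: "zeta_reg (Complex 1 t) = 0"
  have t: "t \<noteq> 0" using z by (auto simp: Complex_eq)
  have lim: "((\<lambda>h. Complex (1 + h) u) \<longlongrightarrow> Complex 1 u) (at_right 0)" for u
    by (auto intro!: tendsto_eq_intros simp: Complex_eq)
  have limZ: "((\<lambda>h. zeta_reg (Complex (1 + h) u)) \<longlongrightarrow> zeta_reg (Complex 1 u)) (at_right 0)" for u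
    by (rule isCont_tendsto_compose[OF zeta_reg_isCont lim]) auto
  have "((\<lambda>h. (zeta_reg (Complex 1 t + h) - zeta_reg (Complex 1 t)) / h) \<longlongrightarrow> deriv zeta_reg (Complex 1 t)) (at 0)"
    using zeta_reg_differentiable[of "Complex 1 t"] by (simp add: DERIV_def)
  moreover have "filterlim complex_of_real (at 0) (at_right 0)"
    unfolding filterlim_at by (auto intro!: tendsto_eq_intros simp: eventually_at_filter)
  ultimately have "((\<lambda>h. (zeta_reg (Complex 1 t + of_real h) - zeta_reg (Complex 1 t)) / of_real h) \<longlongrightarrow> deriv zeta_reg (Complex 1 t)) (at_right 0)"
    by (rule filterlim_compose)
  moreover have "Complex 1 t + of_real h = Complex (1 + h) t" for h
    by (simp add: complex_eq_iff)
  ultimately have q: "((\<lambda>h. zeta_reg (Complex (1 + h) t) / of_real h) \<longlongrightarrow> deriv zeta_reg (Complex 1 t)) (at_right 0)"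
    using z by simp
  let ?A = "\<lambda>h. norm ((Complex (1 + h) t - 1) ^ 4 * (Complex (1 + h) (2 * t) - 1))"
  let ?B = "\<lambda>h. norm (zeta_reg (Complex (1 + h) 0) ^ 3 * (zeta_reg (Complex (1 + h) t) / of_real h) ^ 4 * of_real h * zeta_reg (Complex (1 + h) (2 * t)))"
  have le: "?A h \<le> ?B h" if "h > 0" for h
  proof -
    have eq: "complex_of_real (1 + h) = Complex (1 + h) 0" by (simp add: complex_eq_iff)
    have eq2: "Complex (1 + h) 0 - 1 = of_real h" by (simp add: complex_eq_iff)
    have "h ^ 3 * ?A h \<le> norm (zeta_reg (Complex (1 + h) 0) ^ 3 * zeta_reg (Complex (1 + h) t) ^ 4 * zeta_reg (Complex (1 + h) (2 * t)))"
      using zeta_reg_three_four_one[of "1 + h" t] that unfolding eq eq2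
      by (simp add: norm_mult norm_power mult.assoc)
    also have "\<dots> = h ^ 3 * ?B h"
      using that by (simp add: norm_mult norm_power norm_divide field_simps power3_eq_cube power4_eq_xxxx)
    finally show ?thesis using that by simp
  qed
  have "norm ((Complex 1 t - 1) ^ 4 * (Complex 1 (2 * t) - 1)) \<le>
        norm (zeta_reg (Complex 1 0) ^ 3 * deriv zeta_reg (Complex 1 t) ^ 4 * of_real 0 * zeta_reg (Complex 1 (2 * t)))"
  proof (rule tendsto_le)
    show "(?A \<longlongrightarrow> norm ((Complex 1 t - 1) ^ 4 * (Complex 1 (2 * t) - 1))) (at_right 0)"
      by (intro tendsto_intros lim)
    show "(?B \<longlongrightarrow> norm (zeta_reg (Complex 1 0) ^ 3 * deriv zeta_reg (Complex 1 t) ^ 4 * of_real 0 * zeta_reg (Complex 1 (2 * t)))) (at_right 0)"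
      by (intro tendsto_intros limZ q)
    show "\<forall>\<^sub>F h in at_right 0. ?A h \<le> ?B h"
      using le by (auto simp: eventually_at_filter)
  qed simp
  moreover have "Complex 1 t - 1 \<noteq> 0" "Complex 1 (2 * t) - 1 \<noteq> 0"
    using t by (simp_all add: complex_eq_iff)
  ultimately show False by simp
qed

lemma zeta_reg_nonzero: "Re s \<ge> 1 \<Longrightarrow> zeta_reg s \<noteq> 0"
  using zeta_reg_nonzero_Re_gt_1[of s] zeta_reg_nonzero_Re_eq_1[of "Im s"]
  by (cases "Re s = 1") (metis complex_surj, linarith)

section \<open>Euler summation of the eta series\<close>

text \<open>The k-th iterated difference of \<open>x powr (-s)\<close> in x, with the sign (-1)^k
  that Euler's transformation of alternating series asks for.\<close>

primrec powr_diff :: "nat \<Rightarrow> complex \<Rightarrow> complex \<Rightarrow> complex" where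
  "powr_diff 0 s x = x powr (- s)"
| "powr_diff (Suc k) s x = powr_diff k s x - powr_diff k s (x + 1)"

lemma powr_diff_deriv:
  "Re x > 0 \<Longrightarrow> (powr_diff k s has_field_derivative - s * powr_diff k (s + 1) x) (at x)"
proof (induction k arbitrary: x)
  case 0
  then have "x \<notin> \<real>\<^sub>\<le>\<^sub>0" by (auto simp: complex_nonpos_Reals_iff)
  moreover have "powr_diff 0 s = (\<lambda>x. x powr (- s))" for s by auto
  ultimately show ?case
    by (auto intro!: derivative_eq_intros)
next
  case (Suc k)
  have "((\<lambda>x. powr_diff k s (x + 1)) has_field_derivative - s * powr_diff k (s + 1) (x + 1) * 1) (at x)"
    by (rule DERIV_chain2[OF Suc.IH]) (use Suc.prems in \<open>auto intro!: derivative_eq_intros\<close>)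
  from DERIV_diff[OF Suc.IH[OF Suc.prems] this] show ?case by (simp add: algebra_simps)
qed

text \<open>The mean value inequality trades a difference for a derivative, that is, for -s times
  \<open>powr_diff\<close> at s + 1. Hence the induction varies s, and the factors collect into a
  Pochhammer symbol. Each difference gains one power of x, and with it a strip of width 1 of
  absolute convergence. The condition on \<open>Re s\<close> makes the bound decrease along the
  segment from x to x + 1.\<close>

lemma norm_powr_diff_le:
  "x > 0 \<Longrightarrow> Re s \<ge> - real k \<Longrightarrow>
    norm (powr_diff k s (of_real x)) \<le> norm (pochhammer s k) * x powr (- Re s - real k)"
proof (induction k arbitrary: s x)
  case 0
  then show ?case by (simp add: norm_powr_real_powr)
next
  case (Suc k)
  define U where "U = closed_segment (complex_of_real x) (of_real x + 1)"
  have U: "\<exists>y\<ge>x. u = of_real y" if "u \<in> U" for u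
  proof -
    from that obtain r where r: "0 \<le> r" "u = (1 - r) *\<^sub>R of_real x + r *\<^sub>R (of_real x + 1)"
      unfolding U_def in_segment by blast
    have "u = of_real (x + r)" unfolding r(2) by (simp add: scaleR_conv_of_real algebra_simps)
    then show ?thesis using r(1) by (intro exI[of _ "x + r"]) auto
  qed
  let ?B = "norm s * (norm (pochhammer (s + 1) k) * x powr (- Re s - 1 - real k))"
  have "norm (powr_diff k s (of_real x) - powr_diff k s (of_real x + 1)) \<le> ?B * norm (of_real x - (of_real x + 1) :: complex)"
  proof (rule field_differentiable_bound[of U])
    show "convex U" "of_real x \<in> U" "of_real x + 1 \<in> U" by (auto simp: U_def)
    fix u assume "u \<in> U"
    then obtain y where y: "y \<ge> x" "u = of_real y" using U by blast
    show "(powr_diff k s has_field_derivative - s * powr_diff k (s + 1) u) (at u within U)"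
      using y Suc.prems by (intro has_field_derivative_at_within[OF powr_diff_deriv]) auto
    have "norm (powr_diff k (s + 1) u) \<le> norm (pochhammer (s + 1) k) * y powr (- Re (s + 1) - real k)"
      unfolding y(2) by (rule Suc.IH) (use Suc.prems y in auto)
    also have "\<dots> \<le> norm (pochhammer (s + 1) k) * x powr (- Re s - 1 - real k)"
      using Suc.prems y by (auto intro!: mult_left_mono powr_mono2')
    finally show "norm (- s * powr_diff k (s + 1) u) \<le> ?B"
      unfolding norm_mult norm_minus_cancel by (intro mult_left_mono) auto
  qed
  then show ?case by (simp add: pochhammer_rec norm_mult mult_ac diff_diff_eq add_ac)
qed

lemma powr_diff_holomorphic: "x > 0 \<Longrightarrow> (\<lambda>s. powr_diff k s (of_real x)) holomorphic_on A"
proof (induction k arbitrary: x)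
  case 0
  then show ?case by (auto intro!: holomorphic_intros)
next
  case (Suc k)
  then show ?case using Suc.IH[of x] Suc.IH[of "x + 1"] by (auto intro!: holomorphic_intros)
qed

text \<open>Up to the factor \<open>2 ^ k\<close>, the remainder after k rounds of Euler's
  transformation applied to the alternating series that starts at m.\<close>

definition alt_tail :: "nat \<Rightarrow> nat \<Rightarrow> complex \<Rightarrow> complex" where
  "alt_tail k m s = (\<Sum>n. (-1) ^ n * powr_diff k s (of_nat (n + m)))"

lemma
  assumes "m > 0"
  shows alt_tail_summable: "Re s > 1 - real k \<Longrightarrow> summable (\<lambda>n. norm ((-1) ^ n * powr_diff k s (of_nat (n + m))))"
    and alt_tail_holomorphic: "alt_tail k m holomorphic_on {s. Re s > 1 - real k}"
proof -
  have hol: "(\<lambda>s. (-1) ^ n * powr_diff k s (of_nat (n + m))) holomorphic_on UNIV" for n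
    using powr_diff_holomorphic[of "real (n + m)" k UNIV] assms by (auto intro!: holomorphic_intros)
  have cont: "continuous_on UNIV (\<lambda>s::complex. norm (pochhammer s k))"
    unfolding pochhammer_prod by (intro continuous_intros)
  have bd: "norm ((-1) ^ n * powr_diff k s (of_nat (n + m))) \<le> norm (pochhammer s k) * real (n + m) powr (- Re s - (1 - (1 - real k)))"
    if "Re s > 1 - real k" for n s
    using norm_powr_diff_le[of "real (n + m)" k s] that assms by (simp add: norm_mult norm_power)
  show "Re s > 1 - real k \<Longrightarrow> summable (\<lambda>n. norm ((-1) ^ n * powr_diff k s (of_nat (n + m))))"
    by (rule dirichlet_like_series_summable[OF hol cont assms bd])
  show "alt_tail k m holomorphic_on {s. Re s > 1 - real k}"
    unfolding alt_tail_def by (rule dirichlet_like_series_holomorphic[OF hol cont assms bd])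
qed

text \<open>Averaging the series with its own shift leaves \<open>g 0\<close> and the differences;
  the partial sums match up to the boundary term \<open>(-1) ^ M * g M\<close>, which tends to
  0.\<close>

lemma alternating_sums_via_differences:
  fixes g :: "nat \<Rightarrow> complex"
  assumes "g \<longlonglongrightarrow> 0" "(\<lambda>n. (-1) ^ n * (g n - g (Suc n))) sums S"
  shows "(\<lambda>n. (-1) ^ n * g n) sums ((g 0 + S) / 2)"
proof -
  have *: "(\<Sum>n<M. (-1) ^ n * g n) = (g 0 + (\<Sum>n<M. (-1) ^ n * (g n - g (Suc n))) - (-1) ^ M * g M) / 2" for M
    by (induction M) (auto simp: field_simps)
  have "(\<lambda>M. (-1) ^ M * g M) \<longlonglongrightarrow> 0"
    by (rule tendsto_norm_zero_cancel) (use tendsto_norm_zero[OF assms(1)] in \<open>simp add: norm_mult norm_power\<close>)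
  then have "(\<lambda>M. (g 0 + (\<Sum>n<M. (-1) ^ n * (g n - g (Suc n))) - (-1) ^ M * g M) / 2) \<longlonglongrightarrow> (g 0 + S - 0) / 2"
    using assms(2) unfolding sums_def by (intro tendsto_intros) auto
  then show ?thesis unfolding sums_def * by simp
qed

lemma powr_diff_tendsto_0:
  assumes "Re s > 0" "m > 0"
  shows "(\<lambda>n. powr_diff k s (of_nat (n + m))) \<longlonglongrightarrow> 0"
proof -
  have "(\<lambda>n. real n powr (- Re s - real k)) \<longlonglongrightarrow> 0"
    using assms by (intro tendsto_neg_powr filterlim_real_sequentially) auto
  then have "(\<lambda>n. norm (pochhammer s k) * real (n + m) powr (- Re s - real k)) \<longlonglongrightarrow> norm (pochhammer s k) * 0"
    by (intro tendsto_intros LIMSEQ_ignore_initial_segment)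
  then show ?thesis
    by (rule Lim_null_comparison[rotated, OF tendsto_eq_rhs])
       (use assms norm_powr_diff_le[of "real (n + m)" k s for n] in \<open>auto intro!: always_eventually\<close>)
qed

lemma alt_tail_step:
  assumes "Re s > 0" "m > 0"
  shows "(\<lambda>n. (-1) ^ n * powr_diff k s (of_nat (n + m))) sums ((powr_diff k s (of_nat m) + alt_tail (Suc k) m s) / 2)"
proof -
  have "(\<lambda>n. (-1) ^ n * powr_diff (Suc k) s (of_nat (n + m))) sums alt_tail (Suc k) m s"
    unfolding alt_tail_def using assms
    by (intro summable_sums summable_norm_cancel[OF alt_tail_summable]) auto
  then show ?thesis
    using alternating_sums_via_differences[OF powr_diff_tendsto_0[OF assms, of k]]
    by (simp add: add_ac)
qed

lemma alt_tail_euler: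
  assumes "Re s > 0" "m > 0"
  shows "alt_tail 0 m s = (\<Sum>i<k. powr_diff i s (of_nat m) / 2 ^ Suc i) + alt_tail k m s / 2 ^ k"
proof (induction k)
  case (Suc k)
  have step: "alt_tail k m s = (powr_diff k s (of_nat m) + alt_tail (Suc k) m s) / 2"
    unfolding alt_tail_def[of k] using sums_unique[OF alt_tail_step[OF assms]] by simp
  show ?case unfolding Suc.IH step by (simp add: field_simps)
qed simp

lemma dirichlet_eta_eq:
  assumes "Re s > 0"
  shows "dirichlet_eta s = (\<Sum>n<m. (-1) ^ n * of_nat (Suc n) powr (- s)) +
    (-1) ^ m * ((\<Sum>i<k. powr_diff i s (of_nat (Suc m)) / 2 ^ Suc i) + alt_tail k (Suc m) s / 2 ^ k)"
proof -
  let ?f = "\<lambda>n. (-1) ^ n * of_nat (Suc n) powr (- s) :: complex"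
  have sm: "summable ?f"
    using sums_summable[OF alt_tail_step[OF assms, of 1 0]] by simp
  then have "dirichlet_eta s = (\<Sum>n. ?f (n + m)) + (\<Sum>n<m. ?f n)"
    unfolding dirichlet_eta_def using assms suminf_split_initial_segment[OF sm, of m] by simp
  also have "(\<Sum>n. ?f (n + m)) = (\<Sum>n. (-1) ^ m * ((-1) ^ n * powr_diff 0 s (of_nat (n + Suc m))))"
    by (simp add: power_add mult_ac)
  also have "\<dots> = (-1) ^ m * alt_tail 0 (Suc m) s"
    unfolding alt_tail_def by (rule suminf_mult) (use sums_summable[OF alt_tail_step[OF assms]] in blast)
  finally show ?thesis using alt_tail_euler[OF assms, of "Suc m" k] by simp
qed

text \<open>One round of Euler's transformation turns the conditionally convergent series into one
  that converges absolutely and locally uniformly on \<open>Re s > 0\<close>.\<close>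

lemma dirichlet_eta_holomorphic: "dirichlet_eta holomorphic_on {s. Re s > 0}"
proof -
  have "(\<lambda>s. 1 / 2 + alt_tail 1 1 s / 2) holomorphic_on {s. Re s > 0}"
    using alt_tail_holomorphic[of 1 1] by (auto intro!: holomorphic_intros)
  then show ?thesis
    using dirichlet_eta_eq[of _ 0 1] by (subst holomorphic_cong[OF refl]) auto
qed

lemma dirichlet_eta_zeta_reg_Re_gt_1:
  assumes s: "Re s > 1"
  shows "(s - 1) * dirichlet_eta s = (1 - 2 powr (1 - s)) * zeta_reg s"
proof -
  let ?f = "\<lambda>n. of_nat (Suc n) powr (- s) :: complex"
  define S where "S = (\<Sum>n. ?f n)"
  have S: "?f sums S" unfolding S_def
    using summable_norm_cancel[OF summable_norm_powr[OF s]] by (rule summable_sums)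
  have Z: "zeta_reg s = (s - 1) * S"
    using zeta_reg_sums[OF s] sums_mult[OF S, of "s - 1"] by (rule sums_unique2)
  let ?d = "\<lambda>n. ?f n - (-1) ^ n * ?f n"
  have d: "?d (2 * n + 1) = 2 * 2 powr (- s) * ?f n" for n
  proof -
    have "(2 * of_nat (Suc n)) powr (- s) = 2 powr (- s) * ?f n"
      using powr_times_real[of 2 "of_nat (Suc n)" "- s"] by simp
    moreover have "2 * of_nat (Suc n) = (of_nat (Suc (2 * n + 1)) :: complex)" by simp
    ultimately show ?thesis by simp
  qed
  \<comment> \<open>The difference of the two series lives on the odd indices, that is, on the even
    integers 2 (n + 1).\<close>
  have "?d sums (2 * 2 powr (- s) * S)"
  proof (subst sums_mono_reindex[of "\<lambda>n. 2 * n + 1", symmetric])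
    show "?d n = 0" if "n \<notin> range (\<lambda>n. 2 * n + 1)" for n
      using that by (cases "even n") (auto elim!: oddE)
    show "(\<lambda>n. ?d (2 * n + 1)) sums (2 * 2 powr (- s) * S)"
      unfolding d by (intro sums_mult S)
  qed (auto simp: strict_mono_def)
  then have "(\<lambda>n. ?f n - ?d n) sums (S - 2 * 2 powr (- s) * S)"
    by (intro sums_diff S)
  then have eta: "dirichlet_eta s = S - 2 * 2 powr (- s) * S"
    using s by (simp add: dirichlet_eta_def sums_iff)
  have two: "2 powr (1 - s) = 2 * 2 powr (- s)"
    using powr_add[of 2 1 "- s"] by simp
  show ?thesis unfolding Z eta two by (simp add: algebra_simps)
qed

lemma dirichlet_eta_zeta_reg:
  assumes "Re s > 0"
  shows "(s - 1) * dirichlet_eta s = (1 - 2 powr (1 - s)) * zeta_reg s"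
proof (rule analytic_continuation_open[where s = "{s. Re s > 1}" and s' = "{s. Re s > 0}"
      and f = "\<lambda>s. (s - 1) * dirichlet_eta s" and g = "\<lambda>s. (1 - 2 powr (1 - s)) * zeta_reg s"])
  show "{s. Re s > 1} \<noteq> {}" by (auto intro: exI[of _ 2])
  have "convex {s. Re s > 0}" by (rule convex_halfspace_Re_gt)
  then show "connected {s. Re s > 0}" by (rule convex_connected)
  have "zeta_reg holomorphic_on {s. Re s > 0}"
    by (rule holomorphic_on_subset[OF zeta_reg_holomorphic]) auto
  then show "(\<lambda>s. (1 - 2 powr (1 - s)) * zeta_reg s) holomorphic_on {s. Re s > 0}"
    by (intro holomorphic_intros)
  show "(\<lambda>s. (s - 1) * dirichlet_eta s) holomorphic_on {s. Re s > 0}"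
    by (intro holomorphic_intros dirichlet_eta_holomorphic)
qed (use assms dirichlet_eta_zeta_reg_Re_gt_1 open_halfspace_Re_gt in auto)

section \<open>The functional equation\<close>

lemma Gamma_scaled_nn_integral:
  fixes s c :: real
  assumes "s > 0" "c > 0"
  shows "(\<integral>\<^sup>+t\<in>{0<..}. ennreal (t powr (s - 1) * exp (- (c * t))) \<partial>lborel) = ennreal (Gamma s * c powr (- s))"
proof -
  let ?J = "\<integral>\<^sup>+t\<in>{0<..}. ennreal (t powr (s - 1) * exp (- (c * t))) \<partial>lborel"
  have "ennreal (Gamma s) = (\<integral>\<^sup>+t. ennreal (indicator {0..} t * t powr (s - 1) / exp t) \<partial>lborel)"
    using Gamma_conv_nn_integral_real[OF assms(1)] .
  also have "\<dots> = ennreal \<bar>c\<bar> * (\<integral>\<^sup>+t. ennreal (indicator {0..} (0 + c * t) * (0 + c * t) powr (s - 1) / exp (0 + c * t)) \<partial>lborel)"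
    using assms by (intro nn_integral_real_affine) auto
  also have "(\<integral>\<^sup>+t. ennreal (indicator {0..} (0 + c * t) * (0 + c * t) powr (s - 1) / exp (0 + c * t)) \<partial>lborel) =
      (\<integral>\<^sup>+t. ennreal (c powr (s - 1)) * (ennreal (t powr (s - 1) * exp (- (c * t))) * indicator {0<..} t) \<partial>lborel)"
    using assms
    by (intro nn_integral_cong)
       (auto simp: indicator_def powr_mult exp_minus field_simps zero_le_mult_iff simp flip: ennreal_mult)
  also have "\<dots> = ennreal (c powr (s - 1)) * ?J"
    by (intro nn_integral_cmult) auto
  finally have "ennreal (Gamma s) = ennreal (c * c powr (s - 1)) * ?J"
    using assms by (simp add: ennreal_mult mult.assoc)
  also have "c * c powr (s - 1) = c powr s"
    using assms by (simp add: powr_diff)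
  finally have "ennreal (c powr (- s)) * ennreal (Gamma s) = ennreal (c powr (- s)) * ennreal (c powr s) * ?J"
    by (simp add: mult.assoc)
  also have "ennreal (c powr (- s)) * ennreal (c powr s) = 1"
    using assms by (simp add: powr_minus field_simps flip: ennreal_mult)
  finally show ?thesis using assms by (simp add: mult.commute flip: ennreal_mult)
qed

text \<open>The substitution t = x^2 in the Gamma integral with parameter (1 + w) / 2.\<close>

lemma Gaussian_moment_nn_integral:
  fixes w v :: real
  assumes "w > -1" "v > 0"
  shows "(\<integral>\<^sup>+x\<in>{0<..}. ennreal (2 * x powr w * exp (- (v * x\<^sup>2))) \<partial>lborel) =
         ennreal (Gamma ((1 + w) / 2) * v powr (- ((1 + w) / 2)))"
proof -
  define a where "a = (1 + w) / 2"
  have a: "a > 0" using assms by (simp add: a_def)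
  let ?f = "\<lambda>t. t powr (a - 1) * exp (- (v * t))" and ?I = "Gamma a * v powr (- a)"
  have I: "?I \<ge> 0" using a by simp
  have "(\<integral>\<^sup>+t. ennreal (?f t * indicator {0<..} t) \<partial>lborel) = ennreal ?I"
    using Gamma_scaled_nn_integral[OF a assms(2)] by (simp add: ennreal_mult' ennreal_indicator)
  then have "((\<lambda>t. ?f t * indicator {0<..} t) has_integral ?I) UNIV"
    using I by (intro nn_integral_has_integral) (auto simp: indicator_def)
  also have "(\<lambda>t. ?f t * indicator {0<..} t) = (\<lambda>t. if t \<in> {0<..} then ?f t else 0)"
    by (auto simp: indicator_def fun_eq_iff)
  finally have "(?f has_integral ?I) {0<..}" by (simp only: has_integral_restrict_UNIV)
  moreover have "(\<lambda>x::real. x\<^sup>2) ` {0<..} = {0<..}"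
  proof (intro equalityI subsetI)
    fix y :: real assume "y \<in> {0<..}"
    then show "y \<in> (\<lambda>x. x\<^sup>2) ` {0<..}" by (intro image_eqI[of _ _ "sqrt y"]) auto
  qed auto
  ultimately have "?f absolutely_integrable_on ((\<lambda>x. x\<^sup>2) ` {0<..}) \<and> integral ((\<lambda>x. x\<^sup>2) ` {0<..}) ?f = ?I"
    by (auto intro!: nonnegative_absolutely_integrable_1 simp: has_integral_iff)
  then have "(\<lambda>x. \<bar>2 * x\<bar> * ?f (x\<^sup>2)) absolutely_integrable_on {0<..} \<and> integral {0<..} (\<lambda>x. \<bar>2 * x\<bar> * ?f (x\<^sup>2)) = ?I"
    by (subst has_absolute_integral_change_of_variables_1'[where g = "\<lambda>x. x\<^sup>2"])
       (auto intro!: derivative_eq_intros inj_onI)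
  then have "((\<lambda>x. \<bar>2 * x\<bar> * ?f (x\<^sup>2)) has_integral ?I) {0<..}"
    using set_lebesgue_integral_eq_integral(1) has_integral_iff by blast
  then have "(\<integral>\<^sup>+x. ennreal (indicator {0<..} x * (\<bar>2 * x\<bar> * ?f (x\<^sup>2))) \<partial>lborel) = ennreal ?I"
    by (rule nn_integral_has_integral_lebesgue[rotated]) auto
  also have "(\<lambda>x. ennreal (indicator {0<..} x * (\<bar>2 * x\<bar> * ?f (x\<^sup>2)))) = (\<lambda>x. ennreal (2 * x powr w * exp (- (v * x\<^sup>2))) * indicator {0<..} x)"
  proof
    fix x :: real
    have "x * (x\<^sup>2) powr (a - 1) = x powr w" if "x > 0"
    proof -
      have "x\<^sup>2 = x powr 2" using that by (simp add: powr_numeral)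
      then have "(x\<^sup>2) powr (a - 1) = x powr (2 * (a - 1))" by (simp only: powr_powr)
      then have "x * (x\<^sup>2) powr (a - 1) = x powr 1 * x powr (2 * (a - 1))"
        using that by simp
      also have "\<dots> = x powr w"
        unfolding powr_add[symmetric] by (rule arg_cong[where f = "(powr) x"]) (simp add: a_def field_simps)
      finally show ?thesis .
    qed
    then show "ennreal (indicator {0<..} x * (\<bar>2 * x\<bar> * ?f (x\<^sup>2))) = ennreal (2 * x powr w * exp (- (v * x\<^sup>2))) * indicator {0<..} x"
      by (cases "x > 0") (auto simp: mult.assoc[symmetric])
  qed
  finally show ?thesis by (simp add: a_def)
qed

lemma exp_nn_integral:
  fixes c :: real
  assumes "c > 0"
  shows "(\<integral>\<^sup>+v\<in>{0<..}. ennreal (exp (- (c * v))) \<partial>lborel) = ennreal (1 / c)"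
proof -
  have "(\<integral>\<^sup>+v\<in>{0<..}. ennreal (exp (- (c * v))) \<partial>lborel) = (\<integral>\<^sup>+v\<in>{0<..}. ennreal (v powr (1 - 1) * exp (- (c * v))) \<partial>lborel)"
    by (intro nn_integral_cong) (auto simp: indicator_def)
  also have "\<dots> = ennreal (1 / c)"
    using assms by (subst Gamma_scaled_nn_integral) (auto simp: powr_minus field_simps)
  finally show ?thesis .
qed

lemma lborel_Fubini_nn:
  fixes f :: "real \<Rightarrow> real \<Rightarrow> ennreal"
  assumes "case_prod f \<in> borel_measurable (borel \<Otimes>\<^sub>M borel)"
  shows "(\<integral>\<^sup>+y. (\<integral>\<^sup>+x. f x y \<partial>lborel) \<partial>lborel) = (\<integral>\<^sup>+x. (\<integral>\<^sup>+y. f x y \<partial>lborel) \<partial>lborel)"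
proof -
  have "case_prod f \<in> borel_measurable (lborel \<Otimes>\<^sub>M lborel)"
    using assms by (simp cong: measurable_cong_sets)
  then show ?thesis by (rule lborel_pair.Fubini')
qed

text \<open>Write 1 / (x^2 + b^2) as the integral of exp (- (x^2 + b^2) v) over v and interchange.
  The product of Gamma values is left unevaluated because \<open>xi_reg_symmetric_real\<close> uses
  the factors separately: one goes into the Gamma factor at 1 - w, the other into the duplication
  formula.\<close>

lemma Mellin_Poisson_kernel:
  fixes w b :: real
  assumes "-1 < w" "w < 1" "b > 0"
  shows "(\<integral>\<^sup>+x\<in>{0<..}. ennreal (x powr (w - 1) * (2 * x / (x\<^sup>2 + b\<^sup>2))) \<partial>lborel) =
         ennreal (Gamma ((1 + w) / 2) * Gamma ((1 - w) / 2) * b powr (w - 1))"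
proof -
  let ?h = "\<lambda>x v. ennreal (2 * x powr w * exp (- ((x\<^sup>2 + b\<^sup>2) * v))) * indicator {0<..} x * indicator {0<..} v"
  have "(\<integral>\<^sup>+x\<in>{0<..}. ennreal (x powr (w - 1) * (2 * x / (x\<^sup>2 + b\<^sup>2))) \<partial>lborel) =
        (\<integral>\<^sup>+x. (\<integral>\<^sup>+v. ?h x v \<partial>lborel) \<partial>lborel)"
  proof (rule nn_integral_cong)
    fix x :: real
    show "ennreal (x powr (w - 1) * (2 * x / (x\<^sup>2 + b\<^sup>2))) * indicator {0<..} x = (\<integral>\<^sup>+v. ?h x v \<partial>lborel)"
    proof (cases "x > 0")
      case True
      have "(\<integral>\<^sup>+v. ?h x v \<partial>lborel) = (\<integral>\<^sup>+v. ennreal (2 * x powr w) * (ennreal (exp (- ((x\<^sup>2 + b\<^sup>2) * v))) * indicator {0<..} v) \<partial>lborel)"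
        using True by (intro nn_integral_cong) (auto simp: ennreal_mult' mult.assoc)
      also have "\<dots> = ennreal (2 * x powr w) * ennreal (1 / (x\<^sup>2 + b\<^sup>2))"
        using assms by (subst nn_integral_cmult, simp, subst exp_nn_integral) (auto intro: add_nonneg_pos)
      also have "\<dots> = ennreal (x powr (w - 1) * (2 * x / (x\<^sup>2 + b\<^sup>2)))"
        using True by (simp add: powr_diff flip: ennreal_mult)
      finally show ?thesis using True by simp
    qed auto
  qed
  also have "\<dots> = (\<integral>\<^sup>+v. (\<integral>\<^sup>+x. ?h x v \<partial>lborel) \<partial>lborel)"
    by (rule lborel_Fubini_nn[symmetric]) measurable
  also have "\<dots> = (\<integral>\<^sup>+v. ennreal (Gamma ((1 + w) / 2)) * (ennreal (v powr ((1 - w) / 2 - 1) * exp (- (b\<^sup>2 * v))) * indicator {0<..} v) \<partial>lborel)"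
  proof (rule nn_integral_cong)
    fix v :: real
    show "(\<integral>\<^sup>+x. ?h x v \<partial>lborel) = ennreal (Gamma ((1 + w) / 2)) * (ennreal (v powr ((1 - w) / 2 - 1) * exp (- (b\<^sup>2 * v))) * indicator {0<..} v)"
    proof (cases "v > 0")
      case True
      have "(\<integral>\<^sup>+x. ?h x v \<partial>lborel) = (\<integral>\<^sup>+x. ennreal (exp (- (b\<^sup>2 * v))) * (ennreal (2 * x powr w * exp (- (v * x\<^sup>2))) * indicator {0<..} x) \<partial>lborel)"
        using True by (intro nn_integral_cong) (auto simp: mult_ac distrib_left exp_add exp_diff exp_minus field_simps indicator_def simp flip: ennreal_mult)
      also have "\<dots> = ennreal (exp (- (b\<^sup>2 * v))) * ennreal (Gamma ((1 + w) / 2) * v powr (- ((1 + w) / 2)))"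
        using assms True by (subst nn_integral_cmult, simp, subst Gaussian_moment_nn_integral) auto
      also have "- ((1 + w) / 2) = (1 - w) / 2 - 1" by (simp add: field_simps)
      finally show ?thesis using True assms by (simp add: mult_ac flip: ennreal_mult)
    qed auto
  qed
  also have "\<dots> = ennreal (Gamma ((1 + w) / 2)) * ennreal (Gamma ((1 - w) / 2) * (b\<^sup>2) powr (- ((1 - w) / 2)))"
    using assms by (subst nn_integral_cmult, simp, subst Gamma_scaled_nn_integral) auto
  also have "(b\<^sup>2) powr (- ((1 - w) / 2)) = b powr (w - 1)"
  proof -
    have "b\<^sup>2 = b powr 2" using assms by (simp add: powr_numeral)
    then have "(b\<^sup>2) powr (- ((1 - w) / 2)) = b powr (2 * - ((1 - w) / 2))" by (simp only: powr_powr)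
    also have "2 * - ((1 - w) / 2) = w - 1" by (simp add: field_simps)
    finally show ?thesis .
  qed
  finally show ?thesis using assms by (simp add: mult.assoc flip: ennreal_mult)
qed

text \<open>For v from 0 to u, integrate x exp (- v x) to obtain 1 - exp (- u x); after the
  interchange every inner integral is a Gamma integral. Passing to 1 minus the exponential makes the
  transform converge at 0 for negative w and keeps the integrand nonnegative.\<close>

lemma Mellin_one_minus_exp:
  fixes w u :: real
  assumes "-1 < w" "w < 0" "u \<ge> 0"
  shows "(\<integral>\<^sup>+x\<in>{0<..}. ennreal (x powr (w - 1) * (1 - exp (- (u * x)))) \<partial>lborel) =
         ennreal (Gamma (w + 1) / (- w) * u powr (- w))"
proof (cases "u = 0")
  case False
  with assms have u: "u > 0" by simp
  \<comment> \<open>The point v = 0 is excluded, since there the integral over x diverges. In the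
    order of integration with v inside, it is a null set.\<close>
  let ?h = "\<lambda>x v. ennreal (x powr w * exp (- (v * x))) * indicator {0<..} x * indicator {0<..u} v"
  have "(\<integral>\<^sup>+x\<in>{0<..}. ennreal (x powr (w - 1) * (1 - exp (- (u * x)))) \<partial>lborel) =
        (\<integral>\<^sup>+x. (\<integral>\<^sup>+v. ?h x v \<partial>lborel) \<partial>lborel)"
  proof (rule nn_integral_cong)
    fix x :: real
    show "ennreal (x powr (w - 1) * (1 - exp (- (u * x)))) * indicator {0<..} x = (\<integral>\<^sup>+v. ?h x v \<partial>lborel)"
    proof (cases "x > 0")
      case True
      have "(\<integral>\<^sup>+v. ?h x v \<partial>lborel) = (\<integral>\<^sup>+v. ennreal (x powr w * exp (- (v * x))) * indicator {0..u} v \<partial>lborel)"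
      proof (rule nn_integral_cong_AE)
        show "AE v in lborel. ?h x v = ennreal (x powr w * exp (- (v * x))) * indicator {0..u} v"
          using AE_lborel_singleton[of 0] by eventually_elim (use True in \<open>auto simp: indicator_def\<close>)
      qed
      also have "\<dots> = ennreal (- (x powr (w - 1)) * exp (- (u * x)) - (- (x powr (w - 1)) * exp (- (0 * x))))"
        using True u
        by (intro nn_integral_FTC_Icc[where F = "\<lambda>v. - (x powr (w - 1)) * exp (- (v * x))"])
           (auto intro!: derivative_eq_intros simp: powr_diff)
      finally show ?thesis using True by (simp add: algebra_simps)
    qed auto
  qed
  also have "\<dots> = (\<integral>\<^sup>+v. (\<integral>\<^sup>+x. ?h x v \<partial>lborel) \<partial>lborel)"
    by (rule lborel_Fubini_nn[symmetric]) measurable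
  also have "\<dots> = (\<integral>\<^sup>+v. ennreal (Gamma (w + 1)) * ennreal (indicator {0<..u} v * v powr (- w - 1)) \<partial>lborel)"
  proof (rule nn_integral_cong)
    fix v :: real
    show "(\<integral>\<^sup>+x. ?h x v \<partial>lborel) = ennreal (Gamma (w + 1)) * ennreal (indicator {0<..u} v * v powr (- w - 1))"
    proof (cases "v \<in> {0<..u}")
      case True
      have "(\<integral>\<^sup>+x. ?h x v \<partial>lborel) = (\<integral>\<^sup>+x\<in>{0<..}. ennreal (x powr (w + 1 - 1) * exp (- (v * x))) \<partial>lborel)"
        using True by (intro nn_integral_cong) auto
      also have "\<dots> = ennreal (Gamma (w + 1) * v powr (- (w + 1)))"
        using True assms by (intro Gamma_scaled_nn_integral) auto
      also have "- (w + 1) = - w - 1" by simp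
      finally show ?thesis using True assms by (simp add: ennreal_mult)
    qed auto
  qed
  also have "\<dots> = ennreal (Gamma (w + 1)) * (\<integral>\<^sup>+v. ennreal (indicator {0<..u} v * v powr (- w - 1)) \<partial>lborel)"
    by (rule nn_integral_cmult) auto
  also have "(\<integral>\<^sup>+v. ennreal (indicator {0<..u} v * v powr (- w - 1)) \<partial>lborel) = ennreal (u powr (- w) / (- w))"
  proof (rule nn_integral_has_integral_lebesgue)
    have "((\<lambda>v. v powr (- w - 1)) has_integral (u powr (- w - 1 + 1) / (- w - 1 + 1))) {0..u}"
      using assms by (intro has_integral_powr_from_0) auto
    then show "((\<lambda>v. v powr (- w - 1)) has_integral (u powr (- w) / (- w))) {0<..u}"
      by (subst has_integral_spike_set_eq[where T = "{0..u}"])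
         (auto intro: negligible_subset[of "{0}"])
  qed auto
  finally show ?thesis using assms by (simp add: divide_simps flip: ennreal_mult)
qed simp

section \<open>Partial fractions of the hyperbolic cotangent\<close>

lemma Digamma_reflection:
  fixes z :: complex
  assumes "z \<notin> \<int>"
  shows "(Digamma z - Digamma (1 - z)) * sin (of_real pi * z) = - of_real pi * cos (of_real pi * z)"
proof -
  have np: "w \<notin> \<int>\<^sub>\<le>\<^sub>0" if "w \<notin> \<int>" for w :: complex using that by (auto elim!: nonpos_Ints_cases)
  have z1: "1 - z \<notin> \<int>" using assms Ints_diff[of 1 "1 - z"] by auto
  \<comment> \<open>By the reflection formula for Gamma this function is constant off the integers;
    the vanishing of its derivative is the claim.\<close>
  let ?f = "\<lambda>z::complex. Gamma z * Gamma (1 - z) * sin (of_real pi * z)"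
  have sn: "sin (of_real pi * z) \<noteq> 0" if "z \<notin> \<int>" for z :: complex
    using that by (auto simp: sin_eq_0 mult.commute)
  have eq: "?f w = of_real pi" if "w \<notin> \<int>" for w
    using sn[OF that] by (simp add: Gamma_reflection_complex)
  have "open (- \<int> :: complex set)" by (simp add: closed_of_int_image Ints_def open_Compl)
  then have ev: "\<forall>\<^sub>F w in nhds z. w \<in> - \<int>" using assms by (intro eventually_nhds_in_open) auto
  have "(?f has_field_derivative 0) (at z)"
    by (subst DERIV_cong_ev[OF refl eventually_mono[OF ev] refl, of _ "\<lambda>_. of_real pi"]) (use eq in auto)
  moreover have "(?f has_field_derivative (Gamma z * Gamma (1 - z)) *
     ((Digamma z - Digamma (1 - z)) * sin (of_real pi * z) + of_real pi * cos (of_real pi * z))) (at z)"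
  proof -
    have d1: "(Gamma has_field_derivative Gamma z * Digamma z) (at z)"
      by (rule has_field_derivative_Gamma[OF np[OF assms]])
    have d2: "((\<lambda>z. Gamma (1 - z)) has_field_derivative Gamma (1 - z) * Digamma (1 - z) * (- 1)) (at z)"
      by (rule DERIV_chain2[where f = Gamma and g = "\<lambda>z. 1 - z", OF has_field_derivative_Gamma[OF np[OF z1]]]) (auto intro!: derivative_eq_intros)
    have d3: "((\<lambda>z. sin (of_real pi * z)) has_field_derivative cos (of_real pi * z) * of_real pi) (at z)"
      by (auto intro!: derivative_eq_intros)
    show ?thesis
      by (rule DERIV_cong[OF DERIV_mult[OF DERIV_mult[OF d1 d2] d3]]) (simp add: algebra_simps)
  qed
  ultimately have "0 = (Gamma z * Gamma (1 - z)) *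
     ((Digamma z - Digamma (1 - z)) * sin (of_real pi * z) + of_real pi * cos (of_real pi * z))"
    by (rule DERIV_unique)
  moreover have "Gamma z * Gamma (1 - z) \<noteq> 0"
    using np[OF assms] np[OF z1] by (simp add: Gamma_eq_zero_iff)
  ultimately have "(Digamma z - Digamma (1 - z)) * sin (of_real pi * z) + of_real pi * cos (of_real pi * z) = 0"
    by (metis mult_eq_0_iff)
  then show ?thesis unfolding eq_neg_iff_add_eq_0 mult_minus_left .
qed

text \<open>The sum equals coth (x / 2) / 2 - 1 / x = 1 / (e^x - 1) + 1/2 - 1/x. It is the cotangent
  expansion, read off from the digamma reflection formula at the imaginary point i x / (2 pi), where
  sine and cosine become hyperbolic.\<close>

lemma coth_sums:
  fixes x :: real
  assumes "x > 0"
  shows "(\<lambda>n. 2 * x / (x\<^sup>2 + (2 * pi * real (Suc n))\<^sup>2)) sums ((1 + exp (- x)) / (2 * (1 - exp (- x))) - 1 / x)"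
proof -
  define y where "y = x / (2 * pi)"
  have y: "y > 0" using assms by (simp add: y_def)
  define z where "z = \<i> * of_real y"
  have zInt: "z \<notin> \<int>" using y by (auto simp: z_def complex_eq_iff elim!: Ints_cases)
  have z0: "z \<noteq> 0" "1 - z \<noteq> 0" "1 + z \<noteq> 0" using y by (auto simp: z_def complex_eq_iff)
  let ?a = "\<lambda>w n. inverse (of_nat (Suc n)) - inverse (w + of_nat n) :: complex"
  have "(\<lambda>n. ?a (1 + z) n - ?a (1 - z) n) sums ((Digamma (1 + z) + euler_mascheroni) - (Digamma (1 - z) + euler_mascheroni))"
    using summable_sums[OF summable_Digamma[OF z0(3)]] summable_sums[OF summable_Digamma[OF z0(2)]]
    by (intro sums_diff) (simp_all only: Digamma_def diff_add_cancel)
  also have "(Digamma (1 + z) + euler_mascheroni) - (Digamma (1 - z) + euler_mascheroni) = 1 / z + (Digamma z - Digamma (1 - z))"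
    using Digamma_plus1[OF z0(1)] by (simp add: add.commute)
  finally have s1: "(\<lambda>n. ?a (1 + z) n - ?a (1 - z) n) sums (1 / z + (Digamma z - Digamma (1 - z)))" .
  have step: "?a (1 + z) n - ?a (1 - z) n = \<i> * of_real (2 * y / (y\<^sup>2 + (real (Suc n))\<^sup>2))" for n
  proof -
    define m where "m = complex_of_real (real (Suc n))"
    have nz: "m - z \<noteq> 0" "m + z \<noteq> 0" using y by (auto simp: m_def z_def complex_eq_iff)
    have "?a (1 + z) n - ?a (1 - z) n = inverse (m - z) - inverse (m + z)"
      by (simp add: m_def algebra_simps)
    also have "\<dots> = 2 * z / ((m - z) * (m + z))" using nz by (simp add: field_simps)
    also have "(m - z) * (m + z) = of_real (y\<^sup>2 + (real (Suc n))\<^sup>2)"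
      by (simp add: m_def z_def algebra_simps power2_eq_square)
    finally show ?thesis by (simp add: z_def mult_ac)
  qed
  have ex: "exp (\<i> * (of_real pi * z)) = of_real (exp (- x / 2))" "exp (- (\<i> * (of_real pi * z))) = of_real (exp (x / 2))"
    by (simp_all add: z_def y_def exp_of_real[symmetric] field_simps)
  let ?e = "exp (- x / 2)" and ?e' = "exp (x / 2)"
  have ne: "?e \<noteq> ?e'" using assms by simp
  have sn: "sin (of_real pi * z) = \<i> * of_real ((?e' - ?e) / 2)"
    unfolding sin_exp_eq' ex by simp
  have cs: "cos (of_real pi * z) = of_real ((?e + ?e') / 2)"
    unfolding cos_exp_eq ex by simp
  have "(Digamma z - Digamma (1 - z)) * (\<i> * of_real ((?e' - ?e) / 2)) = - of_real pi * of_real ((?e + ?e') / 2)"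
    using Digamma_reflection[OF zInt] unfolding sn cs .
  then have "Digamma z - Digamma (1 - z) = - of_real pi * of_real ((?e + ?e') / 2) / (\<i> * of_real ((?e' - ?e) / 2))"
    using ne by (intro nonzero_eq_divide_eq[THEN iffD2]) auto
  also have "\<dots> = \<i> * of_real (pi * ((?e + ?e') / (?e' - ?e)))"
    using ne by (simp add: field_simps)
  finally have D': "Digamma z - Digamma (1 - z) = \<i> * of_real (pi * ((?e + ?e') / (?e' - ?e)))" .
  have "1 / z = \<i> * of_real (- (1 / y))"
    using y by (simp add: z_def field_simps)
  then have D: "1 / z + (Digamma z - Digamma (1 - z)) = \<i> * of_real (pi * ((?e + ?e') / (?e' - ?e)) - 1 / y)"
    unfolding D' by (simp only: distrib_left[symmetric] of_real_add[symmetric]) simp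
  have "(\<lambda>n. Im (\<i> * of_real (2 * y / (y\<^sup>2 + (real (Suc n))\<^sup>2)))) sums Im (\<i> * of_real (pi * ((?e + ?e') / (?e' - ?e)) - 1 / y))"
    using s1 unfolding step D by (rule sums_Im)
  then have "(\<lambda>n. 2 * y / (y\<^sup>2 + (real (Suc n))\<^sup>2)) sums (pi * ((?e + ?e') / (?e' - ?e)) - 1 / y)"
    by simp
  from sums_divide[OF this, of "2 * pi"]
  have "(\<lambda>n. 2 * y / (y\<^sup>2 + (real (Suc n))\<^sup>2) / (2 * pi)) sums ((pi * ((?e + ?e') / (?e' - ?e)) - 1 / y) / (2 * pi))" .
  moreover have "2 * y / (y\<^sup>2 + (real (Suc n))\<^sup>2) / (2 * pi) = 2 * x / (x\<^sup>2 + (2 * pi * real (Suc n))\<^sup>2)" for n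
  proof -
    have "x = 2 * pi * y" by (simp add: y_def)
    then have "2 * x / (x\<^sup>2 + (2 * pi * real (Suc n))\<^sup>2) = (2 * pi)\<^sup>2 * (2 * y / (2 * pi)) / ((2 * pi)\<^sup>2 * (y\<^sup>2 + (real (Suc n))\<^sup>2))"
      by (simp add: power2_eq_square algebra_simps)
    also have "\<dots> = (2 * y / (2 * pi)) / (y\<^sup>2 + (real (Suc n))\<^sup>2)"
      by (rule nonzero_mult_divide_mult_cancel_left) simp
    finally show ?thesis by (simp only: divide_divide_eq_left mult.commute)
  qed
  moreover have "(pi * ((?e + ?e') / (?e' - ?e)) - 1 / y) / (2 * pi) = (1 + exp (- x)) / (2 * (1 - exp (- x))) - 1 / x"
  proof -
    have "exp (- x) = ?e / ?e'" by (simp flip: exp_diff)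
    then have "(1 + exp (- x)) / (2 * (1 - exp (- x))) = ((?e' + ?e) / ?e') / (2 * ((?e' - ?e) / ?e'))"
      by (simp add: add_divide_distrib diff_divide_distrib)
    also have "\<dots> = (?e + ?e') / (?e' - ?e) / 2" by (simp add: add.commute)
    finally show ?thesis using assms by (simp add: y_def diff_divide_distrib)
  qed
  ultimately show ?thesis by simp
qed

section \<open>Trapezoid errors of the exponential\<close>

definition exp_trapezoid :: "real \<Rightarrow> real \<Rightarrow> real" where
  "exp_trapezoid x u = (exp (- (u * x)) + exp (- ((u + 1) * x))) / 2 - (exp (- (u * x)) - exp (- ((u + 1) * x))) / x"

lemma exp_trapezoid_eq:
  "exp_trapezoid x (real m) = exp (- x) ^ m * ((1 + exp (- x)) / 2 - (1 - exp (- x)) / x)"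
proof -
  have "exp (- (real m * x)) = exp (- x) ^ m" by (simp flip: exp_of_nat_mult)
  moreover from this have "exp (- ((real m + 1) * x)) = exp (- x) ^ m * exp (- x)"
    by (simp add: distrib_right exp_diff exp_minus divide_inverse)
  ultimately show ?thesis unfolding exp_trapezoid_def
    by (simp add: algebra_simps add_divide_distrib diff_divide_distrib)
qed

lemma exp_trapezoid_sums:
  assumes "x > 0"
  shows "(\<lambda>m. exp_trapezoid x (real m)) sums ((1 + exp (- x)) / (2 * (1 - exp (- x))) - 1 / x)"
proof -
  have "(\<lambda>m. exp (- x) ^ m * ((1 + exp (- x)) / 2 - (1 - exp (- x)) / x)) sums
      (1 / (1 - exp (- x)) * ((1 + exp (- x)) / 2 - (1 - exp (- x)) / x))"
    using assms by (intro sums_mult2 geometric_sums) auto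
  also have "1 / (1 - exp (- x)) * ((1 + exp (- x)) / 2 - (1 - exp (- x)) / x) = (1 + exp (- x)) / (2 * (1 - exp (- x))) - 1 / x"
  proof -
    define e where "e = exp (- x)"
    have "1 - e \<noteq> 0" using assms by (simp add: e_def)
    then show ?thesis unfolding e_def[symmetric] using assms by (simp add: divide_simps) (simp add: algebra_simps)
  qed
  finally show ?thesis unfolding exp_trapezoid_eq .
qed

text \<open>Positivity of the trapezoid error is read off from its partial fraction expansion.\<close>

lemma exp_trapezoid_nonneg:
  assumes "x > 0"
  shows "exp_trapezoid x (real m) \<ge> 0"
proof -
  have "0 \<le> (1 + exp (- x)) / (2 * (1 - exp (- x))) - 1 / x"
    by (rule sums_le[OF _ sums_zero coth_sums[OF assms]]) (use assms in auto)
  then have "0 \<le> (1 - exp (- x)) * ((1 + exp (- x)) / (2 * (1 - exp (- x))) - 1 / x)"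
    using assms by (intro mult_nonneg_nonneg) auto
  also have "\<dots> = (1 + exp (- x)) / 2 - (1 - exp (- x)) / x"
    using assms by (simp add: field_simps)
  finally show ?thesis unfolding exp_trapezoid_eq by (intro mult_nonneg_nonneg) auto
qed

text \<open>Average \<open>Mellin_one_minus_exp\<close> over u in [m, m + 1] and subtract the mean
  of its values at the two endpoints: the constant 1 cancels, the trapezoid error of exp (- u x)
  remains, and \<open>T m\<close> is the integral of the concave function \<open>u powr (-w)\<close>
  minus its trapezoid value. Subtraction is delicate among extended nonnegative reals, so the
  identity is first proved in the additive form \<open>ennreal ?J = ?I + ennreal ?S\<close>, with a
  finite last term.\<close>

lemma Mellin_exp_trapezoid:
  fixes w :: real
  assumes w: "-1 < w" "w < 0"
  defines "G \<equiv> Gamma (w + 1) / (- w)"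
  defines "T \<equiv> \<lambda>m. ((real m + 1) powr (1 - w) - real m powr (1 - w)) / (1 - w) - (real m powr (- w) + (real m + 1) powr (- w)) / 2"
  shows "(\<integral>\<^sup>+x\<in>{0<..}. ennreal (x powr (w - 1) * exp_trapezoid x (real m)) \<partial>lborel) = ennreal (G * T m)"
    and "G * T m \<ge> 0"
proof -
  have G: "G \<ge> 0" unfolding G_def using w by (intro divide_nonneg_pos) auto
  let ?I = "\<integral>\<^sup>+x\<in>{0<..}. ennreal (x powr (w - 1) * exp_trapezoid x (real m)) \<partial>lborel"
  let ?E = "\<lambda>u x. x powr (w - 1) * (1 - exp (- (u * x)))"
  let ?S = "G / 2 * (real m powr (- w) + (real m + 1) powr (- w))"
  let ?J = "G * (((real m + 1) powr (1 - w) - real m powr (1 - w)) / (1 - w))"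
  have E: "(\<integral>\<^sup>+x\<in>{0<..}. ennreal (?E u x) \<partial>lborel) = ennreal (G * u powr (- w))" if "u \<ge> 0" for u
    unfolding G_def by (rule Mellin_one_minus_exp[OF w that])
  have J: "(\<integral>\<^sup>+u. (\<integral>\<^sup>+x. ennreal (?E u x) * indicator {0<..} x * indicator {real m..real m + 1} u \<partial>lborel) \<partial>lborel) = ennreal ?J"
  proof -
    have "(\<integral>\<^sup>+u. (\<integral>\<^sup>+x. ennreal (?E u x) * indicator {0<..} x * indicator {real m..real m + 1} u \<partial>lborel) \<partial>lborel) =
        (\<integral>\<^sup>+u. ennreal (indicator {real m..real m + 1} u * (G * u powr (- w))) \<partial>lborel)"
    proof (rule nn_integral_cong)
      fix u :: real
      show "(\<integral>\<^sup>+x. ennreal (?E u x) * indicator {0<..} x * indicator {real m..real m + 1} u \<partial>lborel) =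
          ennreal (indicator {real m..real m + 1} u * (G * u powr (- w)))"
        using E[of u] by (cases "u \<in> {real m..real m + 1}") auto
    qed
    also have "\<dots> = ennreal ?J"
    proof (rule nn_integral_has_integral_lebesgue)
      let ?F = "\<lambda>u. G * (u powr (1 - w) / (1 - w))"
      have "((\<lambda>u. G * u powr (- w)) has_integral (?F (real m + 1) - ?F (real m))) {real m..real m + 1}"
      proof (rule fundamental_theorem_of_calculus_interior)
        show "continuous_on {real m..real m + 1} ?F"
          using w by (intro continuous_on_mult continuous_on_divide continuous_on_powr' continuous_intros) auto
        show "(?F has_vector_derivative G * u powr (- w)) (at u)" if "u \<in> {real m<..<real m + 1}" for u
        proof -
          have "u > 0" by (rule le_less_trans[of 0 "real m"]) (use that in auto)
          then show ?thesis
            unfolding has_real_derivative_iff_has_vector_derivative[symmetric]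
            using w by (auto intro!: derivative_eq_intros)
        qed
      qed auto
      then show "((\<lambda>u. G * u powr (- w)) has_integral ?J) {real m..real m + 1}"
        by (simp add: diff_divide_distrib right_diff_distrib)
    qed (use G in auto)
    finally show ?thesis .
  qed
  have split: "(\<integral>\<^sup>+u. ennreal (?E u x) * indicator {0<..} x * indicator {real m..real m + 1} u \<partial>lborel) =
      ennreal (x powr (w - 1) * exp_trapezoid x (real m)) * indicator {0<..} x +
      (ennreal (1 / 2) * (ennreal (?E (real m) x) * indicator {0<..} x) + ennreal (1 / 2) * (ennreal (?E (real m + 1) x) * indicator {0<..} x))" for x
  proof (cases "x > 0")
    case True
    let ?F = "\<lambda>u. x powr (w - 1) * (u + exp (- (u * x)) / x)"
    have "(\<integral>\<^sup>+u. ennreal (?E u x) * indicator {0<..} x * indicator {real m..real m + 1} u \<partial>lborel) =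
        (\<integral>\<^sup>+u. ennreal (?E u x) * indicator {real m..real m + 1} u \<partial>lborel)"
      using True by simp
    also have "\<dots> = ennreal (?F (real m + 1) - ?F (real m))"
      using True by (intro nn_integral_FTC_Icc) (auto intro!: derivative_eq_intros simp: field_simps)
    also have "?F (real m + 1) - ?F (real m) =
        x powr (w - 1) * exp_trapezoid x (real m) + (1 / 2 * ?E (real m) x + 1 / 2 * ?E (real m + 1) x)"
      by (simp add: exp_trapezoid_def diff_divide_distrib add_divide_distrib algebra_simps)
    finally have int: "(\<integral>\<^sup>+u. ennreal (?E u x) * indicator {0<..} x * indicator {real m..real m + 1} u \<partial>lborel) = \<dots>" .
    have add: "ennreal (a + (1 / 2 * b + 1 / 2 * c)) = ennreal a + (ennreal (1 / 2) * ennreal b + ennreal (1 / 2) * ennreal c)"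
      if "a \<ge> 0" "b \<ge> 0" "c \<ge> 0" for a b c :: real
    proof -
      have "ennreal (1 / 2 * y) = ennreal (1 / 2) * ennreal y" for y
        by (rule ennreal_mult') simp
      from this[symmetric] show ?thesis using that by (simp only: ennreal_plus add_nonneg_nonneg mult_nonneg_nonneg zero_le_divide_1_iff zero_le_numeral)
    qed
    have ind: "indicator {0<..} x = (1 :: ennreal)" using True by simp
    show ?thesis unfolding int unfolding ind mult_1_right
      using True exp_trapezoid_nonneg[OF True, of m] by (intro add) auto
  qed auto
  have "ennreal ?J = (\<integral>\<^sup>+x. (\<integral>\<^sup>+u. ennreal (?E u x) * indicator {0<..} x * indicator {real m..real m + 1} u \<partial>lborel) \<partial>lborel)"
    unfolding J[symmetric] by (rule lborel_Fubini_nn) measurable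
  also have "\<dots> = ?I + (ennreal (1 / 2) * ennreal (G * real m powr (- w)) + ennreal (1 / 2) * ennreal (G * (real m + 1) powr (- w)))"
    unfolding split exp_trapezoid_def
    by (simp add: nn_integral_add nn_integral_cmult E)
  also have "ennreal (1 / 2) * ennreal (G * real m powr (- w)) + ennreal (1 / 2) * ennreal (G * (real m + 1) powr (- w)) = ennreal ?S"
  proof -
    have half: "ennreal (1 / 2) * ennreal y = ennreal (1 / 2 * y)" for y
      by (rule ennreal_mult'[symmetric]) simp
    show ?thesis unfolding half using G
      by (subst ennreal_plus[symmetric]) (auto simp: distrib_left)
  qed
  finally have main: "ennreal ?J = ?I + ennreal ?S" .
  have S: "?S \<ge> 0" using G by simp
  have "ennreal ?S \<le> ennreal ?J" unfolding main by simp
  then have le: "?S \<le> ?J"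
    using G w S by (subst (asm) ennreal_le_iff) (auto intro!: mult_nonneg_nonneg divide_nonneg_nonneg powr_mono2)
  have GT: "G * T m = ?J - ?S" by (simp add: T_def algebra_simps)
  then show "G * T m \<ge> 0" using le by simp
  have "?I = ennreal ?J - ennreal ?S" unfolding main by (simp add: ennreal_add_diff_cancel_right)
  also have "\<dots> = ennreal (?J - ?S)" using S by (simp add: ennreal_minus)
  finally show "?I = ennreal (G * T m)" unfolding GT .
qed

lemma Gamma_duplication_real:
  fixes w :: real
  assumes "w > -1"
  shows "Gamma ((1 + w) / 2) * Gamma (w / 2 + 1) = 2 powr (- w) * sqrt pi * Gamma (w + 1)"
proof -
  let ?z = "complex_of_real ((1 + w) / 2)"
  have np: "of_real x \<notin> (\<int>\<^sub>\<le>\<^sub>0 :: complex set)" if "x > 0" for x :: real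
    using that by (auto simp: complex_nonpos_Reals_iff dest: nonpos_Ints_subset_nonpos_Reals[THEN subsetD])
  have z: "?z \<notin> \<int>\<^sub>\<le>\<^sub>0" using assms by (intro np) simp
  have half: "?z + 1 / 2 = of_real (w / 2 + 1)" by (simp add: add_divide_distrib)
  then have z': "?z + 1 / 2 \<notin> \<int>\<^sub>\<le>\<^sub>0" using assms np[of "w / 2 + 1"] by simp
  have e: "exp ((1 - 2 * ?z) * of_real (ln 2)) = of_real (2 powr (- w))"
  proof -
    have "(1 - 2 * ?z) * of_real (ln 2) = of_real (- w * ln 2)" by (simp add: field_simps)
    then show ?thesis by (simp only: exp_of_real) (simp add: powr_def)
  qed
  have two: "2 * ?z = of_real (w + 1)" by (simp add: add.commute)
  have "complex_of_real (Gamma ((1 + w) / 2) * Gamma (w / 2 + 1)) = of_real (2 powr (- w) * sqrt pi * Gamma (w + 1))"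
    using Gamma_legendre_duplication[OF z z'] unfolding half e unfolding two Gamma_complex_of_real by simp
  then show ?thesis by (simp only: of_real_eq_iff)
qed

section \<open>The relation between zeta(w) and zeta(1 - w)\<close>

lemma zeta_functional_equation_sums:
  fixes w :: real
  assumes w: "-1 < w" "w < 0"
  obtains S T where
    "zeta_reg (1 - of_real w) = of_real (- w * S)" "zeta_reg (of_real w) = of_real ((1 - w) * T)"
    "Gamma ((1 + w) / 2) * Gamma ((1 - w) / 2) * (2 * pi) powr (w - 1) * S = Gamma (w + 1) / (- w) * T"
proof -
  define G where "G = Gamma (w + 1) / (- w)"
  define K where "K = Gamma ((1 + w) / 2) * Gamma ((1 - w) / 2)"
  define t where "t m = ((real m + 1) powr (1 - w) - real m powr (1 - w)) / (1 - w) - (real m powr (- w) + (real m + 1) powr (- w)) / 2" for m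
  \<comment> \<open>In terms of zeta, S is zeta(1 - w) and T is - zeta(w). The term
    \<open>t 0\<close>, which belongs to the interval [0, 1], supplies the part 1 + (w - 1) / 2 of
    \<open>zeta_reg\<close>.\<close>
  define S where "S = (\<Sum>n. real (Suc n) powr (w - 1))"
  define T where "T = (\<Sum>n. t n)"
  have G: "G > 0" unfolding G_def using w by (intro divide_pos_pos) auto
  have K: "K > 0" unfolding K_def using w by (intro mult_pos_pos) auto
  have sS: "summable (\<lambda>n. real (Suc n) powr (w - 1))"
    using summable_of_nat_powr[of "w - 1" 1] w by simp
  have zS: "zeta_reg (1 - of_real w) = of_real (- w * S)"
  proof -
    have "(\<lambda>n. (1 - of_real w - 1) * of_nat (Suc n) powr - (1 - complex_of_real w)) sums zeta_reg (1 - of_real w)"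
      by (rule zeta_reg_sums) (use w in auto)
    also have "(\<lambda>n. (1 - of_real w - 1) * of_nat (Suc n) powr - (1 - complex_of_real w)) = (\<lambda>n. of_real (- w * real (Suc n) powr (w - 1)))"
    proof
      fix n
      have "of_real (real (Suc n) powr (w - 1)) = of_real (real (Suc n)) powr (complex_of_real (w - 1))"
        by (rule powr_of_real[symmetric]) simp
      then show "(1 - of_real w - 1) * of_nat (Suc n) powr - (1 - complex_of_real w) = of_real (- w * real (Suc n) powr (w - 1))"
        by simp
    qed
    finally have 1: "(\<lambda>n. complex_of_real (- w * real (Suc n) powr (w - 1))) sums zeta_reg (1 - of_real w)" .
    have 2: "(\<lambda>n. complex_of_real (- w * real (Suc n) powr (w - 1))) sums of_real (- w * S)"
      unfolding S_def by (intro sums_of_real sums_mult summable_sums sS)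
    show ?thesis by (rule sums_unique2[OF 1 2])
  qed
  have tt: "trapezoid_term (of_nat (Suc n)) (of_real w) = of_real ((1 - w) * t (Suc n))" for n
  proof -
    have p: "of_real (x powr a) = complex_of_real x powr of_real a" if "x \<ge> 0" for x a
      using that by (rule powr_of_real[symmetric])
    have "(1 - w) * t (Suc n) = (w - 1) * (real (Suc n) powr (- w) + (real (Suc n) + 1) powr (- w)) / 2 + (real (Suc n) + 1) powr (1 - w) - real (Suc n) powr (1 - w)"
      using w unfolding t_def by (simp add: field_simps del: of_nat_Suc)
    then show ?thesis
      unfolding trapezoid_term_def by (simp add: p del: of_nat_Suc)
  qed
  have "summable (\<lambda>n. complex_of_real ((1 - w) * t (Suc n)))"
    using summable_norm_cancel[OF zeta_reg_summable[of "of_real w"]] w unfolding tt by simp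
  then have "summable (\<lambda>n. (1 - w) * t (Suc n))" by (simp only: summable_of_real_iff)
  then have "summable (\<lambda>n. t (Suc n))" using w by (subst (asm) summable_cmult_iff) auto
  then have sT: "summable t" by (simp only: summable_Suc_iff)
  have zT: "zeta_reg (of_real w) = of_real ((1 - w) * T)"
  proof -
    have "(\<lambda>n. t (Suc n)) sums (T - t 0)"
      unfolding T_def using sT by (subst sums_Suc_iff) (simp add: summable_sums)
    then have "(\<lambda>n. complex_of_real ((1 - w) * t (Suc n))) sums of_real ((1 - w) * (T - t 0))"
      by (intro sums_of_real sums_mult)
    then have "zeta_reg (of_real w) = 1 + (of_real w - 1) / 2 + of_real ((1 - w) * (T - t 0))"
      unfolding zeta_reg_def tt by (simp add: sums_iff)
    moreover have "(1 - w) * t 0 = 1 + (w - 1) / 2" using w by (simp add: t_def field_simps)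
    then have "complex_of_real ((1 - w) * t 0) = of_real (1 + (w - 1) / 2)" by simp
    ultimately show ?thesis by (simp add: right_diff_distrib)
  qed
  let ?c = "\<lambda>x. (1 + exp (- x)) / (2 * (1 - exp (- x))) - 1 / x"
  let ?I = "\<integral>\<^sup>+x\<in>{0<..}. ennreal (x powr (w - 1) * ?c x) \<partial>lborel"
  have "?I = (\<integral>\<^sup>+x. (\<Sum>n. ennreal (x powr (w - 1) * (2 * x / (x\<^sup>2 + (2 * pi * real (Suc n))\<^sup>2))) * indicator {0<..} x) \<partial>lborel)"
  proof (rule nn_integral_cong)
    fix x :: real
    show "ennreal (x powr (w - 1) * ?c x) * indicator {0<..} x =
      (\<Sum>n. ennreal (x powr (w - 1) * (2 * x / (x\<^sup>2 + (2 * pi * real (Suc n))\<^sup>2))) * indicator {0<..} x)"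
    proof (cases "x > 0")
      case True
      have s: "(\<lambda>n. x powr (w - 1) * (2 * x / (x\<^sup>2 + (2 * pi * real (Suc n))\<^sup>2))) sums (x powr (w - 1) * ?c x)"
        by (intro sums_mult coth_sums True)
      have "(\<Sum>n. ennreal (x powr (w - 1) * (2 * x / (x\<^sup>2 + (2 * pi * real (Suc n))\<^sup>2)))) = ennreal (x powr (w - 1) * ?c x)"
        unfolding sums_unique[OF s]
        by (rule suminf_ennreal2) (use s True in \<open>auto simp: sums_iff\<close>)
      then show ?thesis using True by simp
    qed auto
  qed
  also have "\<dots> = (\<Sum>n. (\<integral>\<^sup>+x\<in>{0<..}. ennreal (x powr (w - 1) * (2 * x / (x\<^sup>2 + (2 * pi * real (Suc n))\<^sup>2))) \<partial>lborel))"
    by (rule nn_integral_suminf) measurable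
  also have "\<dots> = (\<Sum>n. ennreal (K * (2 * pi) powr (w - 1) * real (Suc n) powr (w - 1)))"
    using w by (subst Mellin_Poisson_kernel) (auto simp: K_def powr_mult mult.assoc simp del: of_nat_Suc)
  also have "\<dots> = ennreal (K * (2 * pi) powr (w - 1) * S)"
    unfolding S_def using K by (subst suminf_ennreal2) (auto intro!: summable_mult sS simp: suminf_mult[OF sS] simp del: of_nat_Suc)
  finally have 1: "?I = ennreal (K * (2 * pi) powr (w - 1) * S)" .
  have "?I = (\<integral>\<^sup>+x. (\<Sum>m. ennreal (x powr (w - 1) * exp_trapezoid x (real m)) * indicator {0<..} x) \<partial>lborel)"
  proof (rule nn_integral_cong)
    fix x :: real
    show "ennreal (x powr (w - 1) * ?c x) * indicator {0<..} x =
      (\<Sum>m. ennreal (x powr (w - 1) * exp_trapezoid x (real m)) * indicator {0<..} x)"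
    proof (cases "x > 0")
      case True
      have s: "(\<lambda>m. x powr (w - 1) * exp_trapezoid x (real m)) sums (x powr (w - 1) * ?c x)"
        by (intro sums_mult exp_trapezoid_sums True)
      have "(\<Sum>m. ennreal (x powr (w - 1) * exp_trapezoid x (real m))) = ennreal (x powr (w - 1) * ?c x)"
        unfolding sums_unique[OF s]
        by (rule suminf_ennreal2) (use s exp_trapezoid_nonneg[OF True] in \<open>auto simp: sums_iff\<close>)
      then show ?thesis using True by simp
    qed auto
  qed
  also have "\<dots> = (\<Sum>m. (\<integral>\<^sup>+x\<in>{0<..}. ennreal (x powr (w - 1) * exp_trapezoid x (real m)) \<partial>lborel))"
    by (rule nn_integral_suminf) (unfold exp_trapezoid_def, measurable)
  also have "\<dots> = (\<Sum>m. ennreal (G * t m))"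
    unfolding G_def t_def Mellin_exp_trapezoid(1)[OF w] ..
  also have "\<dots> = ennreal (G * T)"
    unfolding T_def suminf_mult[OF sT, symmetric]
    using Mellin_exp_trapezoid(2)[OF w] by (intro suminf_ennreal2 summable_mult sT) (auto simp: G_def t_def)
  finally have "ennreal (K * (2 * pi) powr (w - 1) * S) = ennreal (G * T)" unfolding 1 .
  moreover have "S \<ge> 0" unfolding S_def by (intro suminf_nonneg sS) auto
  moreover have "G * T \<ge> 0"
    unfolding T_def suminf_mult[OF sT, symmetric]
    using Mellin_exp_trapezoid(2)[OF w] by (intro suminf_nonneg summable_mult sT) (auto simp: G_def t_def)
  ultimately have "K * (2 * pi) powr (w - 1) * S = G * T"
    using K by (subst (asm) ennreal_inj) auto
  then show ?thesis using that[OF zS zT] by (simp add: K_def G_def)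
qed

text \<open>Riemann's xi function, considered on \<open>Re s > -1\<close> only. Writing Gamma(s / 2
  + 1) for (s / 2) Gamma(s / 2) spares the cancellation of a pole at 0.\<close>

definition xi_reg :: "complex \<Rightarrow> complex" where
  "xi_reg s = of_real pi powr (- s / 2) * Gamma (s / 2 + 1) * zeta_reg s"

lemma xi_reg_holomorphic: "xi_reg holomorphic_on {s. Re s > -1}"
proof -
  have "(\<lambda>s. s / 2 + 1) ` {s. Re s > -1} \<inter> \<int>\<^sub>\<le>\<^sub>0 = {}"
    by (auto elim!: nonpos_Ints_cases simp: complex_eq_iff)
  then show ?thesis
    unfolding xi_reg_def by (intro holomorphic_intros zeta_reg_holomorphic) (auto simp: image_iff)
qed

lemma xi_reg_symmetric_real:
  fixes w :: real
  assumes w: "-1 < w" "w < 0"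
  shows "xi_reg (of_real w) = xi_reg (1 - of_real w)"
proof -
  obtain S T where ST: "zeta_reg (1 - of_real w) = of_real (- w * S)" "zeta_reg (of_real w) = of_real ((1 - w) * T)"
    "Gamma ((1 + w) / 2) * Gamma ((1 - w) / 2) * (2 * pi) powr (w - 1) * S = Gamma (w + 1) / (- w) * T"
    using zeta_functional_equation_sums[OF w] .
  have L: "xi_reg (of_real w) = of_real (pi powr (- w / 2) * Gamma (w / 2 + 1) * ((1 - w) * T))"
    unfolding xi_reg_def ST using powr_of_real[of pi "- w / 2"] Gamma_complex_of_real[of "w / 2 + 1"] by simp
  have R: "xi_reg (1 - of_real w) = of_real (pi powr (- (1 - w) / 2) * Gamma ((1 - w) / 2 + 1) * (- w * S))"
    unfolding xi_reg_def ST using powr_of_real[of pi "- (1 - w) / 2"] Gamma_complex_of_real[of "(1 - w) / 2 + 1"] by simp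
  have G1: "Gamma ((1 - w) / 2 + 1) = (1 - w) / 2 * Gamma ((1 - w) / 2)"
    using w by (intro Gamma_plus1) (auto elim!: nonpos_Ints_cases)
  let ?A = "Gamma ((1 + w) / 2)"
  have A: "?A > 0" using w by simp
  \<comment> \<open>After multiplication by \<open>?A\<close>, one side contains the left side of
    \<open>ST(3)\<close> and the other the left side of the duplication formula.\<close>
  have "?A * (pi powr (- (1 - w) / 2) * Gamma ((1 - w) / 2 + 1) * (- w * S)) =
      pi powr (- (1 - w) / 2) * ((1 - w) / 2) * (- w) * (?A * Gamma ((1 - w) / 2) * (2 * pi) powr (w - 1) * S) * (2 * pi) powr (1 - w)"
    unfolding G1 using powr_add[of "2 * pi" "w - 1" "1 - w"] by (simp add: mult_ac)
  also have "\<dots> = pi powr (- (1 - w) / 2) * ((1 - w) / 2) * (2 * pi) powr (1 - w) * Gamma (w + 1) * T"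
    unfolding ST(3) using w by simp
  also have "\<dots> = (pi powr (- (1 - w) / 2) * pi powr (1 - w) * pi powr (- 1 / 2)) * ((2 powr (1 - w) * 2 powr w / 2)
      * (1 - w) * (2 powr (- w) * sqrt pi * Gamma (w + 1)) * T)"
    by (simp add: powr_mult powr_minus powr_half_sqrt[symmetric] field_simps)
  also have "pi powr (- (1 - w) / 2) * pi powr (1 - w) * pi powr (- 1 / 2) = pi powr (- w / 2)"
    by (simp add: powr_add[symmetric] field_simps)
  also have "2 powr (1 - w) * 2 powr w / 2 = (1::real)"
    by (simp add: powr_add[symmetric])
  also have "2 powr (- w) * sqrt pi * Gamma (w + 1) = ?A * Gamma (w / 2 + 1)"
    using Gamma_duplication_real[of w] w by simp
  finally have "?A * (pi powr (- (1 - w) / 2) * Gamma ((1 - w) / 2 + 1) * (- w * S)) =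
      ?A * (pi powr (- w / 2) * Gamma (w / 2 + 1) * ((1 - w) * T))" by (simp add: mult_ac)
  with A have "pi powr (- (1 - w) / 2) * Gamma ((1 - w) / 2 + 1) * (- w * S) = pi powr (- w / 2) * Gamma (w / 2 + 1) * ((1 - w) * T)"
    by (subst (asm) mult_cancel_left) auto
  then show ?thesis unfolding L R by simp
qed

lemma xi_reg_symmetric:
  assumes "-1 < Re s" "Re s < 2"
  shows "xi_reg (1 - s) = xi_reg s"
proof -
  let ?D = "{s. Re s > -1} \<inter> {s. Re s < 2}"
  let ?U = "complex_of_real ` {-1<..<0}"
  have "(\<lambda>s. xi_reg (1 - s) - xi_reg s) holomorphic_on ?D"
  proof (intro holomorphic_on_diff)
    have "(xi_reg \<circ> (\<lambda>s. 1 - s)) holomorphic_on ?D"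
      by (rule holomorphic_on_compose_gen[OF _ xi_reg_holomorphic]) (auto intro!: holomorphic_intros)
    then show "(\<lambda>s. xi_reg (1 - s)) holomorphic_on ?D" by (simp add: o_def)
    show "xi_reg holomorphic_on ?D" by (rule holomorphic_on_subset[OF xi_reg_holomorphic]) auto
  qed
  moreover have "open ?D" by (intro open_Int open_halfspace_Re_gt open_halfspace_Re_lt)
  moreover have "connected ?D"
    by (intro convex_connected convex_Int convex_halfspace_Re_gt convex_halfspace_Re_lt)
  moreover have "?U \<subseteq> ?D" "complex_of_real (- 1 / 2) \<in> ?D" by auto
  moreover have "complex_of_real (- 1 / 2) islimpt ?U"
  proof (rule islimpt_approachable[THEN iffD2], intro allI impI)
    fix e :: real assume e: "e > 0"
    let ?x = "- 1 / 2 + min (e / 2) (1 / 4)"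
    have "dist (complex_of_real ?x) (of_real (- 1 / 2)) < e"
      unfolding dist_norm of_real_diff[symmetric] norm_of_real using e by auto
    moreover have "?x \<in> {-1<..<0}" "?x \<noteq> - 1 / 2" using e by auto
    ultimately show "\<exists>x'\<in>?U. x' \<noteq> of_real (- 1 / 2) \<and> dist x' (of_real (- 1 / 2)) < e"
      by (intro bexI[of _ "of_real ?x"]) (auto simp only: of_real_eq_iff image_eqI)
  qed
  ultimately have "xi_reg (1 - s) - xi_reg s = 0"
    by (rule analytic_continuation[where f = "\<lambda>s. xi_reg (1 - s) - xi_reg s" and U = ?U])
       (use assms xi_reg_symmetric_real in auto)
  then show ?thesis by simp
qed

text \<open>The definite description must be shown to denote. On \<open>Re s < 0\<close> the
  candidate is defined by the functional equation, with the entire function \<open>rGamma\<close> in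
  place of division by Gamma; by \<open>xi_reg_symmetric\<close> both formulas agree for -1 < Re s <
  0. Uniqueness is the identity theorem on the punctured plane.\<close>

lemma riemann_zeta_eq:
  assumes "Re s > -1"
  shows "riemann_zeta s = zeta_reg s / (s - 1)"
proof -
  let ?A = "{s. Re s > -1}" and ?B = "{s. Re s < 0}"
  let ?l = "\<lambda>s. xi_reg (1 - s) * of_real pi powr (s / 2) * rGamma (s / 2 + 1)"
  define z where "z s = (if s \<in> ?A then zeta_reg s else ?l s)" for s
  have AB: "?A \<union> ?B = UNIV" by force
  have "z holomorphic_on (?A \<union> ?B)"
    unfolding z_def
  proof (rule holomorphic_on_If_Un)
    have "(xi_reg \<circ> (\<lambda>s. 1 - s)) holomorphic_on ?B"
      by (rule holomorphic_on_compose_gen[OF _ xi_reg_holomorphic]) (auto intro!: holomorphic_intros)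
    then show "?l holomorphic_on ?B" by (intro holomorphic_intros) (auto simp: o_def)
    show "zeta_reg s = ?l s" if "s \<in> ?A" "s \<in> ?B" for s
    proof -
      have "s / 2 + 1 \<notin> \<int>\<^sub>\<le>\<^sub>0" using that by (auto elim!: nonpos_Ints_cases simp: complex_eq_iff)
      then have "Gamma (s / 2 + 1) * rGamma (s / 2 + 1) = 1"
        by (simp add: rGamma_inverse_Gamma Gamma_eq_zero_iff)
      moreover have "complex_of_real pi powr (- s / 2) * of_real pi powr (s / 2) = 1"
        by (simp add: powr_add[symmetric])
      moreover have "xi_reg (1 - s) = xi_reg s" using that by (intro xi_reg_symmetric) auto
      ultimately show ?thesis by (simp add: xi_reg_def mult_ac)
    qed
  qed (auto intro: zeta_reg_holomorphic open_halfspace_Re_gt open_halfspace_Re_lt)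
  then have hol: "z holomorphic_on UNIV" unfolding AB .
  define F where "F s = z s / (s - 1)" for s
  have F: "F holomorphic_on - {1} \<and> (\<forall>s. Re s > 1 \<longrightarrow> (\<lambda>n. of_nat (Suc n) powr (- s)) sums F s) \<and> F 1 = 0"
  proof (intro conjI allI impI)
    show "F holomorphic_on - {1}" unfolding F_def
      by (intro holomorphic_intros holomorphic_on_subset[OF hol]) auto
    \<comment> \<open>Division by zero yields exactly the value prescribed at the pole.\<close>
    show "F 1 = 0" by (simp add: F_def)
    fix s :: complex assume s: "Re s > 1"
    then have "s \<noteq> 1" by auto
    then show "(\<lambda>n. of_nat (Suc n) powr (- s)) sums F s"
      using sums_divide[OF zeta_reg_sums[OF s], of "s - 1"] s by (simp add: F_def z_def)
  qed
  have "riemann_zeta = F" unfolding riemann_zeta_def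
  proof (rule the_equality, rule F, elim conjE, rule ext)
    fix f s assume f: "f holomorphic_on - {1}" "\<forall>s. 1 < Re s \<longrightarrow> (\<lambda>n. of_nat (Suc n) powr - s) sums f s" "f 1 = 0"
    show "f s = F s"
    proof (cases "s = 1")
      case False
      show ?thesis
      proof (rule analytic_continuation_open[where s = "{s. Re s > 1}" and s' = "- {1}" and f = f and g = F])
        show "{s. Re s > 1} \<noteq> {}" by (auto intro: exI[of _ 2])
        show "connected (- {1 :: complex})" by (rule connected_punctured_universe) simp
        show "f s = F s" if "s \<in> {s. Re s > 1}" for s
          using that f(2) F sums_unique2 by blast
      qed (use False f F open_halfspace_Re_gt in auto)
    qed (use f F in auto)
  qed
  then have "riemann_zeta s = F s" by (rule fun_cong)
  also have "z s = zeta_reg s" using assms unfolding z_def by simp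
  then have "F s = zeta_reg s / (s - 1)" unfolding F_def by simp
  finally show ?thesis .
qed

section \<open>Monotonicity of the completed zeta function\<close>

lemma Borel_Caratheodory:
  fixes f :: "complex \<Rightarrow> complex"
  assumes hol: "f holomorphic_on ball p R" and "f p = 0"
    and less: "\<And>z. z \<in> ball p R \<Longrightarrow> Re (f z) < A"
    and z: "dist p z \<le> r" "r < R"
  shows "norm (f z) \<le> 2 * A * r / (R - r)"
proof -
  have r: "0 \<le> r" using z(1) zero_le_dist order.trans by blast
  then have R: "R > 0" using z by simp
  have A: "A > 0" using less[of p] assms(2) R by simp
  \<comment> \<open>The map w -> w / (2 A - w) sends the half-plane \<open>Re w < A\<close> into the
    unit disc and fixes 0, so Schwarz's lemma applies to \<open>g\<close>.\<close>
  define g where "g u = f (p + of_real R * u) / (2 * of_real A - f (p + of_real R * u))" for u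
  have in_ball: "p + of_real R * u \<in> ball p R" if "norm u < 1" for u
    using that R by (simp add: dist_norm norm_mult)
  have ne: "2 * of_real A - w \<noteq> 0" if "Re w < A" for w :: complex
    using that A by (auto simp: complex_eq_iff)
  have lt: "norm w < norm (2 * of_real A - w)" if "Re w < A" for w :: complex
  proof -
    have "(norm (2 * of_real A - w))\<^sup>2 - (norm w)\<^sup>2 = 4 * A * (A - Re w)"
      unfolding cmod_power2 by (simp add: power2_eq_square algebra_simps)
    moreover have "\<dots> > 0" using that A by simp
    ultimately have "(norm w)\<^sup>2 < (norm (2 * of_real A - w))\<^sup>2" by simp
    then show ?thesis by (rule power_less_imp_less_base) simp
  qed
  have comp: "(\<lambda>u. f (p + of_real R * u)) holomorphic_on ball 0 1"
  proof -
    have "(f \<circ> (\<lambda>u. p + of_real R * u)) holomorphic_on ball 0 1"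
      by (rule holomorphic_on_compose_gen[OF _ hol]) (use in_ball in \<open>auto intro!: holomorphic_intros\<close>)
    then show ?thesis by (simp add: o_def)
  qed
  have "g holomorphic_on ball 0 1"
    unfolding g_def using ne less in_ball by (intro holomorphic_intros comp) auto
  moreover have "g 0 = 0" by (simp add: g_def assms(2))
  moreover have "norm (g u) < 1" if "norm u < 1" for u
    using lt[OF less[OF in_ball[OF that]]] ne[OF less[OF in_ball[OF that]]]
    by (simp add: g_def norm_divide)
  moreover define u where "u = (z - p) / of_real R"
  moreover have u_le: "norm u \<le> r / R"
    using z(1) R by (simp add: u_def norm_divide dist_norm norm_minus_commute divide_right_mono)
  moreover have "r / R < 1" using z R by simp
  ultimately have gu: "norm (g u) \<le> norm u" by (intro Schwarz_Lemma(1)) auto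
  have "norm u < 1" using u_le \<open>r / R < 1\<close> by simp
  then have fz: "Re (f z) < A" using in_ball[of u] less[of z] R by (simp add: u_def)
  have "g u = f z / (2 * of_real A - f z)" using R by (simp add: g_def u_def)
  then have "norm (f z) = norm (g u) * norm (2 * of_real A - f z)"
    using ne[OF fz] by (simp add: norm_divide)
  also have "\<dots> \<le> r / R * (2 * A + norm (f z))"
    using gu u_le A r R norm_triangle_ineq4[of "2 * of_real A" "f z"] by (intro mult_mono) (auto simp: norm_mult)
  finally have "R * norm (f z) \<le> r * (2 * A + norm (f z))" using R by (simp add: field_simps)
  then show ?thesis using z by (simp add: field_simps)
qed

text \<open>The Dirichlet series differs from 1 by at most zeta(2) - 1 = pi^2 / 6 - 1 < 2/3, and |s
  - 1| is at least 1.\<close>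

lemma zeta_reg_lower_bound_Re_ge_2:
  assumes "Re s \<ge> 2"
  shows "norm (zeta_reg s) \<ge> 1 / 3"
proof -
  let ?f = "\<lambda>n. of_nat (Suc n) powr (- s) :: complex"
  define S where "S = (\<Sum>n. ?f n)"
  have s: "Re s > 1" using assms by simp
  have S: "?f sums S" unfolding S_def
    using summable_norm_cancel[OF summable_norm_powr[OF s]] by (rule summable_sums)
  have Z: "zeta_reg s = (s - 1) * S"
    using zeta_reg_sums[OF s] sums_mult[OF S, of "s - 1"] by (rule sums_unique2)
  have S1: "(\<lambda>n. ?f (Suc n)) sums (S - 1)"
    using S by (subst sums_Suc_iff) simp
  have B: "(\<lambda>n. 1 / (real (Suc n) + 1)\<^sup>2) sums (pi\<^sup>2 / 6 - 1)"
    using inverse_squares_sums by (subst sums_Suc_iff) (simp add: add.commute)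
  have "norm (\<Sum>n. ?f (Suc n)) \<le> (\<Sum>n. 1 / (real (Suc n) + 1)\<^sup>2)"
  proof (rule norm_suminf_le)
    fix n
    have "norm (?f (Suc n)) = real (Suc (Suc n)) powr (- Re s)" by (subst norm_powr_real_powr) auto
    also have "\<dots> \<le> real (Suc (Suc n)) powr (- 2)" using assms by (intro powr_mono) auto
    also have "\<dots> = 1 / (real (Suc n) + 1)\<^sup>2" by (simp add: powr_minus powr_numeral field_simps)
    finally show "norm (?f (Suc n)) \<le> 1 / (real (Suc n) + 1)\<^sup>2" .
  qed (use B in \<open>simp add: sums_iff\<close>)
  then have "norm (S - 1) \<le> pi\<^sup>2 / 6 - 1"
    using S1 B by (simp add: sums_iff)
  moreover have "pi\<^sup>2 \<le> (3.15)\<^sup>2" using pi_approx by (intro power_mono) auto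
  moreover have "norm (1::complex) \<le> norm S + norm (S - 1)"
    using norm_triangle_ineq4[of S "S - 1"] by simp
  ultimately have "norm S \<ge> 1 / 3" by (simp add: power2_eq_square)
  moreover have "norm (s - 1) \<ge> 1"
    using assms abs_Re_le_cmod[of "s - 1"] by simp
  ultimately have "1 * (1 / 3) \<le> norm (s - 1) * norm S" by (intro mult_mono) auto
  then show ?thesis unfolding Z norm_mult by simp
qed

text \<open>Polynomial lower bounds for zeta to the right of a zero-free line follow from the polynomial
  upper bound by applying the Borel--Caratheodory inequality to a branch of the logarithm on discs
  around \<open>2 + it\<close>.\<close>

lemma zeta_reg_lower_bound:
  assumes nz: "\<And>s. Re s > 1 / 2 \<Longrightarrow> zeta_reg s \<noteq> 0" and a: "a > 0"
  obtains C q where "C > 0" "\<And>s. Re s \<ge> 1 / 2 + a \<Longrightarrow> 1 / norm (zeta_reg s) \<le> C * (1 + norm s) powr q"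
proof -
  obtain C0 where C0: "C0 > 0" "\<And>s. Re s \<ge> -1 + 1 \<Longrightarrow> norm (zeta_reg s) \<le> C0 * (1 + norm s) ^ 3"
    using zeta_reg_growth[of 1] by auto
  \<comment> \<open>375 = 3 * 5^3: the 3 comes from the lower bound 1/3 at the centre of the disc,
    the 5^3 from \<open>1 + norm z \<le> 5 * (1 + norm s)\<close> on the disc and cubic growth.
    Adding 1 makes the bound strict and its logarithm positive.\<close>
  define C1 where "C1 = 375 * C0 + 1"
  have C1: "C1 > 1" using C0 by (simp add: C1_def)
  show thesis
  proof (rule that)
    show "3 * C1 powr (3 / a) > 0" using C1 by simp
    fix s assume s: "Re s \<ge> 1 / 2 + a"
    let ?Y = "1 + norm s"
    have Y: "?Y \<ge> 1" by simp
    have CY: "C1 * ?Y ^ 3 > 1"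
    proof -
      have "1 * 1 < C1 * ?Y ^ 3" using C1 Y by (intro mult_less_le_imp_less one_le_power) auto
      then show ?thesis by simp
    qed
    have bound: "1 / norm (zeta_reg s) \<le> 3 * (C1 * ?Y ^ 3) powr (3 / a)"
    proof (cases "Re s \<ge> 2")
      case True
      have "1 / norm (zeta_reg s) \<le> 3"
        using frac_le[of 1 1 "1 / 3" "norm (zeta_reg s)"] zeta_reg_lower_bound_Re_ge_2[OF True] by simp
      moreover have "1 \<le> (C1 * ?Y ^ 3) powr (3 / a)"
        using CY a by (intro ge_one_powr_ge_zero) auto
      ultimately show ?thesis by linarith
    next
      case False
      \<comment> \<open>The disc of radius 3/2 around \<open>p\<close> just touches the critical
        line, so \<open>zeta_reg\<close> has a logarithm on it, while s keeps the distance a from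
        the line.\<close>
      define p where "p = Complex 2 (Im s)"
      let ?r = "3 / 2 - a"
      let ?A = "ln (C1 * ?Y ^ 3)"
      have hp: "Re z > 1 / 2" if "z \<in> ball p (3 / 2)" for z
      proof -
        have "Re (p - z) < 3 / 2" using that complex_Re_le_cmod[of "p - z"] by (simp add: dist_norm)
        then show ?thesis by (simp add: p_def)
      qed
      have "zeta_reg holomorphic_on ball p (3 / 2)"
        by (rule holomorphic_on_subset[OF zeta_reg_holomorphic]) (use hp in force)
      then obtain L where L: "L holomorphic_on ball p (3 / 2)" "\<And>z. z \<in> ball p (3 / 2) \<Longrightarrow> zeta_reg z = exp (L z)"
        by (rule contractible_imp_holomorphic_log) (use nz hp convex_imp_contractible[OF convex_ball] in auto)
      have p: "p \<in> ball p (3 / 2)" by simp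
      have Zp: "norm (zeta_reg p) \<ge> 1 / 3" by (rule zeta_reg_lower_bound_Re_ge_2) (simp add: p_def)
      define f where "f z = L z - L p" for z
      have "dist p s = \<bar>2 - Re s\<bar>"
        by (simp add: dist_norm p_def cmod_def)
      then have ds: "dist p s \<le> ?r" using False s by simp
      have "norm (f s) \<le> 2 * ?A * ?r / (3 / 2 - ?r)"
      proof (rule Borel_Caratheodory[where f = f and p = p and z = s])
        show "f holomorphic_on ball p (3 / 2)" unfolding f_def by (intro holomorphic_intros L)
        show "f p = 0" by (simp add: f_def)
        show "dist p s \<le> ?r" by (rule ds)
        show "?r < 3 / 2" using a by simp
        fix z assume z: "z \<in> ball p (3 / 2)"
        have "norm z \<le> norm p + 3 / 2"
          using z norm_triangle_ineq2[of z p] by (simp add: dist_norm norm_minus_commute)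
        moreover have "norm p \<le> 2 + norm s"
          using cmod_le[of p] abs_Im_le_cmod[of s] by (simp add: p_def)
        ultimately have "1 + norm z \<le> 5 * ?Y" using norm_ge_zero[of s] unfolding distrib_left by linarith
        then have "(1 + norm z) ^ 3 \<le> (5 * ?Y) ^ 3" by (intro power_mono) auto
        then have Zz: "norm (zeta_reg z) \<le> C0 * (5 * ?Y) ^ 3"
          using C0(2)[of z] hp[OF z] C0(1) by (intro order.trans[OF C0(2)] mult_left_mono) auto
        have "exp (Re (f z)) = norm (zeta_reg z) / norm (zeta_reg p)"
          unfolding f_def L(2)[OF z] L(2)[OF p] by (simp add: exp_diff)
        also have "\<dots> \<le> C0 * (5 * ?Y) ^ 3 / (1 / 3)"
          using Zz Zp C0 by (intro frac_le) auto
        also have "\<dots> < C1 * ?Y ^ 3"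
        proof -
          have "(5 * ?Y) ^ 3 = 125 * ?Y ^ 3" by (simp only: power_mult_distrib) simp
          moreover have "?Y ^ 3 > 0" using Y by (intro zero_less_power) linarith
          ultimately show ?thesis by (simp only: C1_def) (simp add: distrib_right)
        qed
        finally have "ln (exp (Re (f z))) < ?A" by (subst ln_less_cancel_iff) (use CY in auto)
        then show "Re (f z) < ?A" by simp
      qed
      also have "\<dots> = ?A * (3 - 2 * a) / a" using a by (simp add: divide_simps)
      also have "\<dots> \<le> ?A * 3 / a"
        using a CY by (intro divide_right_mono mult_left_mono) auto
      finally have "- Re (f s) \<le> ?A * 3 / a"
        using abs_Re_le_cmod[of "f s"] by linarith
      have "s \<in> ball p (3 / 2)" using ds a by simp
      then have "norm (zeta_reg s) = norm (zeta_reg p) * exp (Re (f s))"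
        unfolding f_def L(2)[OF p] by (simp add: L(2) exp_diff)
      then have "1 / norm (zeta_reg s) = exp (- Re (f s)) / norm (zeta_reg p)"
        by (simp add: exp_minus field_simps)
      also have "\<dots> \<le> exp (?A * 3 / a) / (1 / 3)"
        using \<open>- Re (f s) \<le> ?A * 3 / a\<close> Zp by (intro frac_le) auto
      also have "exp (?A * 3 / a) = (C1 * ?Y ^ 3) powr (3 / a)"
      proof -
        have "C1 * ?Y ^ 3 \<noteq> 0" using CY by linarith
        then show ?thesis by (simp add: powr_def mult.commute)
      qed
      finally show ?thesis by simp
    qed
    also have "(C1 * ?Y ^ 3) powr (3 / a) = C1 powr (3 / a) * ?Y powr (9 / a)"
    proof -
      have "?Y ^ 3 = ?Y powr 3" using Y by (simp add: powr_numeral)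
      then have "(?Y ^ 3) powr (3 / a) = ?Y powr (3 * (3 / a))" by (simp only: powr_powr)
      then show ?thesis using C1 Y by (simp add: powr_mult)
    qed
    finally show "1 / norm (zeta_reg s) \<le> 3 * C1 powr (3 / a) * ?Y powr (9 / a)" by (simp add: mult.assoc)
  qed
qed

text \<open>In Gauss's product the ratio |z + a + k| / |z + k| is at most 1 + a / (1 + k), because
  |z + k| is at least 1 + k. Hence |Gamma(z) / Gamma(z + a)| is bounded by its value at z = 1. This
  takes the place of Stirling's formula.\<close>

lemma norm_Gamma_shift_le:
  assumes "Re z \<ge> 1" "a \<ge> 0"
  shows "norm (Gamma z) * Gamma (1 + a) \<le> norm (Gamma (z + of_real a))"
proof (rule tendsto_le)
  show "(\<lambda>n. norm (Gamma_series z n) * Gamma_series (1 + a) n) \<longlonglongrightarrow> norm (Gamma z) * Gamma (1 + a)"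
    by (intro tendsto_intros)
  show "(\<lambda>n. norm (Gamma_series (z + of_real a) n) * Gamma_series (1::real) n) \<longlonglongrightarrow> norm (Gamma (z + of_real a))"
    using tendsto_mult[OF tendsto_norm[OF Gamma_series_LIMSEQ[of "z + of_real a"]] Gamma_series_LIMSEQ[of "1::real"]] by simp
  show "\<forall>\<^sub>F n in sequentially. norm (Gamma_series z n) * Gamma_series (1 + a) n \<le> norm (Gamma_series (z + of_real a) n) * Gamma_series 1 n"
  proof (rule always_eventually, rule allI)
    fix n
    let ?N = "{0..<Suc n}"
    have k: "norm (z + of_real a + of_nat k) * (1 + real k) \<le> norm (z + of_nat k) * (1 + a + real k)" for k
    proof -
      have "1 + real k \<le> norm (z + of_nat k)"
        using assms abs_Re_le_cmod[of "z + of_nat k"] by simp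
      then have "a * (1 + real k) \<le> a * norm (z + of_nat k)"
        using assms by (intro mult_left_mono) auto
      moreover have "norm (z + of_real a + of_nat k) \<le> norm (z + of_nat k) + a"
        using norm_triangle_ineq[of "z + of_nat k" "of_real a"] assms by (simp add: add_ac)
      then have "norm (z + of_real a + of_nat k) * (1 + real k) \<le> (norm (z + of_nat k) + a) * (1 + real k)"
        by (intro mult_right_mono) auto
      ultimately show ?thesis by (simp add: algebra_simps)
    qed
    have "(\<Prod>k\<in>?N. norm (z + of_real a + of_nat k) * (1 + real k)) \<le> (\<Prod>k\<in>?N. norm (z + of_nat k) * (1 + a + real k))"
      by (intro prod_mono conjI k) auto
    then have P: "norm (pochhammer (z + of_real a) (Suc n)) * pochhammer 1 (Suc n) \<le> norm (pochhammer z (Suc n)) * pochhammer (1 + a) (Suc n)"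
      unfolding pochhammer_prod prod_norm[symmetric] prod.distrib by simp
    have pos: "pochhammer (1 + a) (Suc n) > 0" "pochhammer (1::real) (Suc n) > 0"
      using assms by (auto intro!: pochhammer_pos)
    have nz: "pochhammer (z + of_real b) (Suc n) \<noteq> 0" if "b \<ge> 0" for b
      using assms that unfolding pochhammer_prod prod_zero_iff[OF finite_atLeastLessThan]
      by (auto simp: complex_eq_iff)
    define E where "E = fact n * exp (Re z * ln (real n)) * (fact n * exp ((1 + a) * ln (real n)))"
    have 1: "norm (Gamma_series z n) * Gamma_series (1 + a) n = E / (norm (pochhammer z (Suc n)) * pochhammer (1 + a) (Suc n))"
      by (simp add: Gamma_series_def norm_mult norm_divide E_def)
    have "exp (Re (z + of_real a) * ln (real n)) * exp (1 * ln (real n)) = exp (Re z * ln (real n)) * exp ((1 + a) * ln (real n))"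
      unfolding exp_add[symmetric] by (simp add: algebra_simps)
    then have 2: "norm (Gamma_series (z + of_real a) n) * Gamma_series (1::real) n = E / (norm (pochhammer (z + of_real a) (Suc n)) * pochhammer 1 (Suc n))"
      by (simp add: Gamma_series_def norm_mult norm_divide E_def mult_ac)
    show "norm (Gamma_series z n) * Gamma_series (1 + a) n \<le> norm (Gamma_series (z + of_real a) n) * Gamma_series 1 n"
      unfolding 1 2 using P pos nz[of a] nz[of 0] assms
      by (intro divide_left_mono mult_pos_pos) (auto simp: E_def)
  qed
qed auto

text \<open>The auxiliary factor is \<open>exp (- e * w z)\<close> with \<open>w\<close> a square
  root. On the half-plane its argument stays within pi / 4 of the real axis, so
  \<open>Re (w z)\<close> grows like the root of |z|: the factor beats polynomial growth on a large
  arc and is at most 1 on the boundary line. Then e tends to 0. The shift by 1 keeps the root away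
  from its branch point.\<close>

lemma Phragmen_Lindelof_half_plane:
  fixes f :: "complex \<Rightarrow> complex"
  assumes hol: "f holomorphic_on {z. Re z > c}" and cont: "continuous_on {z. Re z \<ge> c} f"
    and bd: "\<And>z. Re z = c \<Longrightarrow> norm (f z) \<le> 1"
    and growth: "\<And>z. Re z \<ge> c \<Longrightarrow> norm (f z) \<le> C * (1 + norm z) powr q"
    and s: "Re s > c"
  shows "norm (f s) \<le> 1"
proof -
  define w where "w z = csqrt (z - of_real c + 1)" for z
  have Re_w: "Re (w z) \<ge> sqrt (norm (z - of_real c + 1) / 2)" if "Re z \<ge> c" for z
    using that by (auto simp: w_def)
  have Re_w0: "Re (w z) \<ge> 0" if "Re z \<ge> c" for z
  proof -
    have "0 \<le> sqrt (norm (z - of_real c + 1) / 2)" by simp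
    then show ?thesis using Re_w[OF that] by linarith
  qed
  have *: "norm (f s) \<le> exp (e * Re (w s))" if e: "e > 0" for e
  proof -
    define h where "h z = f z * exp (- of_real e * w z)" for z
    have norm_h: "norm (h z) = norm (f z) * exp (- e * Re (w z))" for z
      by (simp add: h_def norm_mult)
    have C: "C \<ge> 0"
    proof -
      have "0 \<le> norm (f (of_real c))" by simp
      also have "\<dots> \<le> C * (1 + norm (complex_of_real c)) powr q" by (rule growth) simp
      finally have "0 \<le> C * (1 + norm (complex_of_real c)) powr q" .
      moreover have "1 + norm (complex_of_real c) > 0" by (intro add_pos_nonneg) auto
      then have "(1 + norm (complex_of_real c)) powr q > 0" by simp
      ultimately show ?thesis by (metis not_less mult_less_0_iff)
    qed
    have "eventually (\<lambda>M. C * (1 + M) powr q * exp (- e * sqrt ((M - \<bar>c\<bar> - 1) / 2)) \<le> 1) at_top"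
      using e by real_asymp
    then have "eventually (\<lambda>M. C * (1 + M) powr q * exp (- e * sqrt ((M - \<bar>c\<bar> - 1) / 2)) \<le> 1 \<and> M > norm s) at_top"
      using eventually_gt_at_top by (rule eventually_conj)
    then obtain M where M: "C * (1 + M) powr q * exp (- e * sqrt ((M - \<bar>c\<bar> - 1) / 2)) \<le> 1" "M > norm s"
      using eventually_happens'[OF trivial_limit_at_top_linorder] by blast
    define S where "S = {z. Re z > c} \<inter> ball 0 M"
    have openS: "open S" unfolding S_def by (intro open_Int open_halfspace_Re_gt open_ball)
    have cl: "closure S \<subseteq> {z. Re z \<ge> c} \<inter> cball 0 M"
      unfolding S_def by (rule closure_minimal) (auto intro!: closed_Int closed_halfspace_Re_ge)
    have np: "z - of_real c + 1 \<notin> \<real>\<^sub>\<le>\<^sub>0" if "Re z \<ge> c" for z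
      using that by (auto simp: complex_nonpos_Reals_iff)
    have contw: "continuous_on {z. Re z \<ge> c} w"
      unfolding w_def using np by (intro holomorphic_on_imp_continuous_on holomorphic_intros) auto
    have "norm (h s) \<le> 1"
    proof (rule maximum_modulus_frontier[where f = h and S = S])
      have "w holomorphic_on {z. Re z > c}"
        unfolding w_def using np by (intro holomorphic_intros) auto
      then have "h holomorphic_on {z. Re z > c}"
        unfolding h_def by (intro holomorphic_intros hol)
      then show "h holomorphic_on interior S"
        unfolding interior_open[OF openS] by (rule holomorphic_on_subset) (auto simp: S_def)
      have "continuous_on {z. Re z \<ge> c} h"
        unfolding h_def by (intro continuous_intros cont contw)
      then show "continuous_on (closure S) h" by (rule continuous_on_subset) (use cl in auto)
      show "bounded S" unfolding S_def by (intro bounded_Int) auto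
      show "s \<in> S" using s M by (simp add: S_def)
      fix z assume "z \<in> frontier S"
      then have zc: "Re z \<ge> c" "norm z \<le> M" and "z \<notin> S"
        using cl unfolding frontier_def interior_open[OF openS] by auto
      then consider "Re z = c" | "norm z = M" unfolding S_def by force
      then show "norm (h z) \<le> 1"
      proof cases
        case 1
        have "norm (f z) * exp (- e * Re (w z)) \<le> 1 * 1"
          using bd[OF 1] Re_w0[OF zc(1)] e by (intro mult_mono) auto
        then show ?thesis unfolding norm_h by simp
      next
        case 2
        have "norm (z - of_real c + 1) \<ge> norm z - norm (of_real c - 1 :: complex)"
          using norm_triangle_ineq2[of z "of_real c - 1"] by (simp add: algebra_simps)
        moreover have "norm (of_real c - 1 :: complex) \<le> \<bar>c\<bar> + 1"
          using norm_triangle_ineq4[of "of_real c" "1::complex"] by simp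
        ultimately have "M - \<bar>c\<bar> - 1 \<le> norm (z - of_real c + 1)" using 2 by linarith
        then have "sqrt ((M - \<bar>c\<bar> - 1) / 2) \<le> Re (w z)"
          by (intro order.trans[OF _ Re_w[OF zc(1)]] real_sqrt_le_mono divide_right_mono) auto
        then have "norm (h z) \<le> C * (1 + M) powr q * exp (- e * sqrt ((M - \<bar>c\<bar> - 1) / 2))"
          unfolding norm_h using growth[OF zc(1)] 2 e C by (intro mult_mono) auto
        then show ?thesis using M by linarith
      qed
    qed
    then show ?thesis unfolding norm_h by (simp add: exp_minus field_simps)
  qed
  have "norm (f s) \<le> exp (0 * Re (w s))"
  proof (rule tendsto_lowerbound)
    show "((\<lambda>e. exp (e * Re (w s))) \<longlongrightarrow> exp (0 * Re (w s))) (at_right 0)"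
      by (intro tendsto_intros)
    show "\<forall>\<^sub>F e in at_right 0. norm (f s) \<le> exp (e * Re (w s))"
      using * by (auto simp: eventually_at_filter)
  qed auto
  then show ?thesis by simp
qed

section \<open>Monotonicity under the Riemann hypothesis\<close>

lemma zeta_reg_nonzero_RH:
  assumes "riemann_hypothesis" "0 < Re s" "Re s \<noteq> 1 / 2"
  shows "zeta_reg s \<noteq> 0"
proof
  assume z: "zeta_reg s = 0"
  \<comment> \<open>The hypothesis covers only the open strip; zeros with
    \<open>Re s \<ge> 1\<close> are excluded by the 3-4-1 argument.\<close>
  then have "Re s < 1" using zeta_reg_nonzero[of s] by linarith
  moreover have "riemann_zeta s = 0" using riemann_zeta_eq[of s] assms z by simp
  ultimately show False using assms unfolding riemann_hypothesis_def by blast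
qed

lemma Gamma_half_plus_1_nonzero: "Re s > -2 \<Longrightarrow> Gamma (s / 2 + 1) \<noteq> 0"
  unfolding Gamma_eq_zero_iff by (auto simp: complex_eq_iff elim!: nonpos_Ints_cases)

lemma xi_reg_eq_0_iff: "Re s > -2 \<Longrightarrow> xi_reg s = 0 \<longleftrightarrow> zeta_reg s = 0"
  using Gamma_half_plus_1_nonzero[of s] by (simp add: xi_reg_def)

lemma cnj_xi_reg:
  assumes "Re s > -1"
  shows "cnj (xi_reg s) = xi_reg (cnj s)"
  using assms cnj_powr[of "of_real pi" "- s / 2"] by (simp add: xi_reg_def cnj_zeta_reg cnj_Gamma)

text \<open>The quotient has modulus 1 on the critical line by the functional equation,
  and is of polynomial growth because the Gamma quotient is bounded.\<close>

lemma norm_xi_reg_shift_le: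
  assumes nz: "\<And>s. Re s > 1 / 2 \<Longrightarrow> zeta_reg s \<noteq> 0"
    and a: "0 < a" "a < 1 / 2" and s: "Re s > 1 / 2"
  shows "norm (xi_reg (s - of_real a)) \<le> norm (xi_reg (s + of_real a))"
proof -
  define R where "R s = xi_reg (s - of_real a) / xi_reg (s + of_real a)" for s
  have den: "xi_reg (s + of_real a) \<noteq> 0" if "Re s \<ge> 1 / 2" for s
    using that a by (subst xi_reg_eq_0_iff) (auto intro!: nz)
  \<comment> \<open>Slightly beyond the critical line, so that continuity up to the line is
    immediate.\<close>
  have hol: "R holomorphic_on {s. Re s > 1 / 2 - a / 2}"
  proof -
    let ?D = "{s. Re s > 1 / 2 - a / 2}"
    have "(xi_reg \<circ> (\<lambda>s. s - of_real a)) holomorphic_on ?D" "(xi_reg \<circ> (\<lambda>s. s + of_real a)) holomorphic_on ?D"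
      by (rule holomorphic_on_compose_gen[OF _ xi_reg_holomorphic]; use a in \<open>auto intro!: holomorphic_intros\<close>)+
    moreover have "xi_reg (s + of_real a) \<noteq> 0" if "s \<in> ?D" for s
      using that a by (subst xi_reg_eq_0_iff) (auto intro!: nz)
    ultimately show ?thesis unfolding R_def by (intro holomorphic_intros) (auto simp: o_def)
  qed
  obtain C0 where C0: "C0 > 0" "\<And>s. Re s \<ge> -1 + 1 \<Longrightarrow> norm (zeta_reg s) \<le> C0 * (1 + norm s) ^ 3"
    using zeta_reg_growth[of 1] by auto
  obtain C q where C: "C > 0" "\<And>s. Re s \<ge> 1 / 2 + a \<Longrightarrow> 1 / norm (zeta_reg s) \<le> C * (1 + norm s) powr q"
    using zeta_reg_lower_bound[OF nz a(1)] by auto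
  \<comment> \<open>The exponent must be nonnegative, so that the power increases with its base when
    \<open>1 + norm (s + of_real a)\<close> is replaced by \<open>2 * ?Y\<close>.\<close>
  define q' where "q' = max q 0"
  have "norm (R s) \<le> 1"
  proof (rule Phragmen_Lindelof_half_plane[where f = R and c = "1 / 2"])
    show "R holomorphic_on {s. Re s > 1 / 2}" by (rule holomorphic_on_subset[OF hol]) (use a in auto)
    show "continuous_on {s. Re s \<ge> 1 / 2} R"
      by (rule holomorphic_on_imp_continuous_on, rule holomorphic_on_subset[OF hol]) (use a in auto)
    show "Re s > 1 / 2" by (rule s)
  next
    fix s :: complex assume s: "Re s = 1 / 2"
    have e: "1 - (s - of_real a) = cnj (s + of_real a)" using s by (simp add: complex_eq_iff)
    have "xi_reg (s - of_real a) = xi_reg (1 - (s - of_real a))"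
      by (rule xi_reg_symmetric[symmetric]) (use s a in auto)
    also have "\<dots> = cnj (xi_reg (s + of_real a))"
      unfolding e by (rule cnj_xi_reg[symmetric]) (use s a in auto)
    finally show "norm (R s) \<le> 1" by (simp add: R_def norm_divide)
  next
    fix s :: complex assume s: "Re s \<ge> 1 / 2"
    let ?Y = "1 + norm s" and ?z = "(s - of_real a) / 2 + 1"
    have Y: "?Y \<ge> 1" by simp
    have g: "norm (Gamma ?z) / norm (Gamma ((s + of_real a) / 2 + 1)) \<le> 1 / Gamma (1 + a)"
    proof -
      have e: "?z + of_real a = (s + of_real a) / 2 + 1"
        by (simp add: add_divide_distrib diff_divide_distrib complex_eq_iff)
      have "norm (Gamma ?z) * Gamma (1 + a) \<le> norm (Gamma ((s + of_real a) / 2 + 1))"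
        using norm_Gamma_shift_le[of ?z a] s a unfolding e by simp
      moreover have "norm (Gamma ((s + of_real a) / 2 + 1)) > 0"
        using Gamma_half_plus_1_nonzero[of "s + of_real a"] s a by simp
      moreover have "Gamma (1 + a) > 0" using a by simp
      ultimately show ?thesis by (simp add: field_simps)
    qed
    have p: "norm (of_real pi powr (- (s - of_real a) / 2) :: complex) / norm (of_real pi powr (- (s + of_real a) / 2) :: complex) = pi powr a"
      by (simp add: norm_powr_real_powr field_simps flip: powr_diff)
    have Ym: "1 + norm (s - of_real a) \<le> 2 * ?Y"
      using norm_triangle_ineq4[of s "of_real a"] a norm_ge_zero[of s] unfolding norm_of_real abs_of_pos[OF a(1)] by argo
    have Yp: "1 + norm (s + of_real a) \<le> 2 * ?Y"
      using norm_triangle_ineq[of s "of_real a"] a norm_ge_zero[of s] unfolding norm_of_real abs_of_pos[OF a(1)] by argo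
    have z1: "norm (zeta_reg (s - of_real a)) \<le> C0 * (2 * ?Y) ^ 3"
    proof -
      have "norm (zeta_reg (s - of_real a)) \<le> C0 * (1 + norm (s - of_real a)) ^ 3"
        by (rule C0) (use s a in auto)
      also have "\<dots> \<le> C0 * (2 * ?Y) ^ 3"
        using C0 Ym by (intro mult_left_mono power_mono) auto
      finally show ?thesis .
    qed
    have z2: "1 / norm (zeta_reg (s + of_real a)) \<le> C * (2 * ?Y) powr q'"
    proof -
      have "1 / norm (zeta_reg (s + of_real a)) \<le> C * (1 + norm (s + of_real a)) powr q"
        by (rule C) (use s a in auto)
      also have "\<dots> \<le> C * (1 + norm (s + of_real a)) powr q'"
        using C by (intro mult_left_mono powr_mono) (auto simp: q'_def)
      also have "\<dots> \<le> C * (2 * ?Y) powr q'"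
        using C Yp by (intro mult_left_mono powr_mono2) (auto simp: q'_def)
      finally show ?thesis .
    qed
    have "norm (R s) = (norm (of_real pi powr (- (s - of_real a) / 2) :: complex) / norm (of_real pi powr (- (s + of_real a) / 2) :: complex))
        * (norm (Gamma ?z) / norm (Gamma ((s + of_real a) / 2 + 1))) * norm (zeta_reg (s - of_real a)) * (1 / norm (zeta_reg (s + of_real a)))"
      by (simp add: R_def xi_reg_def norm_mult norm_divide)
    also have "\<dots> \<le> pi powr a * (1 / Gamma (1 + a)) * (C0 * (2 * ?Y) ^ 3) * (C * (2 * ?Y) powr q')"
      unfolding p using a C0 C by (intro mult_mono g z1 z2 mult_nonneg_nonneg order_refl) auto
    also have "\<dots> = (pi powr a / Gamma (1 + a) * C0 * 8 * C * 2 powr q') * ?Y powr (q' + 3)"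
    proof -
      have "?Y ^ 3 = ?Y powr 3" using Y by (simp add: powr_numeral)
      moreover have "(2 * ?Y) powr q' = 2 powr q' * ?Y powr q'" using Y by (intro powr_mult)
      ultimately show ?thesis by (simp only: power_mult_distrib powr_add) simp
    qed
    finally show "norm (R s) \<le> (pi powr a / Gamma (1 + a) * C0 * 8 * C * 2 powr q') * ?Y powr (q' + 3)" .
  qed
  then show ?thesis
    using den[of s] s by (simp add: R_def norm_divide)
qed

text \<open>For two points on a horizontal line, the shift inequality at their midpoint, with half
  their distance as shift, shows that |xi| increases to the right. The squared modulus is
  differentiated because it is polynomial in the real and imaginary parts; its derivative 2 Re (xi'
  cnj xi) has the sign of Re (xi' / xi).\<close>

lemma xi_reg_log_deriv_nonneg:
  assumes nz: "\<And>s. Re s > 1 / 2 \<Longrightarrow> zeta_reg s \<noteq> 0" and s: "Re s > 1 / 2"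
  shows "Re (deriv xi_reg s / xi_reg s) \<ge> 0"
proof -
  define A where "A = {max (1 / 2) (Re s - 1 / 4)<..<Re s + 1 / 4}"
  define \<phi> where "\<phi> x = (Re (xi_reg (Complex x (Im s))))\<^sup>2 + (Im (xi_reg (Complex x (Im s))))\<^sup>2" for x
  have \<phi>: "\<phi> x = (norm (xi_reg (Complex x (Im s))))\<^sup>2" for x unfolding \<phi>_def cmod_power2 ..
  have "mono_on A \<phi>"
  proof (rule mono_onI)
    fix x y assume xy: "x \<in> A" "y \<in> A" "x \<le> y"
    show "\<phi> x \<le> \<phi> y"
    proof (cases "x = y")
      case False
      have e: "Complex x (Im s) = Complex ((x + y) / 2) (Im s) - of_real ((y - x) / 2)"
        "Complex y (Im s) = Complex ((x + y) / 2) (Im s) + of_real ((y - x) / 2)"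
        by (auto simp: complex_eq_iff field_simps)
      have "norm (xi_reg (Complex x (Im s))) \<le> norm (xi_reg (Complex y (Im s)))"
        unfolding e by (rule norm_xi_reg_shift_le[OF nz]) (use False xy in \<open>auto simp: A_def\<close>)
      then show ?thesis unfolding \<phi> by (intro power_mono) auto
    qed simp
  qed
  moreover have "(\<phi> has_real_derivative 2 * Re (deriv xi_reg s * cnj (xi_reg s))) (at (Re s))"
  proof -
    have "(xi_reg has_field_derivative deriv xi_reg s) (at s)"
      by (rule holomorphic_derivI[OF xi_reg_holomorphic open_halfspace_Re_gt]) (use s in auto)
    then have d: "(xi_reg has_field_derivative deriv xi_reg s) (at (Complex (Re s) (Im s)))" by simp
    have "((\<lambda>x. Complex x (Im s)) has_vector_derivative 1) (at (Re s))"
      unfolding Complex_eq by (auto intro!: derivative_eq_intros)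
    from field_vector_diff_chain_at[OF this d]
    have v: "((\<lambda>x. xi_reg (Complex x (Im s))) has_vector_derivative deriv xi_reg s) (at (Re s))"
      by (simp add: o_def)
    have "((\<lambda>x. Re (xi_reg (Complex x (Im s)))) has_real_derivative Re (deriv xi_reg s)) (at (Re s))"
         "((\<lambda>x. Im (xi_reg (Complex x (Im s)))) has_real_derivative Im (deriv xi_reg s)) (at (Re s))"
      using bounded_linear.has_vector_derivative[OF bounded_linear_Re v] bounded_linear.has_vector_derivative[OF bounded_linear_Im v]
      by (simp_all add: has_real_derivative_iff_has_vector_derivative)
    from DERIV_add[OF DERIV_power[OF this(1), of 2] DERIV_power[OF this(2), of 2]]
    show ?thesis unfolding \<phi>_def by (simp add: algebra_simps)
  qed
  moreover have "Re s \<in> interior A" using s by (subst interior_open) (auto simp: A_def)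
  ultimately have "2 * Re (deriv xi_reg s * cnj (xi_reg s)) \<ge> 0"
    by (rule mono_on_imp_deriv_nonneg)
  moreover have "Re (deriv xi_reg s / xi_reg s) = Re (deriv xi_reg s * cnj (xi_reg s)) / (norm (xi_reg s))\<^sup>2"
    by (subst complex_div_cnj) (simp add: Re_divide_of_real flip: of_real_power)
  ultimately show ?thesis by simp
qed

text \<open>The symmetry s -> 1 - s reverses the sign of the logarithmic derivative.\<close>

lemma xi_reg_log_deriv_nonpos:
  assumes nz: "\<And>s. Re s > 1 / 2 \<Longrightarrow> zeta_reg s \<noteq> 0" and s: "-1 < Re s" "Re s < 1 / 2"
  shows "Re (deriv xi_reg s / xi_reg s) \<le> 0"
proof -
  let ?D = "{s. Re s > -1} \<inter> {s. Re s < 2}"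
  have D: "open ?D" "s \<in> ?D" using s by (auto intro!: open_Int open_halfspace_Re_gt open_halfspace_Re_lt)
  have d: "(xi_reg has_field_derivative deriv xi_reg (1 - s)) (at (1 - s))"
    by (rule holomorphic_derivI[OF xi_reg_holomorphic open_halfspace_Re_gt]) (use s in auto)
  have "((\<lambda>s. xi_reg (1 - s)) has_field_derivative deriv xi_reg (1 - s) * (- 1)) (at s)"
    by (rule DERIV_chain2[where f = xi_reg and g = "\<lambda>s. 1 - s", OF d]) (auto intro!: derivative_eq_intros)
  then have "(xi_reg has_field_derivative deriv xi_reg (1 - s) * (- 1)) (at s)"
    by (rule has_field_derivative_transform_within_open[OF _ D]) (use xi_reg_symmetric in auto)
  then have "deriv xi_reg s = - deriv xi_reg (1 - s)" by (simp add: DERIV_imp_deriv)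
  moreover have "xi_reg s = xi_reg (1 - s)" using xi_reg_symmetric[of s] s by simp
  ultimately have "deriv xi_reg s / xi_reg s = - (deriv xi_reg (1 - s) / xi_reg (1 - s))" by simp
  then show ?thesis using xi_reg_log_deriv_nonneg[OF nz, of "1 - s"] s by simp
qed

section \<open>The region \<open>\<bar>Im s\<bar> \<ge> 7 / 2\<close>\<close>

text \<open>Meant for u = \<open>2 powr (s - 1)\<close>, of modulus at most 1 / sqrt 2 when
  \<open>Re s < 1 / 2\<close>. With D = |1 - u|^2 the real part is at least 1/2 + 1 / (4 D), and the
  extreme case u = - 1 / sqrt 2 gives 0.5857...\<close>

lemma Re_inverse_one_minus_ge:
  fixes u :: complex
  assumes "(norm u)\<^sup>2 \<le> 1 / 2"
  shows "Re (1 / (1 - u)) \<ge> 585 / 1000"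
proof -
  have u: "norm u \<le> 708 / 1000"
    by (rule power2_le_imp_le) (use assms in \<open>auto simp: power2_eq_square\<close>)
  define D where "D = (norm (1 - u))\<^sup>2"
  have ne: "1 - u \<noteq> 0" using u by auto
  then have D0: "D > 0" by (simp add: D_def)
  have D1: "D \<le> (1708 / 1000)\<^sup>2"
    unfolding D_def using u norm_triangle_ineq4[of 1 u] by (intro power_mono) auto
  have "2 * (1 - Re u) = D + 1 - (norm u)\<^sup>2"
    unfolding D_def cmod_power2 by (simp add: power2_eq_square algebra_simps)
  then have "2 * (1 - Re u) \<ge> D + 1 / 2" using assms by simp
  moreover have "Re (1 / (1 - u)) = (1 - Re u) / D"
    unfolding D_def cmod_power2 by (simp add: Re_divide)
  moreover have "585 / 1000 * D \<le> (D + 1 / 2) / 2" using D1 by (simp add: power2_eq_square)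
  ultimately show ?thesis using D0 by (simp only: pos_le_divide_eq) argo
qed

lemma Re_inverse_le:
  fixes u y :: real
  assumes "u > 0" "49 / 4 \<le> t\<^sup>2"
  shows "Re (inverse (Complex u (t / 2))) \<le> u / (u\<^sup>2 + 49 / 16)"
proof -
  have "Re (inverse (Complex u (t / 2))) = u / (u\<^sup>2 + (t / 2)\<^sup>2)" by simp
  also have "\<dots> \<le> u / (u\<^sup>2 + 49 / 16)"
    using assms by (intro divide_left_mono) (auto simp: power2_eq_square intro!: mult_pos_pos add_pos_nonneg)
  finally show ?thesis .
qed

text \<open>The range of x is that of Re s / 2 + 1. All terms of the digamma series have nonnegative
  real part there, so six of them minus Euler's constant bound it from below. The function u / (u^2
  + 49/16) increases up to u = 7/4 and decreases afterwards: at u = x it is largest for x = 5/4, at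
  u = x + n with n at least 1 it is largest for x = 1.\<close>

lemma Re_Digamma_lower_bound:
  assumes x: "1 \<le> x" "x \<le> 5 / 4" and t: "49 / 4 \<le> t\<^sup>2"
  shows "Re (Digamma (Complex x (t / 2))) \<ge> 515 / 1000"
proof -
  let ?z = "Complex x (t / 2)"
  let ?f = "\<lambda>n. Re (inverse (of_nat (Suc n)) - inverse (?z + of_nat n))"
  have z: "?z \<noteq> 0" using x by (auto simp: complex_eq_iff)
  have "Re (Digamma ?z) = suminf ?f - euler_mascheroni"
    unfolding Digamma_def using Re_suminf[OF summable_Digamma[OF z]]
      Re_complex_of_real[of euler_mascheroni] by simp
  moreover have "(\<Sum>n<6. ?f n) \<le> suminf ?f"
  proof (rule sum_le_suminf)
    show "summable ?f" using summable_Re[OF summable_Digamma[OF z]] .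
    fix n :: nat
    have e: "?z + of_nat n = Complex (x + real n) (t / 2)" by (simp add: complex_eq_iff)
    have "Re (inverse (Complex (x + real n) (t / 2))) = (x + real n) / ((x + real n)\<^sup>2 + (t / 2)\<^sup>2)" by simp
    also have "\<dots> \<le> (x + real n) / ((x + real n) * real (Suc n))"
    proof (rule divide_left_mono)
      have "(x + real n) * real (Suc n) \<le> (x + real n) * (x + real n)"
        using x by (intro mult_left_mono) auto
      then show "(x + real n) * real (Suc n) \<le> (x + real n)\<^sup>2 + (t / 2)\<^sup>2"
        unfolding power2_eq_square[of "x + real n"] by (rule add_increasing2[rotated]) simp
    qed (use x in \<open>auto intro!: mult_pos_pos add_pos_nonneg\<close>)
    also have "\<dots> = inverse (real (Suc n))"
    proof -
      have "x + real n > 0" using x by (intro add_pos_nonneg) auto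
      then show ?thesis by (simp add: inverse_eq_divide del: of_nat_Suc)
    qed
    also have "\<dots> = Re (inverse (of_nat (Suc n)))"
      by (metis Re_complex_of_real of_real_inverse of_real_of_nat_eq)
    finally show "0 \<le> ?f n" unfolding e by simp
  qed auto
  moreover have "(\<Sum>n<6. ?f n) \<ge> 1106 / 1000"
  proof -
    have e: "?z + of_nat n = Complex (x + real n) (t / 2)" for n by (simp add: complex_eq_iff)
    have r0: "Re (inverse (Complex (x + 0) (t / 2))) \<le> 10 / 37"
    proof -
      have "Re (inverse (Complex (x + 0) (t / 2))) \<le> (x + 0) / ((x + 0)\<^sup>2 + 49 / 16)"
        using x t by (intro Re_inverse_le) auto
      note * = this
      have "0 \<le> (4 * x - 5) * (20 * x - 49)" using x by (intro mult_nonpos_nonpos) auto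
      then have "37 * x \<le> 10 * (x\<^sup>2 + 49 / 16)" by (simp add: power2_eq_square algebra_simps)
      moreover have "x\<^sup>2 + 49 / 16 > 0" by (intro add_nonneg_pos) auto
      ultimately have "x / (x\<^sup>2 + 49 / 16) \<le> 10 / 37" by (simp add: field_simps)
      with * show ?thesis unfolding add_0_right by (rule order.trans)
    qed
    have r: "Re (inverse (Complex (x + c) (t / 2))) \<le> (1 + c) / ((1 + c)\<^sup>2 + 49 / 16)" if c: "c \<ge> 1" for c
    proof -
      have eq: "u / (u\<^sup>2 + 49 / 16) = 16 * u / (16 * u\<^sup>2 + 49)" for u :: real
      proof -
        have "u\<^sup>2 + 49 / 16 = (16 * u\<^sup>2 + 49) / 16" by (simp add: add_divide_distrib)
        then show ?thesis by (simp only: divide_divide_eq_right mult.commute)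
      qed
      have "4 \<le> (x + c) * (1 + c)" using mult_mono[of 2 "x + c" 2 "1 + c"] x c by simp
      then have "0 \<le> (x - 1) * (16 * ((x + c) * (1 + c)) - 49)" using x by (intro mult_nonneg_nonneg) auto
      then have le: "(x + c) * (16 * (1 + c)\<^sup>2 + 49) \<le> (1 + c) * (16 * (x + c)\<^sup>2 + 49)"
        by (simp add: power2_eq_square algebra_simps)
      have pos: "16 * u\<^sup>2 + 49 > 0" for u :: real by (intro add_nonneg_pos) auto
      have "(x + c) / ((x + c)\<^sup>2 + 49 / 16) \<le> (1 + c) / ((1 + c)\<^sup>2 + 49 / 16)"
        unfolding eq pos_divide_le_eq[OF pos] times_divide_eq_left pos_le_divide_eq[OF pos] mult.assoc
        by (rule mult_left_mono[OF le]) simp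
      then show ?thesis using Re_inverse_le[of "x + c" t] x t c by simp
    qed
    have "(\<Sum>n<6. ?f n) = 1 + 1 / 2 + 1 / 3 + 1 / 4 + 1 / 5 + 1 / 6 - (Re (inverse (Complex (x + 0) (t / 2))) +
        Re (inverse (Complex (x + 1) (t / 2))) + Re (inverse (Complex (x + 2) (t / 2))) +
        Re (inverse (Complex (x + 3) (t / 2))) + Re (inverse (Complex (x + 4) (t / 2))) +
        Re (inverse (Complex (x + 5) (t / 2))))"
      unfolding e by (simp add: eval_nat_numeral del: inverse_complex.sel inverse_complex.simps)
    moreover have "Re (inverse (Complex (x + 1) (t / 2))) \<le> 32 / 113" "Re (inverse (Complex (x + 2) (t / 2))) \<le> 48 / 193"
      "Re (inverse (Complex (x + 3) (t / 2))) \<le> 64 / 305" "Re (inverse (Complex (x + 4) (t / 2))) \<le> 80 / 449"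
      "Re (inverse (Complex (x + 5) (t / 2))) \<le> 96 / 625"
      by (rule order.trans[OF r]; simp add: power2_eq_square)+
    ultimately show ?thesis using r0 by argo
  qed
  ultimately show ?thesis using euler_mascheroni_less_13_over_22 by simp
qed

text \<open>If eta'(s) = 0, differentiating (s - 1) eta = (1 - q) zeta_reg expresses the logarithmic
  derivative \<open>Z'\<close> of \<open>zeta_reg\<close> by elementary terms alone. Adding the
  contributions of Gamma and pi bounds Re (xi' / xi) below by -4/49 + 0.693 * 0.585 + 0.515 / 2 -
  1.145 / 2, about 0.0088, against \<open>xi_reg_log_deriv_nonpos\<close>.\<close>

lemma deriv_dirichlet_eta_nonzero_high:
  assumes RH: "riemann_hypothesis" and s: "0 < Re s" "Re s < 1 / 2" and t: "49 / 4 \<le> (Im s)\<^sup>2"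
  shows "deriv dirichlet_eta s \<noteq> 0"
proof
  assume d0: "deriv dirichlet_eta s = 0"
  have Z: "zeta_reg s \<noteq> 0" using RH s by (intro zeta_reg_nonzero_RH) auto
  define Z' where "Z' = deriv zeta_reg s / zeta_reg s"
  define q where "q = (2 :: complex) powr (1 - s)"
  have nq: "norm q = 2 powr (1 - Re s)" unfolding q_def by (subst norm_powr_real_powr) auto
  have "2 powr (1 - Re s) \<ge> 2 powr (1 / 2 :: real)" using s by (intro powr_mono) auto
  then have nq2: "(norm q)\<^sup>2 \<ge> 2"
    unfolding nq powr_half_sqrt[of 2, simplified] using power_mono[of "sqrt 2" "2 powr (1 - Re s)" 2] by simp
  have q: "q \<noteq> 0" "1 - q \<noteq> 0" using nq2 by auto
  have s1: "s - 1 \<noteq> 0" using s by auto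
  have eta': "(dirichlet_eta has_field_derivative 0) (at s)"
    using holomorphic_derivI[OF dirichlet_eta_holomorphic open_halfspace_Re_gt, of s] s d0 by simp
  have l: "((\<lambda>s. (s - 1) * dirichlet_eta s) has_field_derivative dirichlet_eta s) (at s)"
    by (rule DERIV_cong[OF DERIV_mult[OF _ eta']]) (auto intro!: derivative_eq_intros)
  have q': "((\<lambda>s. 1 - 2 powr (1 - s)) has_field_derivative of_real (ln 2) * q) (at s)"
  proof -
    have "((\<lambda>s. (2 :: complex) powr (1 - s)) has_field_derivative Ln 2 * 2 powr (1 - s) * (- 1)) (at s)"
      by (rule DERIV_chain2[where f = "\<lambda>z. 2 powr z" and g = "\<lambda>s. 1 - s", OF has_field_derivative_powr_right])
         (auto intro!: derivative_eq_intros)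
    from DERIV_diff[OF DERIV_const[of 1] this] show ?thesis
      using Ln_of_real[of 2] by (simp add: q_def)
  qed
  have r: "((\<lambda>s. (1 - 2 powr (1 - s)) * zeta_reg s) has_field_derivative (of_real (ln 2) * q * zeta_reg s + deriv zeta_reg s * (1 - q))) (at s)"
    using DERIV_mult[OF q' zeta_reg_differentiable[of s]] s by (simp add: q_def)
  have "((\<lambda>s. (s - 1) * dirichlet_eta s) has_field_derivative (of_real (ln 2) * q * zeta_reg s + deriv zeta_reg s * (1 - q))) (at s)"
    by (rule has_field_derivative_transform_within_open[OF r open_halfspace_Re_gt[of 0]])
       (use s dirichlet_eta_zeta_reg in auto)
  with l have "dirichlet_eta s = of_real (ln 2) * q * zeta_reg s + deriv zeta_reg s * (1 - q)"
    by (rule DERIV_unique)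
  moreover have "dirichlet_eta s = (1 - q) * zeta_reg s / (s - 1)"
    using dirichlet_eta_zeta_reg[of s] s s1 by (simp add: q_def field_simps)
  moreover have "of_real (ln 2) * q * zeta_reg s + deriv zeta_reg s * (1 - q) = (1 - q) * zeta_reg s * (of_real (ln 2) * (q / (1 - q)) + Z')"
    unfolding Z'_def using q Z by (simp add: divide_simps)
  ultimately have "(1 - q) * zeta_reg s / (s - 1) = (1 - q) * zeta_reg s * (of_real (ln 2) * (q / (1 - q)) + Z')"
    by simp
  then have "1 / (s - 1) = of_real (ln 2) * (q / (1 - q)) + Z'"
    using q Z by (simp add: divide_inverse mult.assoc)
  moreover have "q / (1 - q) = - (1 / (1 - 1 / q))" using q by (simp add: field_simps)
  ultimately have "Z' = 1 / (s - 1) + of_real (ln 2) * (1 / (1 - 1 / q))" by (simp add: algebra_simps)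
  then have Re_Z': "Re Z' = Re (1 / (s - 1)) + ln 2 * Re (1 / (1 - 1 / q))"
    by (simp only: plus_complex.sel times_complex.sel Re_complex_of_real Im_complex_of_real mult_zero_left diff_zero)
  have 1: "Re (1 / (1 - 1 / q)) \<ge> 585 / 1000"
    by (rule Re_inverse_one_minus_ge) (use nq2 q in \<open>simp add: norm_divide power_divide field_simps\<close>)
  have 2: "Re (1 / (s - 1)) \<ge> - 4 / 49"
  proof -
    have "Re (1 / (s - 1)) = - ((1 - Re s) / ((Re s - 1)\<^sup>2 + (Im s)\<^sup>2))"
      by (simp add: Re_divide power2_eq_square minus_divide_left)
    moreover have "(1 - Re s) / ((Re s - 1)\<^sup>2 + (Im s)\<^sup>2) \<le> 1 / (49 / 4)"
      using s t by (intro frac_le) (auto intro: add_increasing)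
    ultimately show ?thesis by simp
  qed
  have ln2: "ln (2::real) \<ge> 693 / 1000"
    using ln_approx_bounds[of 2 3] by (simp add: eval_nat_numeral)
  define P where "P = Digamma (s / 2 + 1)"
  have G: "Gamma (s / 2 + 1) \<noteq> 0" using Gamma_half_plus_1_nonzero[of s] s by simp
  have np: "s / 2 + 1 \<notin> \<int>\<^sub>\<le>\<^sub>0" using G Gamma_eq_zero_iff by blast
  have gd: "((\<lambda>s. Gamma (s / 2 + 1)) has_field_derivative Gamma (s / 2 + 1) * P * (1 / 2)) (at s)"
    unfolding P_def
    by (rule DERIV_chain2[where f = Gamma and g = "\<lambda>s. s / 2 + 1", OF has_field_derivative_Gamma[OF np]])
       (auto intro!: derivative_eq_intros)
  have pd: "((\<lambda>s. complex_of_real pi powr (- s / 2)) has_field_derivative (of_real pi powr (- s / 2) * (- of_real (ln pi) / 2))) (at s)"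
  proof -
    have "((\<lambda>s. complex_of_real pi powr (- s / 2)) has_field_derivative Ln (of_real pi) * of_real pi powr (- s / 2) * (- 1 / 2)) (at s)"
      by (rule DERIV_chain2[where f = "\<lambda>z. of_real pi powr z" and g = "\<lambda>s. - s / 2", OF has_field_derivative_powr_right])
         (auto intro!: derivative_eq_intros)
    then show ?thesis using Ln_of_real[of pi] by (simp add: mult_ac)
  qed
  have "(xi_reg has_field_derivative
     (of_real pi powr (- s / 2) * Gamma (s / 2 + 1) * deriv zeta_reg s
      + (of_real pi powr (- s / 2) * (Gamma (s / 2 + 1) * P * (1 / 2)) + of_real pi powr (- s / 2) * (- of_real (ln pi) / 2) * Gamma (s / 2 + 1)) * zeta_reg s)) (at s)"
    unfolding xi_reg_def[abs_def]
    by (rule DERIV_cong[OF DERIV_mult[OF DERIV_mult[OF pd gd] zeta_reg_differentiable]]) (use s in \<open>auto simp: algebra_simps\<close>)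
  then have xd: "deriv xi_reg s = of_real pi powr (- s / 2) * Gamma (s / 2 + 1) * deriv zeta_reg s
      + (of_real pi powr (- s / 2) * (Gamma (s / 2 + 1) * P * (1 / 2)) + of_real pi powr (- s / 2) * (- of_real (ln pi) / 2) * Gamma (s / 2 + 1)) * zeta_reg s"
    by (rule DERIV_imp_deriv)
  have "deriv xi_reg s / xi_reg s = Z' + P / 2 - of_real (ln pi) / 2"
    unfolding xd xi_reg_def Z'_def using G Z by (simp add: field_simps)
  moreover have "Re (deriv xi_reg s / xi_reg s) \<le> 0"
    using RH s by (intro xi_reg_log_deriv_nonpos zeta_reg_nonzero_RH) auto
  ultimately have "Re Z' + Re P / 2 - ln pi / 2 \<le> 0" by simp
  moreover have "Re P \<ge> 515 / 1000"
  proof -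
    have "s / 2 + 1 = Complex (Re s / 2 + 1) (Im s / 2)" by (simp add: complex_eq_iff)
    then show ?thesis unfolding P_def using Re_Digamma_lower_bound[of "Re s / 2 + 1" "Im s"] s t by simp
  qed
  moreover have "ln pi \<le> 1145 / 1000"
  proof -
    have "ln pi \<le> ln (3.1416 :: real)" using pi_approx by (subst ln_le_cancel_iff) auto
    also have "\<dots> \<le> 1145 / 1000"
      using ln_approx_bounds[of "3.1416" 5] by (simp add: eval_nat_numeral)
    finally show ?thesis .
  qed
  moreover have "ln 2 * Re (1 / (1 - 1 / q)) \<ge> 693 / 1000 * (585 / 1000)"
    using ln2 1 by (intro mult_mono) auto
  ultimately show False using Re_Z' 2 by simp
qed

section \<open>The region \<open>\<bar>Im s\<bar> \<le> 7 / 2\<close>\<close>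

text \<open>The triples are \<open>(n, 64 w, 2\<^sup>1\<^sup>8 R l)\<close> where \<open>w\<close> is the weight of \<open>n powr (- s)\<close> after six rounds
  of Euler summation starting at \<open>n = 7\<close>, \<open>R = 177 / 50\<close> bounds the modulus on the rectangle to be treated,
  and \<open>l\<close> approximates \<open>ln n\<close>. This scaling makes the Taylor coefficients at radius \<open>R\<close> accessible to
  fixed-point arithmetic.\<close>

definition eta_int_data :: "(int \<times> int \<times> int) list" where
  "eta_int_data = [(1, 64, 0), (2, -64, 643233), (3, 64, 1019501), (4, -64, 1286467), (5, 64, 1493542), (6, -64, 1662734),
    (7, 63, 1805785), (8, -57, 1929700), (9, 42, 2039002), (10, -22, 2136775), (11, 7, 2225222), (12, -1, 2305968)]"

definition eta_data :: "(real \<times> real \<times> real) list" where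
  "eta_data = map (\<lambda>(n, w, u). (of_int n, of_int w / 64, of_int u / (177 / 50 * 2 ^ 18))) eta_int_data"

lemma dirichlet_eta_eta_data:
  assumes "Re s > 0"
  shows "dirichlet_eta s = (\<Sum>(n, w, l)\<leftarrow>eta_data. of_real w * of_real n powr (- s)) + alt_tail 6 7 s / 64"
proof -
  have "(\<Sum>n<6. (-1) ^ n * of_nat (Suc n) powr (- s)) = 1 - 2 powr (- s) + 3 powr (- s) - 4 powr (- s) + 5 powr (- s) - 6 powr (- s)"
    by (simp add: eval_nat_numeral(2,3) lessThan_Suc algebra_simps)
  \<comment> \<open>The numerators over 64, namely 63, 57, 42, 22, 7, 1, are the tail sums of the
    binomial coefficients 1, 6, 15, 20, 15, 6, 1.\<close>
  moreover have "(\<Sum>i<6. powr_diff i s 7 / 2 ^ Suc i) = 63 / 64 * 7 powr (- s) - 57 / 64 * 8 powr (- s) + 21 / 32 * 9 powr (- s)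
      - 11 / 32 * 10 powr (- s) + 7 / 64 * 11 powr (- s) - 1 / 64 * 12 powr (- s)"
    by (simp add: eval_nat_numeral(2,3) lessThan_Suc field_simps)
  ultimately show ?thesis
    using dirichlet_eta_eq[OF assms, of 6 6] by (simp add: eta_data_def eta_int_data_def)
qed

text \<open>All logarithms are combined from those of 2, 3/2, 5/4, 8/7 and 12/11. Except for 2 these
  are close to 1, where few terms of the series suffice.\<close>

lemma eta_data_ln:
  assumes "(n, w, l) \<in> set eta_data"
  shows "\<bar>ln n - l\<bar> \<le> 1 / 10 ^ 6" "0 \<le> l" "l \<le> 5 / 2" "n \<ge> 1"
proof -
  have l2: "ln 2 \<in> {6931471 / 10 ^ 7..6931473 / 10 ^ 7 :: real}"
    using ln_approx_bounds[of 2 8] by (simp add: eval_nat_numeral)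
  have l3: "ln (3 / 2) \<in> {4054650 / 10 ^ 7..4054652 / 10 ^ 7 :: real}"
    using ln_approx_bounds[of "3 / 2" 6] by (simp add: eval_nat_numeral)
  have l5: "ln (5 / 4) \<in> {2231435 / 10 ^ 7..2231437 / 10 ^ 7 :: real}"
    using ln_approx_bounds[of "5 / 4" 5] by (simp add: eval_nat_numeral)
  have l7: "ln (8 / 7) \<in> {1335313 / 10 ^ 7..1335315 / 10 ^ 7 :: real}"
    using ln_approx_bounds[of "8 / 7" 4] by (simp add: eval_nat_numeral)
  have l11: "ln (12 / 11) \<in> {870113 / 10 ^ 7..870115 / 10 ^ 7 :: real}"
    using ln_approx_bounds[of "12 / 11" 4] by (simp add: eval_nat_numeral)
  have ln4: "ln 4 = 2 * ln (2 :: real)" using ln_realpow[of 2 2] by simp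
  have ln8: "ln 8 = 3 * ln (2 :: real)" using ln_realpow[of 2 3] by simp
  have ln3: "ln 3 = ln 2 + ln (3 / 2 :: real)" using ln_mult[of 2 "3 / 2 :: real"] by simp
  have ln12: "ln 12 = 3 * ln 2 + ln (3 / 2 :: real)" using ln_mult[of 8 "3 / 2 :: real"] ln8 by simp
  have ln_eqs: "ln 5 = 2 * ln 2 + ln (5 / 4 :: real)" "ln 6 = 2 * ln 2 + ln (3 / 2 :: real)"
    "ln 7 = 3 * ln 2 - ln (8 / 7 :: real)" "ln 9 = 2 * ln 2 + 2 * ln (3 / 2 :: real)"
    "ln 10 = 3 * ln 2 + ln (5 / 4 :: real)" "ln 11 = 3 * ln 2 + ln (3 / 2) - ln (12 / 11 :: real)"
    using ln_mult[of 4 "5 / 4 :: real"] ln_mult[of 4 "3 / 2 :: real"] ln_div[of 8 "8 / 7 :: real"] ln_mult[of 3 "3 :: real"]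
      ln_mult[of 8 "5 / 4 :: real"] ln_div[of 12 "12 / 11 :: real"] ln3 ln4 ln8 ln12 by simp_all
  have "10 ^ 6 * (ln n - l) \<le> 1 \<and> 10 ^ 6 * (l - ln n) \<le> 1"
    using assms l2 l3 l5 l7 l11 unfolding eta_data_def eta_int_data_def by (auto simp: ln_eqs ln3 ln4 ln8 ln12)
  then have "ln n - l \<le> 1 / 10 ^ 6" "- (ln n - l) \<le> 1 / 10 ^ 6" by (simp_all add: field_simps)
  then show "\<bar>ln n - l\<bar> \<le> 1 / 10 ^ 6" by (rule abs_leI)
  show "0 \<le> l" "l \<le> 5 / 2" "n \<ge> 1" using assms unfolding eta_data_def eta_int_data_def by auto
qed

section \<open>The remainder after six rounds of Euler summation\<close>

lemma norm_pochhammer_6_le: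
  assumes s: "0 \<le> Re s" "Re s \<le> 1 / 2" "(Im s)\<^sup>2 \<le> 49 / 4" and z: "norm (s - z) \<le> 1 / 2"
  shows "norm (pochhammer z 6) \<le> 20000"
proof -
  have b: "norm (z + of_nat j) \<le> c + 1 / 2" if c: "(1 / 2 + real j)\<^sup>2 + 49 / 4 \<le> c\<^sup>2" "c \<ge> 0" for j c
  proof -
    have "norm (s + of_nat j) \<le> c"
    proof (rule power2_le_imp_le[OF _ c(2)])
      have "(Re s + real j)\<^sup>2 \<le> (1 / 2 + real j)\<^sup>2" using s by (intro power_mono) auto
      moreover have "(norm (s + of_nat j))\<^sup>2 = (Re s + real j)\<^sup>2 + (Im s)\<^sup>2"
        unfolding cmod_power2 by simp
      ultimately show "(norm (s + of_nat j))\<^sup>2 \<le> c\<^sup>2" using s(3) c(1) by linarith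
    qed
    moreover have "norm (z + of_nat j) \<le> norm (s + of_nat j) + norm (s - z)"
      using norm_triangle_ineq4[of "s + of_nat j" "s - z"] by (simp add: add.commute)
    ultimately show ?thesis using z by linarith
  qed
  have "norm (z + of_nat 0) \<le> 354 / 100 + 1 / 2" "norm (z + of_nat 1) \<le> 381 / 100 + 1 / 2"
    "norm (z + of_nat 2) \<le> 431 / 100 + 1 / 2" "norm (z + of_nat 3) \<le> 495 / 100 + 1 / 2"
    "norm (z + of_nat 4) \<le> 571 / 100 + 1 / 2" "norm (z + of_nat 5) \<le> 652 / 100 + 1 / 2"
    by (rule b; simp add: power2_eq_square)+
  then have "norm (z + of_nat 0) * norm (z + of_nat 1) * norm (z + of_nat 2) * norm (z + of_nat 3) * norm (z + of_nat 4) * norm (z + of_nat 5)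
    \<le> (354 / 100 + 1 / 2) * (381 / 100 + 1 / 2) * (431 / 100 + 1 / 2) * (495 / 100 + 1 / 2) * (571 / 100 + 1 / 2) * (652 / 100 + 1 / 2)"
    by (intro mult_mono mult_nonneg_nonneg) auto
  also have "\<dots> \<le> 20000" by simp
  finally show ?thesis
    by (simp add: pochhammer_prod norm_mult eval_nat_numeral(2,3) atLeast0_lessThan_Suc mult_ac)
qed

text \<open>With N = n + 7, the terms are at most N^(-5) N^(-1/2) times the Pochhammer factor. Here
  N^(-1/2) is at most 7^(-1/2) < 379/1000, and N^(-5) is at most the telescoping difference ((N -
  1)^(-4) - N^(-4)) / 4, whose total is 1 / (4 * 6^4) = 1/5184.\<close>

lemma norm_alt_tail_le:
  assumes z: "Re z \<ge> - 1 / 2"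
  shows "norm (alt_tail 6 7 z) \<le> norm (pochhammer z 6) * (379 / 1000 * (1 / 5184))"
proof -
  let ?t = "\<lambda>n. 379 / 1000 * (1 / 4 * (1 / real (n + 6) ^ 4 - 1 / real (Suc n + 6) ^ 4))"
  have "(\<lambda>n. 1 / real (n + 6) ^ 4) \<longlonglongrightarrow> 0" by real_asymp
  then have t: "?t sums (379 / 1000 * (1 / 4 * (1 / real (0 + 6) ^ 4 - 0)))"
    by (intro sums_mult telescope_sums')
  have step: "norm ((-1) ^ n * powr_diff 6 z (of_nat (n + 7))) \<le> norm (pochhammer z 6) * ?t n" for n
  proof -
    let ?N = "real (n + 7)"
    have "?N powr (- 5 - 1 / 2) = ?N powr (- 5) * ?N powr (- 1 / 2)"
      by (simp flip: powr_add)
    also have "\<dots> \<le> (1 / 4 * (1 / real (n + 6) ^ 4 - 1 / real (Suc n + 6) ^ 4)) * (379 / 1000)"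
    proof (rule mult_mono)
      let ?M = "real (n + 6)"
      have M: "?M > 0" by simp
      have "?M ^ 4 * (?M + 5) \<le> (?M + 1) ^ 5"
        by (simp add: eval_nat_numeral algebra_simps)
      then have "4 * ?M ^ 4 \<le> (?M + 1) * ((?M + 1) ^ 4 - ?M ^ 4)"
        by (simp add: eval_nat_numeral algebra_simps)
      then have "1 / (?M + 1) ^ 5 \<le> 1 / 4 * (1 / ?M ^ 4 - 1 / (?M + 1) ^ 4)"
        using M by (simp add: divide_simps) (simp add: eval_nat_numeral algebra_simps)
      moreover have "?N powr (- 5) = 1 / (?M + 1) ^ 5"
        by (simp add: powr_minus powr_numeral field_simps)
      ultimately show "?N powr (- 5) \<le> 1 / 4 * (1 / real (n + 6) ^ 4 - 1 / real (Suc n + 6) ^ 4)"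
        by (simp add: add_ac)
      have "?N powr (- 1 / 2) \<le> 7 powr (- 1 / 2)" by (intro powr_mono2') auto
      also have "\<dots> = 1 / sqrt 7" by (simp add: powr_minus powr_half_sqrt field_simps)
      also have "\<dots> \<le> 1 / (1000 / 379)"
        by (intro divide_left_mono real_le_rsqrt) (auto simp: power2_eq_square)
      finally show "?N powr (- 1 / 2) \<le> 379 / 1000" by simp
      have "1 / real (Suc n + 6) ^ 4 \<le> 1 / real (n + 6) ^ 4" by (intro divide_left_mono power_mono) auto
      then show "0 \<le> 1 / 4 * (1 / real (n + 6) ^ 4 - 1 / real (Suc n + 6) ^ 4)" by simp
    qed auto
    finally have pw: "?N powr (- 5 - 1 / 2) \<le> ?t n" by (simp only: mult.commute)
    have "norm (powr_diff 6 z (of_real ?N)) \<le> norm (pochhammer z 6) * ?N powr (- Re z - real 6)"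
      using z by (intro norm_powr_diff_le) auto
    also have "\<dots> \<le> norm (pochhammer z 6) * ?N powr (- 5 - 1 / 2)"
    proof -
      have "- Re z - real 6 \<le> - 5 - 1 / 2" using z unfolding of_nat_numeral by argo
      then show ?thesis by (intro mult_left_mono powr_mono) auto
    qed
    also have "\<dots> \<le> norm (pochhammer z 6) * ?t n" by (rule mult_left_mono[OF pw]) simp
    finally show ?thesis by (simp add: norm_mult norm_power)
  qed
  have "norm (alt_tail 6 7 z) \<le> (\<Sum>n. norm (pochhammer z 6) * ?t n)"
    unfolding alt_tail_def by (rule norm_suminf_le[OF step]) (use t in \<open>auto simp: sums_iff intro!: summable_mult\<close>)
  also have "\<dots> = norm (pochhammer z 6) * (\<Sum>n. ?t n)"
    using t by (intro suminf_mult) (simp add: sums_iff)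
  also have "(\<Sum>n. ?t n) = 379 / 1000 * (1 / 5184)" using t by (simp add: sums_iff)
  finally show ?thesis .
qed

text \<open>Cauchy's inequality on a circle of radius 1/2. It may leave the strip, as the six-fold
  transformed series converges absolutely for \<open>Re s > -5\<close>; the radius explains the
  bound -1/2 in \<open>norm_alt_tail_le\<close>.\<close>

lemma norm_deriv_alt_tail_le:
  assumes s: "0 \<le> Re s" "Re s \<le> 1 / 2" "(Im s)\<^sup>2 \<le> 49 / 4"
  shows "norm (deriv (alt_tail 6 7) s) \<le> 2925 / 1000"
proof -
  have hol: "alt_tail 6 7 holomorphic_on {s. Re s > -5}" using alt_tail_holomorphic[of 7 6] by simp
  have sub: "Re z \<ge> - 1 / 2" if "z \<in> cball s (1 / 2)" for z
    using that complex_Re_le_cmod[of "s - z"] s by (simp add: dist_norm)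
  have "cball s (1 / 2) \<subseteq> {s. Re s > -5}" using sub by force
  note hol' = holomorphic_on_subset[OF hol this]
  have "norm ((deriv ^^ 1) (alt_tail 6 7) s) \<le> fact 1 * (20000 * (379 / 1000 * (1 / 5184))) / (1 / 2) ^ 1"
  proof (rule Cauchy_inequality)
    show "alt_tail 6 7 holomorphic_on ball s (1 / 2)" by (rule holomorphic_on_subset[OF hol']) auto
    show "continuous_on (cball s (1 / 2)) (alt_tail 6 7)" by (rule holomorphic_on_imp_continuous_on[OF hol'])
    fix z assume z: "norm (s - z) = 1 / 2"
    have "norm (alt_tail 6 7 z) \<le> norm (pochhammer z 6) * (379 / 1000 * (1 / 5184))"
      by (rule norm_alt_tail_le) (use z sub in \<open>auto simp: dist_norm\<close>)
    also have "\<dots> \<le> 20000 * (379 / 1000 * (1 / 5184))"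
      using norm_pochhammer_6_le[OF s, of z] z by (intro mult_right_mono) auto
    finally show "norm (alt_tail 6 7 z) \<le> 20000 * (379 / 1000 * (1 / 5184))" .
  qed auto
  then show ?thesis by simp
qed

section \<open>Taylor coefficients of the approximating polynomial\<close>

definition eta_coeff :: "nat \<Rightarrow> real" where
  "eta_coeff k = (\<Sum>(n, w, l)\<leftarrow>eta_data. - w * l * (- l) ^ k / fact k)"

text \<open>Numerators over 10^10 of the Taylor coefficients with k < 9, rounded to at most five
  significant digits so that shifting the polynomial stays cheap. The constant one is close to
  eta'(0) = ln (pi / 2) / 2.\<close>

definition eta_poly_ints :: "int list" where
  "eta_poly_ints = [2257900000, -610200000, -117430000, 83452000, -15663000, 316400, 464500, -111920, 12367]"

definition eta_poly_coeff :: "nat \<Rightarrow> real" where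
  "eta_poly_coeff k = of_int (nth_default 0 eta_poly_ints k) / 10 ^ 10"

definition eta_poly :: "complex poly" where
  "eta_poly = Poly (map (\<lambda>a. of_real (of_int a / 10 ^ 10)) eta_poly_ints)"

lemma norm_exp_minus_diff_le:
  fixes a b :: complex
  assumes "Re a \<ge> 0" "Re b \<ge> 0"
  shows "norm (exp (- a) - exp (- b)) \<le> norm (a - b)"
proof -
  have "norm (exp (- a) - exp (- b)) \<le> 1 * norm (a - b)"
  proof (rule field_differentiable_bound[OF convex_halfspace_Re_ge[of 0]])
    fix z :: complex assume "z \<in> {z. Re z \<ge> 0}"
    then show "norm (- exp (- z)) \<le> 1" by simp
    show "((\<lambda>z. exp (- z)) has_field_derivative - exp (- z)) (at z within {z. Re z \<ge> 0})"
      by (auto intro!: derivative_eq_intros)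
  qed (use assms in auto)
  then show ?thesis by simp
qed

lemma norm_sum_list_diff_le:
  fixes f g :: "'a \<Rightarrow> complex"
  assumes "\<And>x. x \<in> set xs \<Longrightarrow> norm (f x - g x) \<le> h x"
  shows "norm (sum_list (map f xs) - sum_list (map g xs)) \<le> sum_list (map h xs)"
  using assms
proof (induction xs)
  case (Cons x xs)
  have "norm ((f x - g x) + (sum_list (map f xs) - sum_list (map g xs))) \<le> h x + sum_list (map h xs)"
    using Cons by (intro norm_triangle_le add_mono) auto
  then show ?case by (simp add: algebra_simps)
qed simp

lemma sum_list_sum_commute:
  fixes f :: "'a \<Rightarrow> 'b \<Rightarrow> 'c :: comm_monoid_add"
  shows "(\<Sum>x\<leftarrow>xs. \<Sum>k\<in>A. f x k) = (\<Sum>k\<in>A. \<Sum>x\<leftarrow>xs. f x k)"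
  by (induction xs) (auto simp: sum.distrib)

lemma deriv_dirichlet_eta_eq:
  assumes s: "Re s > 0"
  shows "deriv dirichlet_eta s =
    (\<Sum>(n, w, l)\<leftarrow>eta_data. - of_real (w * ln n) * exp (- (of_real (ln n) * s))) + deriv (alt_tail 6 7) s / 64"
proof -
  have item: "((\<lambda>s. of_real w * of_real n powr (- s)) has_field_derivative - of_real (w * ln n) * exp (- (of_real (ln n) * s))) (at s)"
    if "n \<ge> 1" for n w :: real
  proof -
    have "complex_of_real n powr (- s) = exp (- (of_real (ln n) * s))" for s
      using that by (simp add: powr_def Ln_of_real mult.commute)
    then show ?thesis by (auto intro!: derivative_eq_intros simp: mult_ac)
  qed
  have list: "((\<lambda>s. \<Sum>(n, w, l)\<leftarrow>xs. of_real w * of_real n powr (- s)) has_field_derivative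
      (\<Sum>(n, w, l)\<leftarrow>xs. - of_real (w * ln n) * exp (- (of_real (ln n) * s)))) (at s)"
    if "\<And>n w l. (n, w, l) \<in> set xs \<Longrightarrow> n \<ge> 1" for xs :: "(real \<times> real \<times> real) list"
    using that
  proof (induction xs)
    case (Cons x xs)
    obtain n w l where x: "x = (n, w, l)" by (cases x)
    show ?case unfolding x list.map sum_list.Cons prod.case
      by (intro DERIV_add item Cons.IH) (use Cons.prems x in auto)
  qed auto
  have "alt_tail 6 7 holomorphic_on {s. Re s > 1 - real 6}" by (rule alt_tail_holomorphic) simp
  then have tl: "(alt_tail 6 7 has_field_derivative deriv (alt_tail 6 7) s) (at s)"
    by (rule holomorphic_derivI[OF _ open_halfspace_Re_gt]) (use s in auto)
  have "((\<lambda>s. (\<Sum>(n, w, l)\<leftarrow>eta_data. of_real w * of_real n powr (- s)) + alt_tail 6 7 s / 64) has_field_derivative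
    (\<Sum>(n, w, l)\<leftarrow>eta_data. - of_real (w * ln n) * exp (- (of_real (ln n) * s))) + deriv (alt_tail 6 7) s / 64) (at s)"
    by (intro DERIV_add list DERIV_cdivide tl eta_data_ln(4))
  then have "(dirichlet_eta has_field_derivative
    (\<Sum>(n, w, l)\<leftarrow>eta_data. - of_real (w * ln n) * exp (- (of_real (ln n) * s))) + deriv (alt_tail 6 7) s / 64) (at s)"
    by (rule has_field_derivative_transform_within_open[OF _ open_halfspace_Re_gt[of 0]])
       (use s dirichlet_eta_eta_data in auto)
  then show ?thesis by (rule DERIV_imp_deriv)
qed

lemma exp_5_4_le: "exp (5 / 4 :: real) \<le> 4"
proof -
  have "exp (5 / 4 :: real) \<le> exp (2 * ln 2)"
    using ln2_ge_two_thirds by simp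
  also have "\<dots> = 2 ^ 2" using exp_of_nat_mult[of 2 "ln (2::real)"] by simp
  finally show ?thesis by simp
qed

text \<open>Three errors add up: ln n against its approximation as a factor, the same in the
  exponent (where exp is 1-Lipschitz), and the Taylor remainder, which takes most of the bound. As
  \<open>l * norm s\<close> reaches 5/2 * 354/100 = 177/20, it takes a degree as high as 33 to make
  the remainder this small.\<close>

lemma exp_term_approx:
  assumes s: "0 \<le> Re s" "Re s \<le> 1 / 2" "norm s \<le> 354 / 100"
    and l: "\<bar>m - l\<bar> \<le> 1 / 10 ^ 6" "0 \<le> l" "l \<le> 5 / 2" "0 \<le> m"
  shows "norm (of_real m * exp (- (of_real m * s)) - of_real l * (\<Sum>k\<le>33. (- (of_real l * s)) ^ k / fact k))
    \<le> 1 / 5000"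
proof -
  let ?E = "\<lambda>x. exp (- (of_real x * s))"
  have "norm (of_real (m - l) * ?E m) \<le> 1 / 10 ^ 6 * 1"
    unfolding norm_mult norm_of_real using s l by (intro mult_mono) auto
  moreover have "norm (of_real l * (?E m - ?E l)) \<le> 5 / 2 * (1 / 10 ^ 6 * (354 / 100))"
  proof -
    have "norm (?E m - ?E l) \<le> norm (of_real m * s - of_real l * s)"
      using s l by (intro norm_exp_minus_diff_le) auto
    also have "\<dots> = \<bar>m - l\<bar> * norm s"
      by (simp only: left_diff_distrib[symmetric] of_real_diff[symmetric] norm_mult norm_of_real)
    also have "\<dots> \<le> 1 / 10 ^ 6 * (354 / 100)" using s l by (intro mult_mono) auto
    finally show ?thesis unfolding norm_mult norm_of_real using l by (intro mult_mono) auto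
  qed
  moreover have "norm (of_real l * (?E l - (\<Sum>k\<le>33. (- (of_real l * s)) ^ k / fact k))) \<le> 5 / 2 * (4 * (177 / 20) ^ 34 / fact 33)"
  proof -
    have "norm (?E l - (\<Sum>k\<le>33. (- (of_real l * s)) ^ k / fact k))
        \<le> exp \<bar>Re (- (of_real l * s))\<bar> * norm (- (of_real l * s)) ^ Suc 33 / fact 33"
      by (rule Taylor_exp)
    also have "\<dots> \<le> 4 * (177 / 20) ^ 34 / fact 33"
    proof (intro divide_right_mono mult_mono)
      have "l * Re s \<le> 5 / 2 * (1 / 2)" using s l by (intro mult_mono) auto
      moreover have "\<bar>Re (- (of_real l * s))\<bar> = l * Re s" using s l by (simp add: abs_mult)
      ultimately have "\<bar>Re (- (of_real l * s))\<bar> \<le> 5 / 4" by simp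
      then have "exp \<bar>Re (- (of_real l * s))\<bar> \<le> exp (5 / 4)" by simp
      then show "exp \<bar>Re (- (of_real l * s))\<bar> \<le> 4" using exp_5_4_le by linarith
      have "l * norm s \<le> 5 / 2 * (354 / 100)"
        using s l by (intro mult_mono) auto
      then have "norm (- (of_real l * s)) \<le> 177 / 20"
        using l by (simp add: norm_mult)
      then have "norm (- (of_real l * s)) ^ 34 \<le> (177 / 20) ^ 34" by (rule power_mono) simp
      then show "norm (- (of_real l * s)) ^ Suc 33 \<le> (177 / 20) ^ 34" by simp
    qed auto
    finally show ?thesis unfolding norm_mult norm_of_real using l by (intro mult_mono) auto
  qed
  moreover have "of_real m * ?E m - of_real l * (\<Sum>k\<le>33. (- (of_real l * s)) ^ k / fact k) =
      of_real (m - l) * ?E m + of_real l * (?E m - ?E l) + of_real l * (?E l - (\<Sum>k\<le>33. (- (of_real l * s)) ^ k / fact k))"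
    by (simp add: algebra_simps)
  moreover have "1 / 10 ^ 6 * 1 + 5 / 2 * (1 / 10 ^ 6 * (354 / 100)) + 5 / 2 * (4 * (177 / 20) ^ 34 / fact 33) \<le> (1 / 5000 :: real)"
    by (simp add: power_divide fact_numeral)
  ultimately show ?thesis by (smt (verit) norm_triangle_ineq)
qed

section \<open>Integer certificates for the coefficients\<close>

definition eta_int_sum :: "nat \<Rightarrow> int" where
  "eta_int_sum k = (\<Sum>(n, w, u)\<leftarrow>eta_int_data. w * u * (- u) ^ k)"

definition eta_denom :: "nat \<Rightarrow> int" where
  "eta_denom k = 64 * 2 ^ (18 * Suc k) * fact k"

text \<open>Powers of the radius cancel against those in l = u / (177/50 * 2^18), except for the one
  belonging to the factor l in front, which leaves 50 / 177.\<close>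

lemma eta_coeff_scaled: "eta_coeff k * (177 / 50) ^ k = - (50 * of_int (eta_int_sum k)) / (177 * of_int (eta_denom k))"
proof -
  have D: "of_int (eta_denom k) = (64 * (2 ^ 18) ^ Suc k * fact k :: real)"
    by (simp only: eta_denom_def of_int_mult of_int_power of_int_numeral of_int_fact power_mult)
  have "(\<Sum>(n, w, l)\<leftarrow>map (\<lambda>(n, w, u). (of_int n, of_int w / 64, of_int u / (177 / 50 * 2 ^ 18))) xs. - w * l * (- l) ^ k / fact k) * (177 / 50) ^ k =
    - (50 * of_int (\<Sum>(n, w, u)\<leftarrow>xs. w * u * (- u) ^ k)) / (177 * of_int (eta_denom k) :: real)"
    for xs :: "(int \<times> int \<times> int) list"
  proof (induction xs)
    case (Cons x xs)
    obtain n w u where x: "x = (n, w, u)" by (cases x)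
    have "(- (of_int u / (177 / 50 * 2 ^ 18))) ^ k * (177 / 50) ^ k = (- of_int u / 2 ^ 18 :: real) ^ k"
      unfolding power_mult_distrib[symmetric] by simp
    then have "- (of_int w / 64) * (of_int u / (177 / 50 * 2 ^ 18)) * (- (of_int u / (177 / 50 * 2 ^ 18))) ^ k / fact k * (177 / 50) ^ k =
        - (of_int w / 64) * (of_int u / (177 / 50 * 2 ^ 18)) * (- of_int u / 2 ^ 18) ^ k / (fact k :: real)"
      by (simp only: times_divide_eq_left mult.assoc)
    also have "\<dots> = - (50 * of_int (w * u * (- u) ^ k)) / (177 * of_int (eta_denom k))"
      unfolding D power_divide by (simp add: field_simps)
    finally have main: "- (of_int w / 64) * (of_int u / (177 / 50 * 2 ^ 18)) * (- (of_int u / (177 / 50 * 2 ^ 18))) ^ k / fact k * (177 / 50) ^ k =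
        - (50 * of_int (w * u * (- u) ^ k)) / (177 * of_int (eta_denom k) :: real)" .
    have "- (50 * of_int (w * u * (- u) ^ k)) / (177 * of_int (eta_denom k)) + - (50 * of_int (\<Sum>(n, w, u)\<leftarrow>xs. w * u * (- u) ^ k)) / (177 * of_int (eta_denom k)) =
        - (50 * of_int (\<Sum>(n, w, u)\<leftarrow>x # xs. w * u * (- u) ^ k)) / (177 * of_int (eta_denom k) :: real)"
      by (simp add: x add_divide_distrib[symmetric] algebra_simps)
    then show ?case unfolding Cons.IH[symmetric] main[symmetric] distrib_right[symmetric]
      by (simp only: x list.map sum_list.Cons prod.case)
  qed simp
  then show ?thesis unfolding eta_coeff_def eta_data_def eta_int_sum_def .
qed

text \<open>In units of 10^(-7), bounds at radius 177/50 for the coefficients of index 9 to 33,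
  which the polynomial drops. They make up nearly all of the total; the rounding errors of the first
  nine are tiny.\<close>

definition eta_coeff_errors_high :: "int list" where
  "eta_coeff_errors_high = [14205, 59480, 43312, 20909, 11794, 9796, 8337, 5774, 2972, 874, 255, 633, 606, 438, 269, 148, 74, 34, 15, 6, 3, 1, 1, 1, 1]"

definition eta_coeff_errors :: "int list" where
  "eta_coeff_errors = [21, 93, 62, 13, 28, 13, 13, 19, 4] @ eta_coeff_errors_high"

text \<open>The bound of \<open>eta_coeff_error\<close> cleared of denominators, where 500000000000
  = 50 * 10^10. For so few powers exact integers remain manageable.\<close>

lemma eta_coeff_error_low:
  "\<forall>k\<in>set [0, 1, 2, 3, 4, 5, 6, 7, 8]. \<bar>500000000000 * 50 ^ k * eta_int_sum k + eta_poly_ints ! k * 177 ^ Suc k * eta_denom k\<bar> * 10 ^ 7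
     \<le> eta_coeff_errors ! k * 177 * 10 ^ 10 * 50 ^ k * eta_denom k"
  by (simp add: eta_denom_def eta_int_sum_def eta_int_data_def eta_coeff_errors_def eta_poly_ints_def fact_numeral)

text \<open>Fixed-point lower approximations, with 32 binary places, of \<open>u ^ (k + 1) / k!\<close> where
  \<open>u\<close> is given with 18 binary places. As \<open>u < 9\<close>, the accumulated rounding error is bounded by
  \<open>taylor_fixed_error\<close> units in the last place.\<close>

primrec taylor_fixed :: "int \<Rightarrow> nat \<Rightarrow> int" where
  "taylor_fixed u 0 = u * 2 ^ 14"
| "taylor_fixed u (Suc k) = taylor_fixed u k * u div (2 ^ 18 * int (Suc k))"

primrec taylor_fixed_error :: "nat \<Rightarrow> int" where
  "taylor_fixed_error 0 = 0"
| "taylor_fixed_error (Suc k) = taylor_fixed_error k * 9 div int (Suc k) + 2"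

lemma real_div_bounds:
  fixes a b :: int
  assumes "b > 0"
  shows "real_of_int (a div b) \<le> real_of_int a / real_of_int b" "real_of_int a / real_of_int b \<le> real_of_int (a div b) + 1"
  using real_of_int_div3[of a b] real_of_int_div4[of a b] by simp_all

text \<open>The increment 2 in \<open>taylor_fixed_error\<close> pays one unit for the rounding in
  \<open>taylor_fixed\<close> and one for rounding down the propagated error itself.\<close>

lemma taylor_fixed_bounds:
  assumes "0 \<le> u" "u \<le> 9 * 2 ^ 18"
  defines "x \<equiv> real_of_int u / 2 ^ 18"
  shows "real_of_int (taylor_fixed u k) \<le> x ^ Suc k / fact k * 2 ^ 32
    \<and> x ^ Suc k / fact k * 2 ^ 32 \<le> real_of_int (taylor_fixed u k + taylor_fixed_error k) \<and> 0 \<le> taylor_fixed_error k"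
proof (induction k)
  case 0
  then show ?case by (simp add: x_def)
next
  case (Suc k)
  let ?t = "x ^ Suc k / fact k * 2 ^ 32" and ?l = "taylor_fixed u k" and ?e = "taylor_fixed_error k"
  have x: "0 \<le> x" "x \<le> 9"
    using assms(1,2) of_int_le_iff[of u "9 * 2 ^ 18", where 'a = real] by (simp_all add: x_def)
  have t: "x ^ Suc (Suc k) / fact (Suc k) * 2 ^ 32 = ?t * x / real (Suc k)"
    by (simp add: field_simps del: of_nat_Suc)
  have l: "real_of_int ?l * x / real (Suc k) = real_of_int (?l * u) / real_of_int (2 ^ 18 * int (Suc k))"
    by (simp add: x_def)
  have pos: "2 ^ 18 * int (Suc k) > 0" by simp
  have "real_of_int (taylor_fixed u (Suc k)) \<le> real_of_int ?l * x / real (Suc k)"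
    unfolding l taylor_fixed.simps by (rule real_div_bounds(1)[OF pos])
  also have "\<dots> \<le> ?t * x / real (Suc k)"
    using Suc x by (intro divide_right_mono mult_right_mono) auto
  finally have 1: "real_of_int (taylor_fixed u (Suc k)) \<le> ?t * x / real (Suc k)" .
  have "?t * x / real (Suc k) \<le> (real_of_int ?l + real_of_int ?e) * x / real (Suc k)"
    using Suc x by (intro divide_right_mono mult_right_mono) auto
  also have "\<dots> = real_of_int ?l * x / real (Suc k) + real_of_int ?e * x / real (Suc k)"
    by (simp add: distrib_right add_divide_distrib)
  also have "real_of_int ?l * x / real (Suc k) \<le> real_of_int (taylor_fixed u (Suc k)) + 1"
    unfolding l taylor_fixed.simps by (rule real_div_bounds(2)[OF pos])
  also have "real_of_int ?e * x / real (Suc k) \<le> real_of_int (?e * 9) / real_of_int (int (Suc k))"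
    using Suc x by (auto intro!: divide_right_mono mult_left_mono)
  also have "\<dots> \<le> real_of_int (?e * 9 div int (Suc k)) + 1"
    by (rule real_div_bounds(2)) simp
  finally have 2: "?t * x / real (Suc k) \<le> real_of_int (taylor_fixed u (Suc k) + taylor_fixed_error (Suc k))"
    by simp
  have "0 \<le> taylor_fixed_error (Suc k)"
    using Suc by (auto intro!: add_nonneg_nonneg simp: pos_imp_zdiv_nonneg_iff simp del: of_nat_Suc)
  then show ?case unfolding t using 1 2 by simp
qed

text \<open>The fixed-point values and their error bound are carried along, so that each coefficient
  costs one multiplication and one division per summand instead of a fresh evaluation of
  \<open>taylor_fixed\<close>. The factors stem from 50 / (177 * 64 * 2^32) and the unit 10^(-7),
  with 500000000 = 50 * 10^7.\<close>

primrec taylor_check :: "int list \<Rightarrow> nat \<Rightarrow> int \<Rightarrow> (int \<times> int \<times> int) list \<Rightarrow> bool" where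
  "taylor_check [] k e xs = True"
| "taylor_check (b # bs) k e xs =
    ((\<bar>\<Sum>(w, u, l)\<leftarrow>xs. w * l\<bar> + (\<Sum>(w, u, l)\<leftarrow>xs. \<bar>w\<bar>) * e) * 500000000 \<le> b * (177 * 64 * 2 ^ 32) \<and>
     taylor_check bs (Suc k) (e * 9 div int (Suc k) + 2) (map (\<lambda>(w, u, l). (w, u, l * u div (2 ^ 18 * int (Suc k)))) xs))"

lemma taylor_check_imp:
  assumes "taylor_check bs k (taylor_fixed_error k) (map (\<lambda>(w, u). (w, u, taylor_fixed u k)) xs)" "j < length bs"
  shows "(\<bar>\<Sum>(w, u)\<leftarrow>xs. w * taylor_fixed u (k + j)\<bar> + (\<Sum>(w, u)\<leftarrow>xs. \<bar>w\<bar>) * taylor_fixed_error (k + j)) * 500000000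
    \<le> bs ! j * (177 * 64 * 2 ^ 32)"
  using assms
proof (induction bs arbitrary: k j)
  case (Cons b bs)
  have "taylor_check bs (Suc k) (taylor_fixed_error (Suc k)) (map (\<lambda>(w, u). (w, u, taylor_fixed u (Suc k))) xs)"
    using Cons.prems(1) by (simp add: case_prod_unfold o_def)
  from Cons.IH[OF this, of "j - 1"] Cons.prems show ?case
    by (cases j) (auto simp: case_prod_unfold o_def)
qed simp

text \<open>The nine leading entries \<open>10 ^ 8\<close> are placeholders: the recursion has to
  start at 0, but those coefficients are treated exactly in
  \<open>eta_coeff_error_low\<close>.\<close>

lemma eta_taylor_check:
  "taylor_check (replicate 9 (10 ^ 8) @ eta_coeff_errors_high)
    0 (taylor_fixed_error 0) (map (\<lambda>(w, u). (w, u, taylor_fixed u 0)) (map snd eta_int_data))"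
proof -
  have "replicate 9 (10 ^ 8 :: int) = [100000000, 100000000, 100000000, 100000000, 100000000,
      100000000, 100000000, 100000000, 100000000]"
    by (simp add: eval_nat_numeral(2,3))
  then show ?thesis by (simp add: eta_int_data_def eta_coeff_errors_high_def)
qed

lemma eta_int_sum_eq:
  "real_of_int (eta_int_sum k) / real_of_int (eta_denom k) = (- 1) ^ k / (64 * 2 ^ 32) *
     (\<Sum>(w, u)\<leftarrow>map snd eta_int_data. real_of_int w * ((real_of_int u / 2 ^ 18) ^ Suc k / fact k * 2 ^ 32))"
proof -
  have D: "of_int (eta_denom k) = (64 * (2 ^ 18) ^ Suc k * fact k :: real)"
    by (simp only: eta_denom_def of_int_mult of_int_power of_int_numeral of_int_fact power_mult)
  have "real_of_int (\<Sum>(n, w, u)\<leftarrow>xs. w * u * (- u) ^ k) / real_of_int (eta_denom k) = (- 1) ^ k / (64 * 2 ^ 32) *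
     (\<Sum>(w, u)\<leftarrow>map snd xs. real_of_int w * ((real_of_int u / 2 ^ 18) ^ Suc k / fact k * 2 ^ 32))"
    for xs :: "(int \<times> int \<times> int) list"
  proof (induction xs)
    case (Cons x xs)
    obtain n w u where x: "x = (n, w, u)" by (cases x)
    have "real_of_int (w * u * (- u) ^ k) / real_of_int (eta_denom k) =
        (- 1) ^ k / (64 * 2 ^ 32) * (real_of_int w * ((real_of_int u / 2 ^ 18) ^ Suc k / fact k * 2 ^ 32))"
      unfolding D power_divide by (subst power_minus) (simp add: field_simps)
    then show ?case using Cons.IH unfolding x by (simp add: add_divide_distrib distrib_left)
  qed simp
  then show ?thesis unfolding eta_int_sum_def .
qed

lemma eta_coeff_error_high:
  assumes k: "9 \<le> k" "k < 34"
  shows "\<bar>eta_coeff k * (177 / 50) ^ k\<bar> \<le> of_int (eta_coeff_errors ! k) / 10 ^ 7"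
proof -
  let ?xs = "map snd eta_int_data"
  define T where "T u = (real_of_int u / 2 ^ 18) ^ Suc k / fact k * 2 ^ 32" for u
  define A where "A = (\<Sum>(w, u)\<leftarrow>?xs. real_of_int w * T u)"
  define L where "L = (\<Sum>(w, u)\<leftarrow>?xs. w * taylor_fixed u k)"
  define E where "E = (\<Sum>(w, u)\<leftarrow>?xs. \<bar>w\<bar>) * taylor_fixed_error k"
  have "\<bar>(\<Sum>(w, u)\<leftarrow>xs. real_of_int w * T u) - real_of_int (\<Sum>(w, u)\<leftarrow>xs. w * taylor_fixed u k)\<bar>
      \<le> real_of_int ((\<Sum>(w, u)\<leftarrow>xs. \<bar>w\<bar>) * taylor_fixed_error k)"
    if "\<And>w u. (w, u) \<in> set xs \<Longrightarrow> 0 \<le> u \<and> u \<le> 9 * 2 ^ 18" for xs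
    using that
  proof (induction xs)
    case (Cons x xs)
    obtain w u where x: "x = (w, u)" by (cases x)
    have "\<bar>T u - taylor_fixed u k\<bar> \<le> taylor_fixed_error k"
      using taylor_fixed_bounds[of u k] Cons.prems[of w u] x by (auto simp: T_def abs_le_iff)
    then have "\<bar>real_of_int w * (T u - taylor_fixed u k)\<bar> \<le> \<bar>real_of_int w\<bar> * taylor_fixed_error k"
      unfolding abs_mult by (intro mult_left_mono) auto
    moreover have "\<bar>(\<Sum>(w, u)\<leftarrow>xs. real_of_int w * T u) - real_of_int (\<Sum>(w, u)\<leftarrow>xs. w * taylor_fixed u k)\<bar>
      \<le> real_of_int ((\<Sum>(w, u)\<leftarrow>xs. \<bar>w\<bar>) * taylor_fixed_error k)" by (rule Cons.IH) (use Cons.prems in auto)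
    ultimately show ?case unfolding x
      by (simp add: right_diff_distrib distrib_right)
  qed simp
  moreover have "0 \<le> u \<and> u \<le> 9 * 2 ^ 18" if "(w, u) \<in> set ?xs" for w u
    using that by (auto simp: eta_int_data_def)
  ultimately have "\<bar>A - real_of_int L\<bar> \<le> real_of_int E" unfolding A_def L_def E_def by blast
  then have A: "\<bar>A\<bar> \<le> real_of_int (\<bar>L\<bar> + E)" by simp
  have "(\<bar>L\<bar> + E) * 500000000 \<le> eta_coeff_errors ! k * (177 * 64 * 2 ^ 32)"
  proof -
    have "k < length (replicate 9 (10 ^ 8 :: int) @ eta_coeff_errors_high)"
      using k by (simp add: eta_coeff_errors_high_def)
    from taylor_check_imp[OF eta_taylor_check this]
    have "(\<bar>L\<bar> + E) * 500000000 \<le> (replicate 9 (10 ^ 8) @ eta_coeff_errors_high) ! k * (177 * 64 * 2 ^ 32)"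
      unfolding L_def E_def add_0 .
    moreover have "eta_coeff_errors ! k = eta_coeff_errors_high ! (k - 9)"
      using k by (simp add: nth_append eta_coeff_errors_def eval_nat_numeral(2,3))
    moreover have "(replicate 9 (10 ^ 8) @ eta_coeff_errors_high) ! k = eta_coeff_errors_high ! (k - 9)"
      using k(1) unfolding nth_append length_replicate by simp
    ultimately show ?thesis by (simp only:)
  qed
  then have "real_of_int ((\<bar>L\<bar> + E) * 500000000) \<le> real_of_int (eta_coeff_errors ! k * (177 * 64 * 2 ^ 32))"
    by (simp only: of_int_le_iff)
  then have LE: "real_of_int (\<bar>L\<bar> + E) * 500000000 \<le> real_of_int (eta_coeff_errors ! k) * (177 * 64 * 2 ^ 32)" by simp
  have "eta_coeff k * (177 / 50) ^ k = - (50 / 177) * (real_of_int (eta_int_sum k) / real_of_int (eta_denom k))"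
    unfolding eta_coeff_scaled by simp
  also have "\<bar>\<dots>\<bar> = 50 / 177 * (\<bar>A\<bar> / (64 * 2 ^ 32))"
    unfolding eta_int_sum_eq A_def[symmetric, unfolded T_def] by (simp add: abs_mult)
  also have "\<dots> \<le> 50 / 177 * (real_of_int (\<bar>L\<bar> + E) / (64 * 2 ^ 32))"
    using A by (intro mult_left_mono divide_right_mono) auto
  also have "\<dots> \<le> of_int (eta_coeff_errors ! k) / 10 ^ 7"
    using LE by simp
  finally show ?thesis .
qed

lemma eta_coeff_error:
  assumes "k < 34"
  shows "\<bar>eta_coeff k - eta_poly_coeff k\<bar> * (177 / 50) ^ k \<le> of_int (eta_coeff_errors ! k) / 10 ^ 7"
proof -
  define D where "D = real_of_int (eta_denom k)"
  have D: "D > 0" by (simp add: D_def eta_denom_def)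
  have "\<bar>eta_coeff k - eta_poly_coeff k\<bar> * (177 / 50) ^ k = \<bar>eta_coeff k * (177 / 50) ^ k - eta_poly_coeff k * (177 / 50) ^ k\<bar>"
    by (simp add: abs_mult flip: left_diff_distrib)
  also have "\<dots> \<le> of_int (eta_coeff_errors ! k) / 10 ^ 7"
  proof (cases "k < 9")
    case True
    define a where "a = eta_poly_ints ! k"
    have "k \<in> set [0, 1, 2, 3, 4, 5, 6, 7, 8]" using True by auto
    from bspec[OF eta_coeff_error_low this]
    have le: "\<bar>500000000000 * 50 ^ k * of_int (eta_int_sum k) + of_int a * 177 ^ Suc k * D\<bar> * 10 ^ 7
       \<le> of_int (eta_coeff_errors ! k) * 177 * 10 ^ 10 * 50 ^ k * D"
      unfolding D_def a_def[symmetric] of_int_le_iff[where 'a = real, symmetric] by simp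
    have "eta_poly_coeff k = of_int a / 10 ^ 10"
      using True by (simp add: eta_poly_coeff_def a_def nth_default_def eta_poly_ints_def)
    then have "eta_coeff k * (177 / 50) ^ k - eta_poly_coeff k * (177 / 50) ^ k =
        - (500000000000 * 50 ^ k * of_int (eta_int_sum k) + of_int a * 177 ^ Suc k * D) / (177 * 10 ^ 10 * 50 ^ k * D)"
      unfolding eta_coeff_scaled D_def[symmetric] using D by (simp add: power_divide field_simps)
    also have "\<bar>\<dots>\<bar> = \<bar>500000000000 * 50 ^ k * of_int (eta_int_sum k) + of_int a * 177 ^ Suc k * D\<bar> / (177 * 10 ^ 10 * 50 ^ k * D)"
      using D by (simp add: abs_mult)
    also have "\<dots> \<le> of_int (eta_coeff_errors ! k) / 10 ^ 7"
      using le D by (subst pos_divide_le_eq) (auto simp: mult_ac)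
    finally show ?thesis .
  next
    case False
    then have "eta_poly_coeff k = 0" by (simp add: eta_poly_coeff_def nth_default_def eta_poly_ints_def)
    then show ?thesis using eta_coeff_error_high[of k] False assms by simp
  qed
  finally show ?thesis .
qed

lemma eta_coeff_error_sum:
  "(\<Sum>k\<le>33. \<bar>eta_coeff k - eta_poly_coeff k\<bar> * (177 / 50) ^ k) \<le> 182 / 10000"
proof -
  have "(\<Sum>k\<le>33. \<bar>eta_coeff k - eta_poly_coeff k\<bar> * (177 / 50) ^ k) \<le> (\<Sum>k\<le>33. of_int (eta_coeff_errors ! k) / 10 ^ 7)"
    by (intro sum_mono eta_coeff_error) auto
  also have "\<dots> = of_int (\<Sum>k\<le>33. eta_coeff_errors ! k) / 10 ^ 7"
    by (simp add: sum_divide_distrib)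
  also have "(\<Sum>k\<le>33. eta_coeff_errors ! k) \<le> 182000" by code_simp
  finally show ?thesis by simp
qed

lemma poly_eta_poly: "poly eta_poly s = (\<Sum>k\<le>33. of_real (eta_poly_coeff k) * s ^ k)"
  by (simp add: eta_poly_def eta_poly_coeff_def eta_poly_ints_def nth_default_def eval_nat_numeral(2,3) algebra_simps)

lemma cnj_poly_eta_poly: "cnj (poly eta_poly s) = poly eta_poly (cnj s)"
  unfolding poly_eta_poly by simp

text \<open>Error budget: 18/10000 for the exponentials (the weights have absolute sum 9, with
  1/5000 each), 182/10000 for the coefficients, 46/1000 for the derivative of the Euler
  remainder.\<close>

lemma deriv_dirichlet_eta_approx:
  assumes s: "0 < Re s" "Re s \<le> 1 / 2" "(Im s)\<^sup>2 \<le> 49 / 4"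
  shows "norm (deriv dirichlet_eta s - poly eta_poly s) \<le> 67 / 1000"
proof -
  have ns: "norm s \<le> 177 / 50"
  proof (rule power2_le_imp_le)
    have "(Re s)\<^sup>2 \<le> (1 / 2)\<^sup>2" using s by (intro power_mono) auto
    then show "(norm s)\<^sup>2 \<le> (177 / 50)\<^sup>2" using s(3) unfolding cmod_power2 by (simp add: power2_eq_square)
  qed simp
  let ?T = "\<lambda>l. \<Sum>k\<le>33. (- (of_real l * s)) ^ k / fact k"
  let ?A = "\<Sum>(n, w, l)\<leftarrow>eta_data. - of_real (w * ln n) * exp (- (of_real (ln n) * s))"
  let ?B = "\<Sum>(n, w, l)\<leftarrow>eta_data. - of_real w * (of_real l * ?T l)"
  have "norm (?A - ?B) \<le> (\<Sum>(n, w, l)\<leftarrow>eta_data. \<bar>w\<bar> * (1 / 5000))"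
  proof (rule norm_sum_list_diff_le)
    fix x assume x: "x \<in> set eta_data"
    obtain n w l where nwl: "x = (n, w, l)" by (cases x)
    have "norm (of_real (ln n) * exp (- (of_real (ln n) * s)) - of_real l * ?T l) \<le> 1 / 5000"
      by (rule exp_term_approx) (use s ns eta_data_ln x nwl in auto)
    then have "norm (- of_real w * (of_real (ln n) * exp (- (of_real (ln n) * s)) - of_real l * ?T l)) \<le> \<bar>w\<bar> * (1 / 5000)"
      unfolding norm_mult norm_minus_cancel norm_of_real by (intro mult_left_mono) auto
    then show "norm ((case x of (n, w, l) \<Rightarrow> - of_real (w * ln n) * exp (- (of_real (ln n) * s))) -
        (case x of (n, w, l) \<Rightarrow> - of_real w * (of_real l * ?T l))) \<le> (case x of (n, w, l) \<Rightarrow> \<bar>w\<bar> * (1 / 5000))"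
      unfolding nwl prod.case by (simp only: right_diff_distrib of_real_mult mult_minus_left mult.assoc)
  qed
  also have "\<dots> \<le> 18 / 10000" by (simp add: eta_data_def eta_int_data_def)
  finally have AB: "norm (?A - ?B) \<le> 18 / 10000" .
  have "?B = (\<Sum>(n, w, l)\<leftarrow>eta_data. \<Sum>k\<le>33. of_real (- w * l * (- l) ^ k / fact k) * s ^ k)"
    by (intro arg_cong[where f = sum_list] map_cong refl)
       (auto simp: sum_distrib_left power_mult_distrib power_minus' mult_ac intro!: sum.cong)
  also have "\<dots> = (\<Sum>k\<le>33. \<Sum>(n, w, l)\<leftarrow>eta_data. of_real (- w * l * (- l) ^ k / fact k) * s ^ k)"
    by (simp only: case_prod_unfold sum_list_sum_commute)
  also have "\<dots> = (\<Sum>k\<le>33. of_real (eta_coeff k) * s ^ k)"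
  proof (rule sum.cong[OF refl])
    fix k
    have "(\<Sum>(n, w, l)\<leftarrow>xs. of_real (- w * l * (- l) ^ k / fact k) * s ^ k) =
      of_real (\<Sum>(n, w, l)\<leftarrow>xs. - w * l * (- l) ^ k / fact k) * s ^ k" for xs :: "(real \<times> real \<times> real) list"
      by (induction xs) (auto simp: distrib_right)
    then show "(\<Sum>(n, w, l)\<leftarrow>eta_data. of_real (- w * l * (- l) ^ k / fact k) * s ^ k) = of_real (eta_coeff k) * s ^ k"
      unfolding eta_coeff_def .
  qed
  finally have B: "?B - poly eta_poly s = (\<Sum>k\<le>33. of_real (eta_coeff k - eta_poly_coeff k) * s ^ k)"
    unfolding poly_eta_poly by (simp add: sum_subtractf left_diff_distrib)
  have "norm (?B - poly eta_poly s) \<le> (\<Sum>k\<le>33. \<bar>eta_coeff k - eta_poly_coeff k\<bar> * (177 / 50) ^ k)"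
    unfolding B
  proof (rule sum_norm_le)
    fix k
    show "norm (of_real (eta_coeff k - eta_poly_coeff k) * s ^ k) \<le> \<bar>eta_coeff k - eta_poly_coeff k\<bar> * (177 / 50) ^ k"
      unfolding norm_mult norm_of_real norm_power using ns by (intro mult_left_mono power_mono) auto
  qed
  with eta_coeff_error_sum have BC: "norm (?B - poly eta_poly s) \<le> 182 / 10000" by linarith
  have "norm (deriv (alt_tail 6 7) s / 64) \<le> 46 / 1000"
    using norm_deriv_alt_tail_le[of s] s by (simp add: norm_divide)
  moreover have "deriv dirichlet_eta s - poly eta_poly s = (?A - ?B) + (?B - poly eta_poly s) + deriv (alt_tail 6 7) s / 64"
    using deriv_dirichlet_eta_eq[OF s(1)] by simp
  then have "norm (deriv dirichlet_eta s - poly eta_poly s) \<le>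
      norm (?A - ?B) + norm (?B - poly eta_poly s) + norm (deriv (alt_tail 6 7) s / 64)"
    by (simp only:) (rule order.trans[OF norm_triangle_ineq add_right_mono[OF norm_triangle_ineq]])
  ultimately show ?thesis using AB BC by linarith
qed

section \<open>A lower bound for the polynomial on three discs\<close>

primrec horner_bound :: "real list \<Rightarrow> real \<Rightarrow> real" where
  "horner_bound [] r = 0"
| "horner_bound (b # bs) r = b + r * horner_bound bs r"

lemma norm_poly_le_horner_bound:
  fixes bs :: "complex list"
  assumes "list_all2 (\<lambda>b B. norm b \<le> B) bs Bs" "norm z \<le> r"
  shows "norm (poly (Poly bs) z) \<le> horner_bound Bs r"
  using assms(1)
proof (induction rule: list_all2_induct)
  case (Cons b bs B Bs)
  have r: "0 \<le> r" using norm_ge_zero assms(2) by (rule order.trans)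
  have "norm (b + z * poly (Poly bs) z) \<le> B + r * horner_bound Bs r"
    by (intro norm_triangle_le add_mono Cons) (auto simp: norm_mult intro!: mult_mono Cons assms r)
  then show ?case by simp
qed simp

lemma norm_Complex_le: "a\<^sup>2 + b\<^sup>2 \<le> c\<^sup>2 \<Longrightarrow> 0 \<le> c \<Longrightarrow> norm (Complex a b) \<le> c"
  by (simp add: cmod_def real_le_lsqrt)

text \<open>One Horner step in the shifted variable, on coefficient lists: from p(y) to a + (m + y)
  p(y).\<close>

primrec mult_linear :: "'a :: comm_ring_1 \<Rightarrow> 'a \<Rightarrow> 'a list \<Rightarrow> 'a list" where
  "mult_linear m a [] = [a]"
| "mult_linear m a (t # ts) = (a + m * t) # mult_linear m t ts"

primrec taylor_shift :: "'a :: comm_ring_1 \<Rightarrow> 'a list \<Rightarrow> 'a list" where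
  "taylor_shift m [] = []"
| "taylor_shift m (a # as) = mult_linear m a (taylor_shift m as)"

lemma poly_mult_linear: "poly (Poly (mult_linear m a ts)) y = a + (m + y) * poly (Poly ts) y"
  by (induction ts arbitrary: a) (auto simp: algebra_simps)

lemma poly_taylor_shift: "poly (Poly (taylor_shift m as)) y = poly (Poly as) (m + y)"
  by (induction as) (auto simp: poly_mult_linear)

text \<open>In the variable 20 s and with denominators cleared, the centres of the discs are
  Gaussian integers, so the shifted coefficients are computed exactly in Gaussian integers.\<close>

definition eta_poly_scaled :: "complex list" where
  "eta_poly_scaled = [Complex (57802240000000000000) 0, Complex (-781056000000000000) 0, Complex (-7515520000000000) 0, Complex (267046400000000) 0, Complex (-2506080000000) 0, Complex (2531200000) 0, Complex (185800000) 0, Complex (-2238400) 0, Complex (12367) 0]"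

lemma poly_eta_poly_scaled: "poly (Poly eta_poly_scaled) (20 * s) = 10 ^ 10 * 20 ^ 8 * poly eta_poly s"
  by (simp add: eta_poly_scaled_def eta_poly_def eta_poly_ints_def Complex_eq algebra_simps)

text \<open>On the disc the polynomial deviates from its value \<open>b\<close> at the centre by at
  most r times the Horner bound for the other Taylor coefficients there. The threshold 67/1000 is
  the error allowed by \<open>deriv_dirichlet_eta_approx\<close>.\<close>

lemma eta_poly_disc_bound:
  assumes shift: "taylor_shift m eta_poly_scaled = b # bs"
    and b: "\<beta> \<le> norm b" and bs: "list_all2 (\<lambda>b B. norm b \<le> B) bs Bs"
    and s: "norm (20 * s - m) \<le> r" and margin: "67 / 1000 * (10 ^ 10 * 20 ^ 8) < \<beta> - r * horner_bound Bs r"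
  shows "67 / 1000 < norm (poly eta_poly s)"
proof -
  have r: "0 \<le> r" using norm_ge_zero s by (rule order.trans)
  have "10 ^ 10 * 20 ^ 8 * poly eta_poly s = b + (20 * s - m) * poly (Poly bs) (20 * s - m)"
    using poly_taylor_shift[of m eta_poly_scaled "20 * s - m"] unfolding shift poly_eta_poly_scaled[symmetric] by simp
  then have "norm b \<le> norm (10 ^ 10 * 20 ^ 8 * poly eta_poly s) + norm ((20 * s - m) * poly (Poly bs) (20 * s - m))"
    by (metis add_diff_cancel_right' norm_triangle_ineq4)
  also have "norm (10 ^ 10 * 20 ^ 8 * poly eta_poly s) = 10 ^ 10 * 20 ^ 8 * norm (poly eta_poly s)"
    by (simp add: norm_mult)
  also have "norm ((20 * s - m) * poly (Poly bs) (20 * s - m)) \<le> r * horner_bound Bs r"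
    unfolding norm_mult using s r norm_poly_le_horner_bound[OF bs s] by (intro mult_mono) auto
  finally show ?thesis using b margin by simp
qed

text \<open>In the variable s the three centres are 1/4, 1/4 + 9i/5 and 1/4 + 3i, with radii 22/20,
  16/20 and 13/20. The radii shrink because the linear coefficient, compared with the value at the
  centre, grows with the height.\<close>

lemma eta_poly_low:
  assumes "norm (20 * s - Complex 5 0) \<le> 22"
  shows "67 / 1000 < norm (poly eta_poly s)"
proof (rule eta_poly_disc_bound[OF _ _ _ assms])
  show "taylor_shift (Complex 5 0) eta_poly_scaled = Complex (53740897143080859375) (0) #
     [Complex (-837424603345625000) (0),
      Complex (-3880971609437500) (0),
      Complex (217975299225000) (0),
      Complex (-2382376943750) (0),
      Complex (7016609000) (0),
      Complex (116112900) (0),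
      Complex (-1743720) (0),
      Complex (12367) (0)]"
    by (simp add: eta_poly_scaled_def complex_add complex_mult)
  have "(53740800000000000000 :: real)\<^sup>2 \<le> (53740897143080859375)\<^sup>2 + (0)\<^sup>2" by (simp add: power2_eq_square)
  then show "53740800000000000000 \<le> norm (Complex (53740897143080859375) (0))"
    unfolding cmod_def complex.sel by (rule real_le_rsqrt)
  show "list_all2 (\<lambda>b B. norm b \<le> B)
     [Complex (-837424603345625000) (0),
      Complex (-3880971609437500) (0),
      Complex (217975299225000) (0),
      Complex (-2382376943750) (0),
      Complex (7016609000) (0),
      Complex (116112900) (0),
      Complex (-1743720) (0),
      Complex (12367) (0)]
     [837425000000000000, 3880980000000000, 217976000000000, 2382380000000, 7016610000, 116113000, 1743730, 12368]"
    by (simp add: norm_Complex_le power2_eq_square)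
  show "67 / 1000 * (10 ^ 10 * 20 ^ 8) < 53740800000000000000 - 22 * horner_bound [837425000000000000, 3880980000000000, 217976000000000, 2382380000000, 7016610000, 116113000, 1743730, 12368] 22"
    by simp
qed

lemma eta_poly_mid:
  assumes "norm (20 * s - Complex 5 36) \<le> 16"
  shows "67 / 1000 < norm (poly eta_poly s)"
proof (rule eta_poly_disc_bound[OF _ _ _ assms])
  show "taylor_shift (Complex 5 36) eta_poly_scaled = Complex (54551294072682033327) (-39756228606149438880) #
     [Complex (-1599416630757195560) (199551140215520544),
      Complex (16816000294677764) (18053505532550880),
      Complex (24532746181800) (-409533578026848),
      Complex (-3185584944710) (4110414631200),
      Complex (54473692520) (-7231319712),
      Complex (-332660796) (-439417440),
      Complex (-1743720) (3561696),
      Complex (12367) (0)]"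
    by (simp add: eta_poly_scaled_def complex_add complex_mult)
  have "(67501100000000000000 :: real)\<^sup>2 \<le> (54551294072682033327)\<^sup>2 + (-39756228606149438880)\<^sup>2" by (simp add: power2_eq_square)
  then show "67501100000000000000 \<le> norm (Complex (54551294072682033327) (-39756228606149438880))"
    unfolding cmod_def complex.sel by (rule real_le_rsqrt)
  show "list_all2 (\<lambda>b B. norm b \<le> B)
     [Complex (-1599416630757195560) (199551140215520544),
      Complex (16816000294677764) (18053505532550880),
      Complex (24532746181800) (-409533578026848),
      Complex (-3185584944710) (4110414631200),
      Complex (54473692520) (-7231319712),
      Complex (-332660796) (-439417440),
      Complex (-1743720) (3561696),
      Complex (12367) (0)]
     [1611820000000000000, 24672000000000000, 410268000000000, 5200340000000, 54951600000, 551137000, 3965640, 12368]"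
    by (simp add: norm_Complex_le power2_eq_square)
  show "67 / 1000 * (10 ^ 10 * 20 ^ 8) < 67501100000000000000 - 16 * horner_bound [1611820000000000000, 24672000000000000, 410268000000000, 5200340000000, 54951600000, 551137000, 3965640, 12368] 16"
    by simp
qed

lemma eta_poly_high:
  assumes "norm (20 * s - Complex 5 60) \<le> 13"
  shows "67 / 1000 < norm (poly eta_poly s)"
proof (rule eta_poly_disc_bound[OF _ _ _ assms])
  show "taylor_shift (Complex 5 60) eta_poly_scaled = Complex (33496607390855859375) (-86990725655737500000) #
     [Complex (-2167396569535625000) (1857435951547500000),
      Complex (53994865079562500) (-4394571691500000),
      Complex (-825574016775000) (-534849759300000),
      Complex (2566868856250) (15287505900000),
      Complex (138841841000) (-107790588000),
      Complex (-1130480700) (-732362400),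
      Complex (-1743720) (5936160),
      Complex (12367) (0)]"
    by (simp add: eta_poly_scaled_def complex_add complex_mult)
  have "(93216900000000000000 :: real)\<^sup>2 \<le> (33496607390855859375)\<^sup>2 + (-86990725655737500000)\<^sup>2" by (simp add: power2_eq_square)
  then show "93216900000000000000 \<le> norm (Complex (33496607390855859375) (-86990725655737500000))"
    unfolding cmod_def complex.sel by (rule real_le_rsqrt)
  show "list_all2 (\<lambda>b B. norm b \<le> B)
     [Complex (-2167396569535625000) (1857435951547500000),
      Complex (53994865079562500) (-4394571691500000),
      Complex (-825574016775000) (-534849759300000),
      Complex (2566868856250) (15287505900000),
      Complex (138841841000) (-107790588000),
      Complex (-1130480700) (-732362400),
      Complex (-1743720) (5936160),
      Complex (12367) (0)]
     [2854420000000000000, 54173500000000000, 983686000000000, 15501600000000, 175773000000, 1346980000, 6186970, 12368]"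
    by (simp add: norm_Complex_le power2_eq_square)
  show "67 / 1000 * (10 ^ 10 * 20 ^ 8) < 93216900000000000000 - 13 * horner_bound [2854420000000000000, 54173500000000000, 983686000000000, 15501600000000, 175773000000, 1346980000, 6186970, 12368] 13"
    by simp
qed

lemma deriv_dirichlet_eta_nonzero_low:
  assumes s: "0 < Re s" "Re s \<le> 1 / 2" "(Im s)\<^sup>2 \<le> 49 / 4"
  shows "deriv dirichlet_eta s \<noteq> 0"
proof -
  have upper: "67 / 1000 < norm (poly eta_poly s)"
    if s: "0 < Re s" "Re s \<le> 1 / 2" "0 \<le> Im s" "Im s \<le> 7 / 2" for s
  proof -
    have disc: "norm (20 * s - Complex 5 y) \<le> r" if h: "\<bar>20 * Im s - y\<bar> \<le> h" "h\<^sup>2 + 25 \<le> r\<^sup>2" "0 \<le> r" for y h r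
    proof (rule power2_le_imp_le[OF _ h(3)])
      have "\<bar>20 * Re s - 5\<bar> \<le> 5" using s(1,2) by (simp add: abs_le_iff)
      then have "(20 * Re s - 5)\<^sup>2 \<le> 5\<^sup>2" by (simp only: power2_le_iff_abs_le)
      moreover have "(20 * Im s - y)\<^sup>2 \<le> h\<^sup>2" using power_mono[OF h(1) abs_ge_zero, of 2] by simp
      moreover have "(norm (20 * s - Complex 5 y))\<^sup>2 = (20 * Re s - 5)\<^sup>2 + (20 * Im s - y)\<^sup>2"
        unfolding cmod_power2 by simp
      ultimately show "(norm (20 * s - Complex 5 y))\<^sup>2 \<le> r\<^sup>2" using h(2) by simp
    qed
    \<comment> \<open>In the variable 20 s the heights 0 to 70 are covered by the half-widths 21, 15
      and 10 around 0, 36 and 60. With the horizontal half-width 5 these boxes lie in the discs of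
      radius 22, 16 and 13.\<close>
    consider "Im s \<le> 21 / 20" | "21 / 20 \<le> Im s" "Im s \<le> 5 / 2" | "5 / 2 \<le> Im s" by linarith
    then show ?thesis
    proof cases
      case 1
      show ?thesis by (rule eta_poly_low, rule disc[of 0 21]) (use s 1 in \<open>auto simp: power2_eq_square abs_le_iff\<close>)
    next
      case 2
      show ?thesis by (rule eta_poly_mid, rule disc[of 36 "15"]) (use s 2 in \<open>auto simp: power2_eq_square abs_le_iff\<close>)
    next
      case 3
      show ?thesis by (rule eta_poly_high, rule disc[of 60 10]) (use s 3 in \<open>auto simp: power2_eq_square abs_le_iff\<close>)
    qed
  qed
  have im: "\<bar>Im s\<bar> \<le> 7 / 2"
    by (rule power2_le_imp_le) (use s in \<open>auto simp: power2_eq_square\<close>)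
  have "67 / 1000 < norm (poly eta_poly s)"
  proof (cases "Im s \<ge> 0")
    case True
    then show ?thesis using upper[of s] s im by simp
  next
    case False
    then have "67 / 1000 < norm (poly eta_poly (cnj s))" using upper[of "cnj s"] s im by simp
    then show ?thesis unfolding cnj_poly_eta_poly[symmetric] complex_mod_cnj .
  qed
  then show ?thesis using deriv_dirichlet_eta_approx[OF s] by auto
qed

theorem theorem4p1:
  fixes s :: complex
  assumes "riemann_hypothesis"
    and "0 < Re s" and "Re s < 1 / 2"
  shows "deriv dirichlet_eta s \<noteq> 0"
  using deriv_dirichlet_eta_nonzero_high[of s] deriv_dirichlet_eta_nonzero_low[of s] assms
  by (cases "49 / 4 \<le> (Im s)\<^sup>2") auto

end
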